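(* Let $E=E_1+E_2$ satisfy the assumptions (E.1)–(E.5) in the context. For every $K<\infty$ there exists a constant $C_1$ depending only on $K$ such that for all $\eta_0,\eta_1\in\mathcal E$ with $E(\eta_0),E(\eta_1)\le K$, $$\langle DE_1(\eta_1),\eta_1-\eta_0\rangle\ge E_1(\eta_1)-E_1(\eta_0)-C_1\|\nabla\eta_1-\nabla\eta_0\|_{L^2}^2.$$
   Context: $Q\subset\mathbb R^n$ is a bounded Lipschitz domain, $\partial Q=\Gamma_D\cup\Gamma_N$ with $\Gamma_D$ of positive $(n-1)$-dimensional measure; function spaces on $Q$ are $\mathbb R^n$-valued. $X=W^{2,q}(Q)$ with $q>n$, or $X=W^{k_0,2}(Q)$ with $k_0>n/2+1$ (so $X$ embeds compactly in $C^{1,\alpha}$ for small $\alpha>0$). $\mathcal E=\{\eta\in X:\ |\eta(Q)|=\int_Q\det\nabla\eta\,dx,\ \eta(x)=x\text{ for }x\in\Gamma_D\}$. Assumptions on $E:X\to(-\infty,\infty]$: $E=E_1+E_2$, $E_1(\eta)=\int_Qe(\nabla\eta)\,dx$ with $e:\mathbb R^{n\times n}\to(-\infty,\infty]$ and (E.1) $e\in C^2(\mathbb R^{n\times n}_{\det>0})$, where $\mathbb R^{n\times n}_{\det>0}=\{M:\det M>0\}$; (E.2) there is $e_{\min}>-\infty$ with $e\ge e_{\min}$; (E.3) for all $K<\infty$ there is $\epsilon_0>0$ such that for each $\eta\in X$, $E(\eta)\le K$ implies $\det\nabla\eta\ge\epsilon_0$ in $Q$; (E.4) $e(\xi)\to\infty$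 as $\det\xi\to0$ with $\det\xi>0$, and $e(\xi)=\infty$ for $\det\xi\le0$; (E.5) $E_2$ is convex, coercive and differentiable on $X$; coercivity together with the boundary values on $\Gamma_D$ means that sublevel sets of $E$ in $\mathcal E$ are bounded in $X$. For $\eta$ with finite energy, $\langle DE_1(\eta),\gamma\rangle=\int_Q\nabla_\xi e(\nabla\eta):\nabla\gamma\,dx$, where $\nabla_\xi e$ is the gradient of $e$. "Depending only on $K$" means for fixed $Q$, $X$, $\Gamma_D$ and $E$. *)

theory Defs
  imports "HOL-Analysis.Analysis"
begin

section \<open>Lipschitz domains and Hausdorff measure\<close>

text \<open>
  Near each boundary point, after a rigid motion, the domain is the region strictly above the
  graph of a Lipschitz function. The vertical direction of the rotated coordinates is the unit
  vector \<open>\<nu>\<close>; the horizontal coordinates are the orthogonal projection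
  \<open>y - (y \<bullet> \<nu>) \<nu>\<close>, so \<open>g\<close> is a function on the hyperplane orthogonal to \<open>\<nu>\<close>.
\<close>

definition bounded_lipschitz_domain :: "(real ^ 'n) set \<Rightarrow> bool" where
  "bounded_lipschitz_domain Q \<longleftrightarrow>
     Q \<noteq> {} \<and> open Q \<and> connected Q \<and> bounded Q \<and>
     (\<forall>x \<in> frontier Q. \<exists>r > 0. \<exists>\<nu> g L. norm \<nu> = 1 \<and> L-lipschitz_on {z. z \<bullet> \<nu> = 0} g \<and>
        Q \<inter> ball x r = {y \<in> ball x r. g (y - (y \<bullet> \<nu>) *\<^sub>R \<nu>) < y \<bullet> \<nu>})"

text \<open>
  The case distinction gives the empty set weight 0 also for \<open>d = 0\<close>.
\<close>

definition hausdorff_pre :: "nat \<Rightarrow> real \<Rightarrow> ('a::metric_space) set \<Rightarrow> ennreal" where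
  "hausdorff_pre d \<delta> A =
     (INF C \<in> {C :: nat \<Rightarrow> 'a set. A \<subseteq> (\<Union>i. C i) \<and> (\<forall>i. bounded (C i) \<and> diameter (C i) \<le> \<delta>)}.
        \<Sum>i. if C i = {} then 0 else ennreal (unit_ball_vol (real d) * (diameter (C i) / 2) ^ d))"

definition hausdorff_measure :: "nat \<Rightarrow> ('a::metric_space) set \<Rightarrow> ennreal" where
  "hausdorff_measure d A = (SUP \<delta> \<in> {0<..}. hausdorff_pre d \<delta> A)"

section \<open>Weak derivatives and Sobolev spaces\<close>

text \<open>
  Higher partial derivatives are indexed by lists of coordinate directions: \<open>[j\<^sub>1, \<dots>, j\<^sub>m]\<close>
  stands for \<open>\<partial>\<^bsub>j\<^sub>1\<^esub> \<dots> \<partial>\<^bsub>j\<^sub>m\<^esub>\<close>.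
\<close>

definition partial :: "'n \<Rightarrow> (real ^ 'n \<Rightarrow> real) \<Rightarrow> real ^ 'n \<Rightarrow> real" where
  "partial j \<phi> x = frechet_derivative \<phi> (at x) (axis j 1)"

definition partials :: "'n list \<Rightarrow> (real ^ 'n \<Rightarrow> real) \<Rightarrow> real ^ 'n \<Rightarrow> real" where
  "partials js \<phi> = foldr partial js \<phi>"

definition test_functions :: "(real ^ 'n) set \<Rightarrow> (real ^ 'n \<Rightarrow> real) set" where
  "test_functions Q = {\<phi>. (\<forall>js x. partials js \<phi> differentiable (at x)) \<and>
     compact (closure {x. \<phi> x \<noteq> 0}) \<and> closure {x. \<phi> x \<noteq> 0} \<subseteq> Q}"

definition locally_integrable :: "(real ^ 'n) set \<Rightarrow> (real ^ 'n \<Rightarrow> 'b::euclidean_space) \<Rightarrow> bool" where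
  "locally_integrable Q u \<longleftrightarrow> (\<forall>K. compact K \<and> K \<subseteq> Q \<longrightarrow> u absolutely_integrable_on K)"

definition weak_deriv ::
  "(real ^ 'n) set \<Rightarrow> 'n list \<Rightarrow> (real ^ 'n \<Rightarrow> 'b::euclidean_space) \<Rightarrow> (real ^ 'n \<Rightarrow> 'b) \<Rightarrow> bool" where
  "weak_deriv Q js u g \<longleftrightarrow> locally_integrable Q u \<and> locally_integrable Q g \<and>
     (\<forall>\<phi> \<in> test_functions Q.
        (LINT x|lebesgue_on Q. partials js \<phi> x *\<^sub>R u x) =
        (-1) ^ length js *\<^sub>R (LINT x|lebesgue_on Q. \<phi> x *\<^sub>R g x))"

text \<open>A weak derivative is determined only up to a null set; this picks one representative.\<close>

definition wderiv ::
  "(real ^ 'n) set \<Rightarrow> 'n list \<Rightarrow> (real ^ 'n \<Rightarrow> 'b::euclidean_space) \<Rightarrow> real ^ 'n \<Rightarrow> 'b" where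
  "wderiv Q js u = (SOME g. weak_deriv Q js u g)"

definition Lp_fun :: "(real ^ 'n) set \<Rightarrow> real \<Rightarrow> (real ^ 'n \<Rightarrow> 'b::euclidean_space) \<Rightarrow> bool" where
  "Lp_fun Q p u \<longleftrightarrow> u \<in> borel_measurable (lebesgue_on Q) \<and>
     integrable (lebesgue_on Q) (\<lambda>x. norm (u x) powr p)"

definition Lp_norm :: "(real ^ 'n) set \<Rightarrow> real \<Rightarrow> (real ^ 'n \<Rightarrow> 'b::euclidean_space) \<Rightarrow> real" where
  "Lp_norm Q p u = (LINT x|lebesgue_on Q. norm (u x) powr p) powr (1 / p)"

definition in_sobolev :: "(real ^ 'n) set \<Rightarrow> nat \<Rightarrow> real \<Rightarrow> (real ^ 'n \<Rightarrow> 'b::euclidean_space) \<Rightarrow> bool" where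
  "in_sobolev Q k p u \<longleftrightarrow>
     (\<forall>js. length js \<le> k \<longrightarrow> (\<exists>g. weak_deriv Q js u g \<and> Lp_fun Q p g))"

definition sobolev_norm :: "(real ^ 'n) set \<Rightarrow> nat \<Rightarrow> real \<Rightarrow> (real ^ 'n \<Rightarrow> 'b::euclidean_space) \<Rightarrow> real" where
  "sobolev_norm Q k p u =
     (\<Sum>js \<in> {js. length js \<le> k}. Lp_norm Q p (wderiv Q js u) powr p) powr (1 / p)"

text \<open>
  Let \<open>k\<close>, \<open>p\<close> be such that \<open>W\<^sup>k\<^sup>,\<^sup>p(Q)\<close> embeds in the continuous functions on the closure of
  \<open>Q\<close>. An element of the Sobolev space is then identified with its unique representative that is
  continuous on the closure; setting it to 0 elsewhere makes it unique as a total function. Images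
  \<open>\<eta>(Q)\<close> and boundary values refer to this representative.
\<close>

definition sobolev_space :: "(real ^ 'n) set \<Rightarrow> nat \<Rightarrow> real \<Rightarrow> (real ^ 'n \<Rightarrow> real ^ 'n) set" where
  "sobolev_space Q k p = {\<eta>. in_sobolev Q k p \<eta> \<and> continuous_on (closure Q) \<eta> \<and>
     (\<forall>x. x \<notin> closure Q \<longrightarrow> \<eta> x = 0)}"

definition wgrad :: "(real ^ 'n) set \<Rightarrow> (real ^ 'n \<Rightarrow> real ^ 'n) \<Rightarrow> real ^ 'n \<Rightarrow> real ^ 'n ^ 'n" where
  "wgrad Q \<eta> x = (\<chi> i j. wderiv Q [j] \<eta> x $ i)"

section \<open>Deformations and energy\<close>

definition admissible ::
  "(real ^ 'n) set \<Rightarrow> nat \<Rightarrow> real \<Rightarrow> (real ^ 'n) set \<Rightarrow> (real ^ 'n \<Rightarrow> real ^ 'n) set" where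
  "admissible Q k p \<Gamma>D = {\<eta> \<in> sobolev_space Q k p.
     measure lebesgue (\<eta> ` Q) = (LINT x|lebesgue_on Q. det (wgrad Q \<eta> x)) \<and>
     (\<forall>x \<in> \<Gamma>D. \<eta> x = x)}"

text \<open>
  Positive part minus negative part. In \<open>ereal\<close>, \<open>\<infinity> - \<infinity>\<close> is \<open>\<infinity>\<close>, but this does not occur for
  integrands bounded below on a set of finite measure.
\<close>

definition ext_integral :: "'a measure \<Rightarrow> ('a \<Rightarrow> ereal) \<Rightarrow> ereal" where
  "ext_integral M f =
     enn2ereal (\<integral>\<^sup>+ x. e2ennreal (f x) \<partial>M) - enn2ereal (\<integral>\<^sup>+ x. e2ennreal (- f x) \<partial>M)"

definition E1 :: "(real ^ 'n) set \<Rightarrow> (real ^ 'n ^ 'n \<Rightarrow> ereal) \<Rightarrow> (real ^ 'n \<Rightarrow> real ^ 'n) \<Rightarrow> ereal" where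
  "E1 Q e \<eta> = ext_integral (lebesgue_on Q) (\<lambda>x. e (wgrad Q \<eta> x))"

definition energy ::
  "(real ^ 'n) set \<Rightarrow> (real ^ 'n ^ 'n \<Rightarrow> ereal) \<Rightarrow> ((real ^ 'n \<Rightarrow> real ^ 'n) \<Rightarrow> real) \<Rightarrow>
   (real ^ 'n \<Rightarrow> real ^ 'n) \<Rightarrow> ereal" where
  "energy Q e E2 \<eta> = E1 Q e \<eta> + ereal (E2 \<eta>)"

definition grad :: "('a::real_inner \<Rightarrow> real) \<Rightarrow> 'a \<Rightarrow> 'a" where
  "grad f x = (THE D. GDERIV f x :> D)"

text \<open>The inner product on matrices is the Frobenius product \<open>A : B\<close>.\<close>

definition DE1 ::
  "(real ^ 'n) set \<Rightarrow> (real ^ 'n ^ 'n \<Rightarrow> ereal) \<Rightarrow> (real ^ 'n \<Rightarrow> real ^ 'n) \<Rightarrow>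
   (real ^ 'n \<Rightarrow> real ^ 'n) \<Rightarrow> real" where
  "DE1 Q e \<eta> \<gamma> =
     (LINT x|lebesgue_on Q. grad (\<lambda>\<xi>. real_of_ereal (e \<xi>)) (wgrad Q \<eta> x) \<bullet> wgrad Q \<gamma> x)"

definition C2_on :: "'a::real_normed_vector set \<Rightarrow> ('a \<Rightarrow> real) \<Rightarrow> bool" where
  "C2_on S f \<longleftrightarrow> (\<exists>(f' :: 'a \<Rightarrow> 'a \<Rightarrow>\<^sub>L real) (f'' :: 'a \<Rightarrow> 'a \<Rightarrow>\<^sub>L 'a \<Rightarrow>\<^sub>L real).
     (\<forall>x \<in> S. (f has_derivative blinfun_apply (f' x)) (at x)) \<and>
     (\<forall>x \<in> S. (f' has_derivative blinfun_apply (f'' x)) (at x)) \<and>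
     continuous_on S f'')"

text \<open>Convexity and Frechet differentiability of a functional on \<open>sobolev_space Q k p\<close>.\<close>

definition convex_on_sobolev ::
  "(real ^ 'n) set \<Rightarrow> nat \<Rightarrow> real \<Rightarrow> ((real ^ 'n \<Rightarrow> real ^ 'n) \<Rightarrow> real) \<Rightarrow> bool" where
  "convex_on_sobolev Q k p F \<longleftrightarrow>
     (\<forall>\<eta> \<in> sobolev_space Q k p. \<forall>\<gamma> \<in> sobolev_space Q k p. \<forall>t \<in> {0..1}.
        F (\<lambda>x. (1 - t) *\<^sub>R \<eta> x + t *\<^sub>R \<gamma> x) \<le> (1 - t) * F \<eta> + t * F \<gamma>)"

definition bounded_linear_on_sobolev ::
  "(real ^ 'n) set \<Rightarrow> nat \<Rightarrow> real \<Rightarrow> ((real ^ 'n \<Rightarrow> real ^ 'n) \<Rightarrow> real) \<Rightarrow> bool" where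
  "bounded_linear_on_sobolev Q k p L \<longleftrightarrow>
     (\<forall>\<eta> \<in> sobolev_space Q k p. \<forall>\<gamma> \<in> sobolev_space Q k p. \<forall>a b.
        L (\<lambda>x. a *\<^sub>R \<eta> x + b *\<^sub>R \<gamma> x) = a * L \<eta> + b * L \<gamma>) \<and>
     (\<exists>B. \<forall>\<eta> \<in> sobolev_space Q k p. \<bar>L \<eta>\<bar> \<le> B * sobolev_norm Q k p \<eta>)"

definition differentiable_on_sobolev ::
  "(real ^ 'n) set \<Rightarrow> nat \<Rightarrow> real \<Rightarrow> ((real ^ 'n \<Rightarrow> real ^ 'n) \<Rightarrow> real) \<Rightarrow> bool" where
  "differentiable_on_sobolev Q k p F \<longleftrightarrow>
     (\<forall>\<eta> \<in> sobolev_space Q k p. \<exists>L. bounded_linear_on_sobolev Q k p L \<and>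
        (\<forall>\<epsilon> > 0. \<exists>\<delta> > 0. \<forall>\<gamma> \<in> sobolev_space Q k p. sobolev_norm Q k p \<gamma> < \<delta> \<longrightarrow>
           \<bar>F (\<lambda>x. \<eta> x + \<gamma> x) - F \<eta> - L \<gamma>\<bar> \<le> \<epsilon> * sobolev_norm Q k p \<gamma>))"

text \<open>
  Coercivity of \<open>E\<^sub>2\<close> in combination with the boundary condition: sublevel sets of the total
  energy among admissible deformations are bounded in the Sobolev norm.
\<close>

definition coercive_on_admissible ::
  "(real ^ 'n) set \<Rightarrow> nat \<Rightarrow> real \<Rightarrow> (real ^ 'n) set \<Rightarrow> (real ^ 'n ^ 'n \<Rightarrow> ereal) \<Rightarrow>
   ((real ^ 'n \<Rightarrow> real ^ 'n) \<Rightarrow> real) \<Rightarrow> bool" where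
  "coercive_on_admissible Q k p \<Gamma>D e E2 \<longleftrightarrow>
     (\<forall>K::real. \<exists>R. \<forall>\<eta> \<in> admissible Q k p \<Gamma>D.
        energy Q e E2 \<eta> \<le> ereal K \<longrightarrow> sobolev_norm Q k p \<eta> \<le> R)"

end

theory Submission
  imports Defs
begin

text \<open>
  Deformations of energy at most \<open>K\<close> are bounded in \<open>X\<close>, so by Sobolev embedding their gradients
  stay in a ball, and by (E.3) they stay in the compact set \<open>|\<xi>| \<le> M\<close>, \<open>det \<xi> \<ge> \<epsilon>\<^sub>0\<close>. This set is
  not convex, but nearby points of it are joined by segments inside \<open>det > 0\<close>, where Taylor's
  formula gives the inequality pointwise; for points at distance at least \<open>\<delta>\<close> everything is bounded,
  and a bounded quantity is at most a constant times \<open>|\<xi>\<^sub>1 - \<xi>\<^sub>0|\<^sup>2\<close>.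

  The embedding into \<open>L\<^sup>\<infinity>\<close> uses the interior cone condition: for \<open>x\<close> in \<open>Q\<close> and a bump \<open>\<psi>\<close>
  supported in the cone, \<open>F(t) = \<integral> v(x + t z) \<psi>(z) dz\<close> only tests \<open>v\<close> against functions with
  compact support in \<open>Q\<close>, and \<open>F'(t)\<close> is a sum of averages of the same form of the weak partial
  derivatives of \<open>v\<close>. Averages of \<open>L\<^sup>p\<close> functions are \<open>O(t powr - (n / p))\<close>, each integration in \<open>t\<close> gains
  one power of \<open>t\<close>, and \<open>F(t)\<close> converges to \<open>v(x)\<close> in \<open>L\<^sup>1\<close> as \<open>t\<close> tends to 0.
\<close>

section \<open>Smooth functions\<close>

text \<open>The embedding is applied to the first weak derivatives, which have \<open>k - 1\<close>
  further ones in \<open>L^p\<close>. Both alternatives for \<open>X\<close> say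
  \<open>n / p < k - 1\<close>, so one argument covers them. The cone replaces extension across the
  boundary and density of functions smooth up to it: the kernels stay in \<open>Q\<close> however
  close \<open>x\<close> is to the frontier. That \<open>F'\<close> carries no negative power of
  \<open>t\<close> is the chain rule: the point \<open>x + t z\<close> moves with velocity
  \<open>z\<close>, so \<open>F'\<close> averages \<open>z\<close> times the gradient of
  \<open>v\<close>. As \<open>v\<close> has only weak derivatives, the scale is put on the kernel
  and the chain rule becomes an integration by parts. Convergence in \<open>L^1\<close> is enough
  because only a bound on the gradient is wanted, not its continuity; \<open>wderiv\<close> is an
  arbitrary representative, so pointwise statements about gradients hold almost everywhere. The
  lower bound on the determinant keeps gradients away from the set where \<open>e\<close> and its
  derivatives may blow up; the compact set, and with it the constant, is fixed by \<open>K\<close>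
  before any deformation is chosen.\<close>

primrec ndiff :: "nat \<Rightarrow> (real ^ 'n \<Rightarrow> real) \<Rightarrow> bool" where
  "ndiff 0 f = (\<forall>x. f differentiable (at x))"
| "ndiff (Suc m) f = ((\<forall>x. f differentiable (at x)) \<and> (\<forall>j. ndiff m (partial j f)))"

text \<open>\<open>ndiff\<close> recurses on the innermost derivative, so that the product and chain
  rules close under induction on the order, with no Leibniz formula over lists of
  directions.\<close>

definition smooth :: "(real ^ 'n \<Rightarrow> real) \<Rightarrow> bool" where
  "smooth f \<longleftrightarrow> (\<forall>m. ndiff m f)"

lemma ndiff_differentiable: "ndiff m f \<Longrightarrow> f differentiable (at x)"
  by (cases m) auto

lemma ndiff_Suc_imp: "ndiff (Suc m) f \<Longrightarrow> ndiff m f"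
proof (induction m arbitrary: f)
  case (Suc m)
  have "\<forall>j. ndiff m (partial j f)"
    using Suc.IH Suc.prems by auto
  then show ?case
    using Suc.prems by simp
qed simp

lemma partials_Nil [simp]: "partials [] f = f"
  and partials_Cons: "partials (j # js) f = partial j (partials js f)"
  by (simp_all add: partials_def)

lemma partials_snoc: "partials (js @ [j]) f = partials js (partial j f)"
  by (simp add: partials_def)

lemma ndiff_partials: "ndiff m f \<Longrightarrow> length js \<le> m \<Longrightarrow> ndiff (m - length js) (partials js f)"
proof (induction js arbitrary: m f rule: rev_induct)
  case (snoc j js)
  then obtain m' where m': "m = Suc m'"
    by (cases m) auto
  then show ?case
    using snoc.IH[of m' "partial j f"] snoc.prems by (auto simp: partials_snoc)
qed simp

text \<open>Bridge to the condition in \<open>test_functions\<close>. Both directions peel off the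
  innermost direction, which \<open>partials_snoc\<close> exposes at the end of the list.\<close>

lemma smooth_iff_partials: "smooth f \<longleftrightarrow> (\<forall>js x. partials js f differentiable (at x))"
proof
  show "\<forall>js x. partials js f differentiable (at x)" if "smooth f"
  proof (intro allI)
    fix js x
    show "partials js f differentiable (at x)"
      using that ndiff_partials[of "length js" f js] by (auto simp: smooth_def)
  qed
next
  assume *: "\<forall>js x. partials js f differentiable (at x)"
  have "\<forall>js x. partials js f differentiable (at x) \<Longrightarrow> ndiff m f" for m
  proof (induction m arbitrary: f)
    case 0
    then show ?case
      using partials_Nil[of f] by (metis ndiff.simps(1))
  next
    case (Suc m)
    have "ndiff m (partial j f)" for j
    proof (rule Suc.IH)
      show "\<forall>js x. partials js (partial j f) differentiable at x"
        using Suc.prems by (metis partials_snoc)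
    qed
    then show ?case
      using Suc.prems partials_Nil[of f] by (metis ndiff.simps(2))
  qed
  then show "smooth f"
    using * by (simp add: smooth_def)
qed

lemma smooth_differentiable: "smooth f \<Longrightarrow> f differentiable (at x)"
  unfolding smooth_def using ndiff_differentiable by blast

lemma smooth_partial: "smooth f \<Longrightarrow> smooth (partial j f)"
  unfolding smooth_def by (metis ndiff.simps(2))

lemma partial_eqI: "(f has_derivative f') (at x) \<Longrightarrow> partial j f x = f' (axis j 1)"
  unfolding partial_def using frechet_derivative_at by metis

text \<open>Normal form from which the rules for \<open>partial\<close> are read off by evaluating
  at \<open>axis j 1\<close>.\<close>

lemma differentiable_has_derivative_partial:
  assumes "f differentiable (at x)"
  shows "(f has_derivative (\<lambda>h. \<Sum>i\<in>UNIV. h $ i * partial i f x)) (at x)"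
proof -
  have d: "(f has_derivative frechet_derivative f (at x)) (at x)"
    using assms by (simp add: frechet_derivative_works)
  interpret linear "frechet_derivative f (at x)"
    using d by (rule has_derivative_linear)
  have "frechet_derivative f (at x) h = (\<Sum>i\<in>UNIV. h $ i * partial i f x)" for h
  proof -
    have "frechet_derivative f (at x) h = frechet_derivative f (at x) (\<Sum>i\<in>UNIV. h $ i *\<^sub>R axis i 1)"
      by (simp add: basis_expansion scalar_mult_eq_scaleR[symmetric])
    also have "\<dots> = (\<Sum>i\<in>UNIV. h $ i * partial i f x)"
      by (simp add: sum scale partial_def)
    finally show ?thesis .
  qed
  then have "frechet_derivative f (at x) = (\<lambda>h. \<Sum>i\<in>UNIV. h $ i * partial i f x)"
    by blast
  then show ?thesis
    using d by simp
qed

section \<open>Rules for partial derivatives and closure properties of smooth functions\<close>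

lemma partial_const: "partial j (\<lambda>x. c) = (\<lambda>x. 0)"
  by (rule ext, subst partial_eqI[OF has_derivative_const]) simp

lemma partial_add:
  assumes "\<And>x. f differentiable (at x)" "\<And>x. g differentiable (at x)"
  shows "partial j (\<lambda>x. f x + g x) = (\<lambda>x. partial j f x + partial j g x)"
proof
  fix x
  show "partial j (\<lambda>x. f x + g x) x = partial j f x + partial j g x"
    using partial_eqI[OF has_derivative_add[OF differentiable_has_derivative_partial differentiable_has_derivative_partial], OF assms(1,2)]
      partial_eqI[OF differentiable_has_derivative_partial[OF assms(1)]] partial_eqI[OF differentiable_has_derivative_partial[OF assms(2)]]
    by metis
qed

lemma partial_mult:
  assumes "\<And>x. f differentiable (at x)" "\<And>x. g differentiable (at x)"
  shows "partial j (\<lambda>x. f x * g x) = (\<lambda>x. f x * partial j g x + partial j f x * g x)"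
proof
  fix x
  show "partial j (\<lambda>x. f x * g x) x = f x * partial j g x + partial j f x * g x"
    using partial_eqI[OF has_derivative_mult[OF differentiable_has_derivative_partial differentiable_has_derivative_partial], OF assms(1,2)]
      partial_eqI[OF differentiable_has_derivative_partial[OF assms(1)]] partial_eqI[OF differentiable_has_derivative_partial[OF assms(2)]]
    by metis
qed

lemma partial_compose:
  assumes "\<And>x. f differentiable (at x)" "\<And>y. (h has_real_derivative h' y) (at y)"
  shows "partial j (\<lambda>x. h (f x)) = (\<lambda>x. h' (f x) * partial j f x)"
proof
  fix x
  have "((\<lambda>x. h (f x)) has_derivative (\<lambda>y. h' (f x) * (\<Sum>i\<in>UNIV. y $ i * partial i f x))) (at x)"
    using has_derivative_compose[OF differentiable_has_derivative_partial[OF assms(1)]]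
      assms(2)[unfolded has_field_derivative_def] by blast
  from partial_eqI[OF this] partial_eqI[OF differentiable_has_derivative_partial[OF assms(1)]]
  show "partial j (\<lambda>x. h (f x)) x = h' (f x) * partial j f x"
    by metis
qed

lemma partial_affine:
  assumes "\<And>x. f differentiable (at x)"
  shows "partial j (\<lambda>x. f (c *\<^sub>R (x - a))) = (\<lambda>x. c * partial j f (c *\<^sub>R (x - a)))"
proof
  fix x
  have "((\<lambda>x. c *\<^sub>R (x - a)) has_derivative (\<lambda>h. c *\<^sub>R h)) (at x)"
    by (auto intro!: derivative_eq_intros)
  from has_derivative_compose[OF this differentiable_has_derivative_partial[OF assms]]
  have "((\<lambda>x. f (c *\<^sub>R (x - a))) has_derivative
     (\<lambda>h. \<Sum>i\<in>UNIV. (c *\<^sub>R h) $ i * partial i f (c *\<^sub>R (x - a)))) (at x)" .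
  then have "partial j (\<lambda>x. f (c *\<^sub>R (x - a))) x =
      (\<Sum>i\<in>UNIV. (c *\<^sub>R axis j 1) $ i * partial i f (c *\<^sub>R (x - a)))"
    by (rule partial_eqI)
  also have "\<dots> = c * (\<Sum>i\<in>UNIV. axis j 1 $ i * partial i f (c *\<^sub>R (x - a)))"
    by (simp add: sum_distrib_left mult.assoc)
  also have "\<dots> = c * partial j f (c *\<^sub>R (x - a))"
    using partial_eqI[OF differentiable_has_derivative_partial[OF assms]] by metis
  finally show "partial j (\<lambda>x. f (c *\<^sub>R (x - a))) x = c * partial j f (c *\<^sub>R (x - a))" .
qed

lemma ndiff_const: "ndiff m (\<lambda>x. c)"
  by (induction m arbitrary: c) (auto simp: partial_const)

lemma ndiff_add: "ndiff m f \<Longrightarrow> ndiff m g \<Longrightarrow> ndiff m (\<lambda>x. f x + g x)"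
proof (induction m arbitrary: f g)
  case (Suc m)
  then show ?case
    by (auto simp: partial_add)
qed (auto intro: differentiable_add)

lemma ndiff_mult: "ndiff m f \<Longrightarrow> ndiff m g \<Longrightarrow> ndiff m (\<lambda>x. f x * g x)"
proof (induction m arbitrary: f g)
  case (Suc m)
  have "ndiff m f" "ndiff m g"
    using Suc.prems by (auto intro: ndiff_Suc_imp)
  then show ?case
    using Suc by (auto simp: partial_mult intro!: ndiff_add differentiable_mult)
qed (auto intro: differentiable_mult)

lemma ndiff_coord: "ndiff m (\<lambda>x. x $ i)"
proof -
  have d: "((\<lambda>x :: real ^ 'a. x $ i) has_derivative (\<lambda>h. h $ i)) (at x)" for x
    by (intro bounded_linear_imp_has_derivative bounded_linear_vec_nth)
  then have "(\<lambda>x :: real ^ 'a. x $ i) differentiable at x" for x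
    by (auto simp: differentiable_def)
  moreover have "partial j (\<lambda>x. x $ i) = (\<lambda>x. axis j 1 $ i)" for j
    by (rule ext) (rule partial_eqI[OF d])
  ultimately show ?thesis
    by (cases m) (auto simp: ndiff_const)
qed

lemma ndiff_affine: "ndiff m f \<Longrightarrow> ndiff m (\<lambda>x. f (c *\<^sub>R (x - a)))"
proof (induction m arbitrary: f)
  case 0
  have "(\<lambda>x. f (c *\<^sub>R (x - a))) differentiable at x" for x
    by (rule differentiable_compose[of f]) (use 0 in \<open>auto intro!: differentiable_scaleR differentiable_diff\<close>)
  then show ?case by simp
next
  case (Suc m)
  have "(\<lambda>x. f (c *\<^sub>R (x - a))) differentiable at x" for x
    by (rule differentiable_compose[of f]) (use Suc in \<open>auto intro!: differentiable_scaleR differentiable_diff\<close>)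
  then show ?case
    using Suc by (auto simp: partial_affine intro!: ndiff_mult ndiff_const)
qed

lemma smooth_const: "smooth (\<lambda>x. c)"
  and smooth_coord: "smooth (\<lambda>x. x $ i)"
  and smooth_add: "smooth f \<Longrightarrow> smooth g \<Longrightarrow> smooth (\<lambda>x. f x + g x)"
  and smooth_mult: "smooth f \<Longrightarrow> smooth g \<Longrightarrow> smooth (\<lambda>x. f x * g x)"
  and smooth_affine: "smooth f \<Longrightarrow> smooth (\<lambda>x. f (c *\<^sub>R (x - a)))"
  by (simp_all add: smooth_def ndiff_const ndiff_coord ndiff_add ndiff_mult ndiff_affine)

lemma smooth_sum: "(\<And>i. i \<in> I \<Longrightarrow> smooth (f i)) \<Longrightarrow> smooth (\<lambda>x. \<Sum>i\<in>I. f i x)"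
  by (induction I rule: infinite_finite_induct) (auto intro: smooth_add smooth_const)

lemma smooth_continuous: "smooth f \<Longrightarrow> continuous_on A f"
  by (meson continuous_at_imp_continuous_on differentiable_imp_continuous_within smooth_differentiable)

text \<open>The family \<open>exp_bump k\<close> is closed under differentiation, up to linear combinations.\<close>

definition exp_bump :: "nat \<Rightarrow> real \<Rightarrow> real" where
  "exp_bump k x = (if 0 < x then exp (- 1 / x) / x ^ k else 0)"


lemma exp_bump_has_derivative:
  "(exp_bump k has_real_derivative exp_bump (k + 2) x - real k * exp_bump (k + 1) x) (at x)"
proof -
  consider "x < 0" | "x = 0" | "0 < x" by linarith
  then show ?thesis
  proof cases
    case 1
    have "(exp_bump k has_real_derivative 0) (at x)"
      by (rule has_field_derivative_transform_within_open[of "\<lambda>x. 0" _ _ "{..<0}"])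
         (use 1 in \<open>auto simp: exp_bump_def\<close>)
    then show ?thesis using 1 by (simp add: exp_bump_def)
  next
    case 3
    have "((\<lambda>x. exp (- 1 / x) / x ^ k) has_real_derivative
        exp_bump (k + 2) x - real k * exp_bump (k + 1) x) (at x)"
    proof (cases k)
      case 0
      then show ?thesis
        using 3 by (auto intro!: derivative_eq_intros simp: exp_bump_def field_simps power2_eq_square)
    next
      case (Suc l)
      have "((\<lambda>x. x ^ k) has_real_derivative real k * x ^ l) (at x)"
        using DERIV_pow[of k x UNIV] Suc by simp
      moreover have "((\<lambda>x. exp (- 1 / x)) has_real_derivative exp (- 1 / x) / x\<^sup>2) (at x)"
        using 3 by (auto intro!: derivative_eq_intros simp: power2_eq_square)
      ultimately have "((\<lambda>x. exp (- 1 / x) / x ^ k) has_real_derivative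
          (exp (- 1 / x) / x\<^sup>2 * x ^ k - exp (- 1 / x) * (real k * x ^ l)) / (x ^ k * x ^ k)) (at x)"
        using 3 by (intro DERIV_divide) auto
      moreover have "(exp (- 1 / x) / x\<^sup>2 * x ^ k - exp (- 1 / x) * (real k * x ^ l)) / (x ^ k * x ^ k)
          = exp_bump (k + 2) x - real k * exp_bump (k + 1) x"
        using 3 Suc by (simp add: exp_bump_def field_simps power2_eq_square)
      ultimately show ?thesis by simp
    qed
    then show ?thesis
      by (rule has_field_derivative_transform_within_open[of _ _ _ "{0<..}"])
         (use 3 in \<open>auto simp: exp_bump_def\<close>)
  next
    case 2
    have "((\<lambda>y. exp_bump k y / y) \<longlongrightarrow> 0) (at 0)"
    proof -
      \<comment> \<open>After the substitution of \<open>inverse y\<close> this is the difference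
        quotient at 0 from the right: the exponential beats every power.\<close>
      have "((\<lambda>y::real. y ^ (k+1) / exp y) \<longlongrightarrow> 0) at_top"
        by (rule tendsto_power_div_exp_0)
      then have "((\<lambda>y::real. (inverse y) ^ (k+1) / exp (inverse y)) \<longlongrightarrow> 0) (at_right 0)"
        by (rule filterlim_compose[OF _ filterlim_inverse_at_top_right])
      then have "((\<lambda>y. exp_bump k y / y) \<longlongrightarrow> 0) (at_right 0)"
      proof (rule Lim_transform_eventually)
        show "\<forall>\<^sub>F y in at_right 0. inverse y ^ (k+1) / exp (inverse y) = exp_bump k y / y"
          by (auto simp: eventually_at_filter exp_bump_def exp_minus field_simps intro!: always_eventually)
      qed
      moreover have "((\<lambda>y. exp_bump k y / y) \<longlongrightarrow> 0) (at_left 0)"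
        by (rule Lim_transform_eventually[OF tendsto_const])
           (auto simp: eventually_at_filter exp_bump_def intro!: always_eventually)
      ultimately show ?thesis
        by (simp add: filterlim_at_split)
    qed
    then have "(exp_bump k has_real_derivative 0) (at 0)"
      by (simp add: has_field_derivative_iff exp_bump_def)
    then show ?thesis using 2 by (simp add: exp_bump_def)
  qed
qed

text \<open>The index \<open>k\<close> is general in the induction because a derivative raises it to
  \<open>k + 1\<close> and \<open>k + 2\<close>; the inner function stays the same
  throughout.\<close>

lemma ndiff_exp_bump: "ndiff m f \<Longrightarrow> ndiff m (\<lambda>x. exp_bump k (f x))"
proof (induction m arbitrary: k)
  case 0
  have "(\<lambda>x. exp_bump k (f x)) differentiable at x" for x
    by (rule differentiable_compose[of "exp_bump k"])
      (use 0 exp_bump_has_derivative in \<open>auto simp: has_field_derivative_def differentiable_def\<close>)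
  then show ?case by simp
next
  case (Suc m)
  have "(\<lambda>x. exp_bump k (f x)) differentiable at x" for x
    by (rule differentiable_compose[of "exp_bump k"])
      (use Suc exp_bump_has_derivative in \<open>auto simp: has_field_derivative_def differentiable_def\<close>)
  moreover have "partial j (\<lambda>x. exp_bump k (f x)) =
      (\<lambda>x. (exp_bump (k + 2) (f x) + (- real k) * exp_bump (k + 1) (f x)) * partial j f x)" for j
    using partial_compose[of f "exp_bump k", OF _ exp_bump_has_derivative] Suc.prems by simp
  moreover have "ndiff m f"
    using Suc.prems by (rule ndiff_Suc_imp)
  moreover have "ndiff m (\<lambda>x. (exp_bump (k + 2) (f x) + (- real k) * exp_bump (k + 1) (f x)) * partial j f x)" for j
    using Suc.prems \<open>ndiff m f\<close> by (intro ndiff_mult ndiff_add ndiff_const Suc.IH) auto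
  ultimately show ?case
    by (simp only: ndiff.simps) blast
qed

lemma smooth_exp_bump: "smooth f \<Longrightarrow> smooth (\<lambda>x. exp_bump k (f x))"
  by (simp add: smooth_def ndiff_exp_bump)

text \<open>The standard mollifier \<open>exp (- 1 / (r^2 - |z - w|^2))\<close>, normalised. Its
  integral is positive because it is positive on a ball of positive measure.\<close>

lemma smooth_bump_exists:
  fixes w :: "real ^ 'n"
  assumes "0 < r"
  obtains \<psi> where "smooth \<psi>" "\<And>z. z \<notin> cball w r \<Longrightarrow> \<psi> z = 0" "\<And>z. 0 \<le> \<psi> z"
    "integral\<^sup>L lborel \<psi> = 1"
proof -
  \<comment> \<open>The squared distance is written out in coordinates so that smoothness follows
    from sums and products alone.\<close>
  define q where "q z = r\<^sup>2 + (\<Sum>i\<in>UNIV. (- 1) * ((z $ i + (- w $ i)) * (z $ i + (- w $ i))))" for z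
  define f where "f z = exp_bump 0 (q z)" for z
  have q: "q z = r\<^sup>2 - (dist w z)\<^sup>2" for z
  proof -
    have "(dist w z)\<^sup>2 = (z - w) \<bullet> (z - w)"
      by (metis dist_commute dist_norm power2_norm_eq_inner)
    then show ?thesis
      by (simp add: q_def inner_vec_def sum_negf power2_eq_square)
  qed
  have sq: "smooth q"
    unfolding q_def by (intro smooth_add smooth_sum smooth_mult smooth_const smooth_coord)
  have sf: "smooth f"
    unfolding f_def by (intro smooth_exp_bump sq)
  have pos: "0 < f z \<longleftrightarrow> z \<in> ball w r" for z
  proof -
    have "0 < q z \<longleftrightarrow> dist w z < r"
      using assms by (auto simp: q intro: power_less_imp_less_base power_strict_mono)
    then show ?thesis
      by (simp add: f_def exp_bump_def)
  qed
  have nn: "0 \<le> f z" for z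
    by (simp add: f_def exp_bump_def)
  have zero: "f z = 0" if "z \<notin> ball w r" for z
    using pos[of z] nn[of z] that by auto
  have int: "integrable lborel f"
  proof -
    have "set_integrable lborel (cball w r) f"
      unfolding set_integrable_def
      by (rule borel_integrable_compact) (auto intro: smooth_continuous sf)
    moreover have "(\<lambda>x. indicat_real (cball w r) x *\<^sub>R f x) = f"
      by (rule ext) (use zero in \<open>auto simp: indicator_def\<close>)
    ultimately show ?thesis
      by (simp add: set_integrable_def)
  qed
  have "integral\<^sup>L lborel f \<noteq> 0"
  proof
    assume "integral\<^sup>L lborel f = 0"
    then have "AE z in lborel. f z = 0"
      using integral_nonneg_eq_0_iff_AE[OF int] nn by simp
    then have "AE z in lborel. z \<notin> ball w r"
      by eventually_elim (metis pos less_irrefl)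
    then have "emeasure lborel (ball w r) = 0"
      by (subst (asm) AE_iff_measurable[OF _ refl]) (auto simp: ball_def)
    then show False
      using assms content_ball_pos[of r w] by (simp add: measure_def)
  qed
  then have ipos: "0 < integral\<^sup>L lborel f"
    using Bochner_Integration.integral_nonneg[of lborel f] nn by (simp add: order_less_le)
  show thesis
  proof
    show "smooth (\<lambda>z. (1 / integral\<^sup>L lborel f) * f z)"
      by (intro smooth_mult smooth_const sf)
  qed (use zero nn ipos in auto)
qed

section \<open>Approximate identities\<close>

text \<open>Induction over integrable functions. An indicator is first enlarged to an open set of
  almost the same measure, which is then exhausted from inside by Lipschitz cutoffs; sums and
  dominated limits preserve the property.\<close>

lemma integrable_approx_uniformly_continuous:
  fixes u :: "'a::euclidean_space \<Rightarrow> 'b::euclidean_space"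
  assumes "integrable lebesgue u"
  shows "\<forall>\<epsilon>>0. \<exists>g. uniformly_continuous_on UNIV g \<and> integrable lebesgue g \<and>
     (LINT x|lebesgue. norm (u x - g x)) < \<epsilon>"
  using assms
proof (induction u rule: integrable_induct)
  case (base A c)
  show ?case
  proof (intro allI impI)
    fix \<epsilon> :: real assume "0 < \<epsilon>"
    define \<delta> where "\<delta> = \<epsilon> / (2 * (norm c + 1))"
    have "0 < \<delta>" using \<open>0 < \<epsilon>\<close> by (simp add: \<delta>_def add_nonneg_pos)
    obtain U where U: "open U" "A \<subseteq> U" "U - A \<in> lmeasurable" "emeasure lebesgue (U - A) < ennreal \<delta>"
      using sets_lebesgue_outer_open[OF base(1) \<open>0 < \<delta>\<close>] by metis
    have A: "A \<in> lmeasurable" using base by (simp add: fmeasurable_def)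
    have Um: "U \<in> lmeasurable"
      using fmeasurable.Un[OF A U(3)] U(2) by (simp add: Un_absorb1 Un_Diff_cancel)
    \<comment> \<open>\<open>infdist\<close> to the empty set is 0 by convention, which would make
      the cutoffs below vanish identically.\<close>
    have "U \<noteq> UNIV"
    proof
      assume "U = UNIV"
      then have "emeasure lebesgue (UNIV :: 'a set) < \<infinity>"
        using Um by (simp add: fmeasurable_def)
      then show False by simp
    qed
    then have ne: "- U \<noteq> {}" by blast
    \<comment> \<open>Lipschitz with constant \<open>k\<close>, zero off \<open>U\<close>, and
      increasing with \<open>k\<close> to the indicator of \<open>U\<close>.\<close>
    define h where "h k x = min 1 (real k * infdist x (- U))" for k and x :: 'a
    have h01: "0 \<le> h k x" "h k x \<le> 1" for k x
      by (auto simp: h_def infdist_nonneg)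
    have h0: "h k x = 0" if "x \<notin> U" for k x
      using that by (simp add: h_def)
    have huc: "uniformly_continuous_on UNIV (\<lambda>x. h k x *\<^sub>R c)" for k
    proof -
      have "(real k * norm c)-lipschitz_on UNIV (\<lambda>x. h k x *\<^sub>R c)"
      proof (rule lipschitz_onI)
        fix x y :: 'a
        have "\<bar>h k x - h k y\<bar> \<le> \<bar>real k * infdist x (- U) - real k * infdist y (- U)\<bar>"
          unfolding h_def by linarith
        also have "\<dots> = real k * \<bar>infdist x (- U) - infdist y (- U)\<bar>"
          by (metis abs_mult abs_of_nat right_diff_distrib)
        also have "\<dots> \<le> real k * dist x y"
          using infdist_triangle_abs by (intro mult_left_mono) auto
        finally have "\<bar>h k x - h k y\<bar> * norm c \<le> real k * dist x y * norm c"
          by (rule mult_right_mono) simp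
        then show "dist (h k x *\<^sub>R c) (h k y *\<^sub>R c) \<le> real k * norm c * dist x y"
          by (simp add: dist_norm scaleR_diff_left[symmetric] mult_ac)
      qed simp
      then show ?thesis
        by (rule lipschitz_on_uniformly_continuous)
    qed
    have hm: "(\<lambda>x. h k x *\<^sub>R c) \<in> borel_measurable lebesgue" for k
      by (intro measurable_completion)
        (simp add: borel_measurable_continuous_onI uniformly_continuous_imp_continuous[OF huc])
    have bnd: "integrable lebesgue (\<lambda>x. indicat_real U x * norm c)"
      using Um by (auto intro!: integrable_mult_left simp: fmeasurable_def)
    have hi: "integrable lebesgue (\<lambda>x. h k x *\<^sub>R c)" for k
    proof (rule Bochner_Integration.integrable_bound[OF bnd hm], intro AE_I2)
      fix x
      have "h k x * norm c \<le> indicat_real U x * norm c"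
        by (rule mult_right_mono) (use h01[of k x] h0[of x k] in \<open>auto simp: indicator_def\<close>)
      then show "norm (h k x *\<^sub>R c) \<le> norm (indicat_real U x * norm c)"
        using h01[of k x] by simp
    qed
    have iU: "integrable lebesgue (\<lambda>x. indicat_real U x *\<^sub>R c)"
      using Um by (auto intro!: integrable_scaleR_left simp: fmeasurable_def)
    have hlim: "(\<lambda>k. h k x) \<longlonglongrightarrow> indicat_real U x" for x
    proof (cases "x \<in> U")
      case True
      then have "0 < infdist x (- U)"
        using \<open>open U\<close> ne by (metis ComplD closed_Compl in_closed_iff_infdist_zero infdist_nonneg less_le)
      then obtain N :: nat where N: "1 \<le> real N * infdist x (- U)"
        by (metis ex_less_of_nat_mult less_imp_le)
      have "h k x = 1" if "N \<le> k" for k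
      proof -
        have "real N * infdist x (- U) \<le> real k * infdist x (- U)"
          using that by (intro mult_right_mono) (auto simp: infdist_nonneg)
        then show ?thesis using N by (simp add: h_def)
      qed
      then have "(\<lambda>k. h k x) \<longlonglongrightarrow> 1"
        by (intro tendsto_eventually) (auto simp: eventually_sequentially)
      then show ?thesis using True by simp
    qed (simp add: h0)
    have "(\<lambda>k. LINT x|lebesgue. norm (indicat_real U x *\<^sub>R c - h k x *\<^sub>R c)) \<longlonglongrightarrow>
        (LINT (x::'a)|lebesgue. (0::real))"
    proof (rule integral_dominated_convergence[where w="\<lambda>x. indicat_real U x * norm c"])
      show "AE x in lebesgue. (\<lambda>k. norm (indicat_real U x *\<^sub>R c - h k x *\<^sub>R c)) \<longlonglongrightarrow> 0"
      proof (intro AE_I2)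
        fix x
        have "(\<lambda>k. norm (indicat_real U x *\<^sub>R c - h k x *\<^sub>R c)) \<longlonglongrightarrow>
            norm (indicat_real U x *\<^sub>R c - indicat_real U x *\<^sub>R c)"
          by (intro tendsto_intros hlim)
        then show "(\<lambda>k. norm (indicat_real U x *\<^sub>R c - h k x *\<^sub>R c)) \<longlonglongrightarrow> 0"
          by simp
      qed
      show "AE x in lebesgue. norm (norm (indicat_real U x *\<^sub>R c - h k x *\<^sub>R c)) \<le> indicat_real U x * norm c" for k
      proof (intro AE_I2)
        fix x
        have "\<bar>indicat_real U x - h k x\<bar> * norm c \<le> indicat_real U x * norm c"
          by (rule mult_right_mono) (use h01[of k x] h0[of x k] in \<open>auto simp: indicator_def\<close>)
        then show "norm (norm (indicat_real U x *\<^sub>R c - h k x *\<^sub>R c)) \<le> indicat_real U x * norm c"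
          by (simp add: scaleR_diff_left[symmetric])
      qed
      show "(\<lambda>x. norm (indicat_real U x *\<^sub>R c - h k x *\<^sub>R c)) \<in> borel_measurable lebesgue" for k
        by (intro borel_measurable_integrable integrable_norm Bochner_Integration.integrable_diff iU hi)
    qed (use bnd in auto)
    then have "\<forall>\<^sub>F k in sequentially. (LINT x|lebesgue. norm (indicat_real U x *\<^sub>R c - h k x *\<^sub>R c)) < \<epsilon> / 2"
      using \<open>0 < \<epsilon>\<close> by (intro order_tendstoD(2)[where y = "0::real"]) auto
    then obtain k where k: "(LINT x|lebesgue. norm (indicat_real U x *\<^sub>R c - h k x *\<^sub>R c)) < \<epsilon> / 2"
      using eventually_happens'[OF sequentially_bot] by blast
    have iA: "integrable lebesgue (\<lambda>x. indicat_real A x *\<^sub>R c)"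
      using A by (auto intro!: integrable_scaleR_left simp: fmeasurable_def)
    have iUA: "integrable lebesgue (\<lambda>x. indicat_real (U - A) x * norm c)"
      using U(3) by (auto intro!: integrable_mult_left simp: fmeasurable_def)
    have "(LINT x|lebesgue. norm (indicat_real A x *\<^sub>R c - h k x *\<^sub>R c)) \<le>
        (LINT x|lebesgue. indicat_real (U - A) x * norm c + norm (indicat_real U x *\<^sub>R c - h k x *\<^sub>R c))"
    proof (rule Bochner_Integration.integral_mono)
      fix x
      have eq: "indicat_real A x *\<^sub>R c - h k x *\<^sub>R c =
          - (indicat_real (U - A) x *\<^sub>R c) + (indicat_real U x *\<^sub>R c - h k x *\<^sub>R c)"
        using U(2) by (auto simp: indicator_def)
      show "norm (indicat_real A x *\<^sub>R c - h k x *\<^sub>R c) \<le>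
          indicat_real (U - A) x * norm c + norm (indicat_real U x *\<^sub>R c - h k x *\<^sub>R c)"
        unfolding eq by (rule order_trans[OF norm_triangle_ineq]) simp
    qed (intro integrable_norm Bochner_Integration.integrable_diff Bochner_Integration.integrable_add iA iU iUA hi)+
    also have "\<dots> = measure lebesgue (U - A) * norm c +
        (LINT x|lebesgue. norm (indicat_real U x *\<^sub>R c - h k x *\<^sub>R c))"
      using iUA iU hi[of k] U(3) by (subst Bochner_Integration.integral_add) auto
    also have "measure lebesgue (U - A) * norm c \<le> \<delta> * norm c"
      using U(4) \<open>0 < \<delta>\<close> unfolding emeasure_eq_measure2[OF U(3)]
      by (intro mult_right_mono) (auto simp: ennreal_less_iff)
    also have "\<delta> * norm c \<le> \<epsilon> / 2"
      using \<open>0 < \<epsilon>\<close> unfolding \<delta>_def by (simp add: divide_simps add_nonneg_eq_0_iff) (smt (verit) norm_ge_zero)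
    finally have "(LINT x|lebesgue. norm (indicat_real A x *\<^sub>R c - h k x *\<^sub>R c)) < \<epsilon>"
      using k by simp
    then show "\<exists>g. uniformly_continuous_on UNIV g \<and> integrable lebesgue g \<and>
        (LINT x|lebesgue. norm (indicat_real A x *\<^sub>R c - g x)) < \<epsilon>"
      using huc hi by blast
  qed
next
  case (add f1 f2)
  show ?case
  proof (intro allI impI)
    fix \<epsilon> :: real assume "0 < \<epsilon>"
    then have "0 < \<epsilon> / 2" by simp
    then have e: "\<exists>g. uniformly_continuous_on UNIV g \<and> integrable lebesgue g \<and> (LINT x|lebesgue. norm (f x - g x)) < \<epsilon> / 2"
      if "f = f1 \<or> f = f2" for f
      using that add.IH by blast
    obtain g1 where
      g1: "uniformly_continuous_on UNIV g1" "integrable lebesgue g1" "(LINT x|lebesgue. norm (f1 x - g1 x)) < \<epsilon> / 2"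
      using e[of f1] by blast
    obtain g2 where
      g2: "uniformly_continuous_on UNIV g2" "integrable lebesgue g2" "(LINT x|lebesgue. norm (f2 x - g2 x)) < \<epsilon> / 2"
      using e[of f2] by blast
    have "(LINT x|lebesgue. norm (f1 x + f2 x - (g1 x + g2 x))) \<le>
      (LINT x|lebesgue. norm (f1 x - g1 x) + norm (f2 x - g2 x))"
    proof (rule Bochner_Integration.integral_mono)
      show "norm (f1 x + f2 x - (g1 x + g2 x)) \<le> norm (f1 x - g1 x) + norm (f2 x - g2 x)" for x
        by (rule norm_diff_triangle_ineq)
    qed (intro integrable_norm Bochner_Integration.integrable_diff Bochner_Integration.integrable_add add.hyps g1 g2)+
    also have "\<dots> < \<epsilon>"
      using add.hyps g1 g2 by (subst Bochner_Integration.integral_add) auto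
    finally show "\<exists>g. uniformly_continuous_on UNIV g \<and> integrable lebesgue g \<and>
        (LINT x|lebesgue. norm (f1 x + f2 x - g x)) < \<epsilon>"
      using uniformly_continuous_on_add[OF g1(1) g2(1)] Bochner_Integration.integrable_add[OF g1(2) g2(2)]
      by blast
  qed
next
  case (lim f s)
  show ?case
  proof (intro allI impI)
    fix \<epsilon> :: real assume "0 < \<epsilon>"
    have fm: "f \<in> borel_measurable lebesgue" and sm: "s i \<in> borel_measurable lebesgue" for i
      using lim by auto
    have "(\<lambda>k. LINT x|lebesgue. norm (f x - s k x)) \<longlonglongrightarrow> (LINT (x::'a)|lebesgue. (0::real))"
    proof (rule integral_dominated_convergence[where w="\<lambda>x. 3 * norm (f x)"])
      show "AE x in lebesgue. (\<lambda>k. norm (f x - s k x)) \<longlonglongrightarrow> 0"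
      proof (intro AE_I2)
        fix x :: 'a assume "x \<in> space lebesgue"
        then have "(\<lambda>k. norm (f x - s k x)) \<longlonglongrightarrow> norm (f x - f x)"
          by (intro tendsto_intros lim)
        then show "(\<lambda>k. norm (f x - s k x)) \<longlonglongrightarrow> 0" by simp
      qed
      show "AE x in lebesgue. norm (norm (f x - s k x)) \<le> 3 * norm (f x)" for k
      proof (intro AE_I2)
        fix x :: 'a assume "x \<in> space lebesgue"
        then have "norm (s k x) \<le> 2 * norm (f x)" by (rule lim)
        then show "norm (norm (f x - s k x)) \<le> 3 * norm (f x)"
          using norm_triangle_ineq4[of "f x" "s k x"] by simp
      qed
    qed (use lim fm sm in auto)
    then have "\<forall>\<^sub>F k in sequentially. (LINT x|lebesgue. norm (f x - s k x)) < \<epsilon> / 2"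
      using \<open>0 < \<epsilon>\<close> by (intro order_tendstoD(2)[where y = "0::real"]) auto
    then obtain k where k: "(LINT x|lebesgue. norm (f x - s k x)) < \<epsilon> / 2"
      using eventually_happens'[OF sequentially_bot] by blast
    obtain g where g: "uniformly_continuous_on UNIV g" "integrable lebesgue g"
      "(LINT x|lebesgue. norm (s k x - g x)) < \<epsilon> / 2"
      using lim.IH[of k, rule_format, of "\<epsilon> / 2"] \<open>0 < \<epsilon>\<close> by auto
    have "(LINT x|lebesgue. norm (f x - g x)) \<le> (LINT x|lebesgue. norm (f x - s k x) + norm (s k x - g x))"
    proof (rule Bochner_Integration.integral_mono)
      show "norm (f x - g x) \<le> norm (f x - s k x) + norm (s k x - g x)" for x
        by (metis dist_norm dist_triangle)
    qed (intro integrable_norm Bochner_Integration.integrable_diff Bochner_Integration.integrable_add lim g)+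
    also have "\<dots> < \<epsilon>"
      using lim g k by (subst Bochner_Integration.integral_add) auto
    finally show "\<exists>g. uniformly_continuous_on UNIV g \<and> integrable lebesgue g \<and> (LINT x|lebesgue. norm (f x - g x)) < \<epsilon>"
      using g by blast
  qed
qed

text \<open>The \<open>L^1\<close>-normalised rescaling centred at \<open>x\<close>. Integrating
  \<open>v\<close> against it is integrating \<open>v (x + t z)\<close> against
  \<open>\<psi> z\<close>, but the dependence on \<open>x\<close> and \<open>t\<close> sits on the
  smooth factor.\<close>

definition kern :: "(real ^ 'n \<Rightarrow> real) \<Rightarrow> real \<Rightarrow> real ^ 'n \<Rightarrow> real ^ 'n \<Rightarrow> real" where
  "kern \<psi> t x y = \<psi> ((1 / t) *\<^sub>R (y - x)) / t ^ CARD('n)"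

lemma nn_integral_affine:
  fixes f :: "'a::euclidean_space \<Rightarrow> ennreal"
  assumes [measurable]: "f \<in> borel_measurable borel" and "c \<noteq> 0"
  shows "(\<integral>\<^sup>+x. f x \<partial>lborel) = ennreal (\<bar>c\<bar> ^ DIM('a)) * (\<integral>\<^sup>+x. f (a + c *\<^sub>R x) \<partial>lborel)"
  by (subst lborel_affine[OF assms(2), of a])
     (simp add: nn_integral_density nn_integral_distr nn_integral_cmult)

lemma continuous_on_kern:
  assumes "continuous_on UNIV \<psi>"
  shows "continuous_on UNIV (\<lambda>p. kern \<psi> t (fst p) (snd p))"
proof -
  have "continuous_on UNIV (\<lambda>p. \<psi> ((1 / t) *\<^sub>R (snd p - fst p)))"
    by (intro continuous_on_compose2[OF assms] continuous_on_scaleR continuous_on_diff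
        continuous_on_fst continuous_on_snd continuous_on_const continuous_on_id) auto
  then show ?thesis
    unfolding kern_def divide_inverse by (rule continuous_on_mult_right)
qed

lemma borel_measurable_kern:
  assumes "continuous_on UNIV \<psi>"
  shows "(\<lambda>p. kern \<psi> t (fst p) (snd p)) \<in> borel_measurable borel"
    and "(\<lambda>y. kern \<psi> t x y) \<in> borel_measurable borel"
    and "(\<lambda>x. kern \<psi> t x y) \<in> borel_measurable borel"
proof -
  show "(\<lambda>p. kern \<psi> t (fst p) (snd p)) \<in> borel_measurable borel"
    by (intro borel_measurable_continuous_onI continuous_on_kern assms)
  have "continuous_on UNIV (\<lambda>y. kern \<psi> t (fst (x, y)) (snd (x, y)))"
    by (rule continuous_on_compose2[OF continuous_on_kern[OF assms]])
      (auto intro!: continuous_on_Pair continuous_on_const continuous_on_id)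
  then show "(\<lambda>y. kern \<psi> t x y) \<in> borel_measurable borel"
    by (intro borel_measurable_continuous_onI) simp
  have "continuous_on UNIV (\<lambda>x. kern \<psi> t (fst (x, y)) (snd (x, y)))"
    by (rule continuous_on_compose2[OF continuous_on_kern[OF assms]])
      (auto intro!: continuous_on_Pair continuous_on_const continuous_on_id)
  then show "(\<lambda>x. kern \<psi> t x y) \<in> borel_measurable borel"
    by (intro borel_measurable_continuous_onI) simp
qed

text \<open>Substitution with factor \<open>t\<close> in \<open>y\<close> and \<open>- t\<close> in
  \<open>x\<close>. Mass in \<open>y\<close> makes averages of constants exact; mass in
  \<open>x\<close> lets Fubini bound the \<open>L^1\<close> norm of an average by that of the
  function.\<close>

lemma nn_integral_kern:
  fixes \<psi> :: "real ^ 'n \<Rightarrow> real"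
  assumes cont: "continuous_on UNIV \<psi>" and "\<And>z. 0 \<le> \<psi> z" and "0 < t"
  shows "(\<integral>\<^sup>+y. kern \<psi> t x y \<partial>lborel) = (\<integral>\<^sup>+z. \<psi> z \<partial>lborel)"
    and "(\<integral>\<^sup>+x. kern \<psi> t x y \<partial>lborel) = (\<integral>\<^sup>+z. \<psi> z \<partial>lborel)"
proof -
  have m: "\<psi> \<in> borel_measurable borel"
    using cont by (rule borel_measurable_continuous_onI)
  have c: "ennreal (t ^ CARD('n)) * ennreal (\<psi> z / t ^ CARD('n)) = \<psi> z" for z
    using assms by (simp add: ennreal_mult[symmetric])
  note mx = borel_measurable_kern(2)[OF cont] and my = borel_measurable_kern(3)[OF cont]
  have "(\<integral>\<^sup>+y. kern \<psi> t x y \<partial>lborel) =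
      ennreal (t ^ CARD('n)) * (\<integral>\<^sup>+z. ennreal (kern \<psi> t x (x + t *\<^sub>R z)) \<partial>lborel)"
    using \<open>0 < t\<close> mx by (subst nn_integral_affine[of _ t x]) auto
  also have "\<dots> = (\<integral>\<^sup>+z. \<psi> z \<partial>lborel)"
    using \<open>0 < t\<close> m by (subst nn_integral_cmult[symmetric]) (auto simp: kern_def c)
  finally show "(\<integral>\<^sup>+y. kern \<psi> t x y \<partial>lborel) = (\<integral>\<^sup>+z. \<psi> z \<partial>lborel)" .
  have "(\<integral>\<^sup>+x. kern \<psi> t x y \<partial>lborel) =
      ennreal (t ^ CARD('n)) * (\<integral>\<^sup>+z. ennreal (kern \<psi> t (y + (- t) *\<^sub>R z) y) \<partial>lborel)"
    using \<open>0 < t\<close> my by (subst nn_integral_affine[of _ "- t" y]) auto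
  also have "\<dots> = (\<integral>\<^sup>+z. \<psi> z \<partial>lborel)"
    using \<open>0 < t\<close> m by (subst nn_integral_cmult[symmetric]) (auto simp: kern_def c)
  finally show "(\<integral>\<^sup>+x. kern \<psi> t x y \<partial>lborel) = (\<integral>\<^sup>+z. \<psi> z \<partial>lborel)" .
qed

lemma bounded_compact_support:
  fixes f :: "'a::topological_space \<Rightarrow> 'b::real_normed_vector"
  assumes "continuous_on UNIV f" "compact A" "\<And>z. z \<notin> A \<Longrightarrow> f z = 0"
  obtains M where "0 < M" "\<And>z. norm (f z) \<le> M"
proof -
  have "bounded (f ` A)"
    using assms by (meson compact_continuous_image compact_imp_bounded continuous_on_subset subset_UNIV)
  then obtain M where "0 < M" "\<forall>y\<in>f ` A. norm y \<le> M"
    using bounded_pos by blast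
  then show thesis
    using assms(3) that[of M] by (metis image_eqI less_imp_le norm_zero)
qed

lemma kern_integrable:
  fixes u :: "real ^ 'n \<Rightarrow> 'b::euclidean_space"
  assumes u: "integrable (lebesgue_on Q) u" and cont: "continuous_on UNIV \<psi>"
    and A: "compact A" "\<And>z. z \<notin> A \<Longrightarrow> \<psi> z = 0"
  shows "integrable (lebesgue_on Q) (\<lambda>y. kern \<psi> t x y *\<^sub>R u y)"
proof -
  obtain M where M: "0 < M" "\<And>z. norm (\<psi> z) \<le> M"
    using bounded_compact_support[OF cont A] by blast
  have "(\<lambda>y. kern \<psi> t x y) \<in> borel_measurable lebesgue"
    using borel_measurable_kern(2)[OF cont] by (intro measurable_completion) simp
  then have km': "(\<lambda>y. kern \<psi> t x y) \<in> borel_measurable (lebesgue_on Q)"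
    by (rule measurable_restrict_space1)
  show ?thesis
  proof (rule Bochner_Integration.integrable_bound)
    show "integrable (lebesgue_on Q) (\<lambda>y. (M / \<bar>t\<bar> ^ CARD('n)) *\<^sub>R u y)"
      using u by simp
    show "AE y in lebesgue_on Q. norm (kern \<psi> t x y *\<^sub>R u y) \<le> norm ((M / \<bar>t\<bar> ^ CARD('n)) *\<^sub>R u y)"
      using M by (intro AE_I2)
        (auto simp: kern_def power_abs intro!: mult_right_mono divide_right_mono)
  qed (use u km' in \<open>auto intro: borel_measurable_scaleR\<close>)
qed

text \<open>The averages tend to \<open>u\<close> in \<open>L^1\<close>, so the positive part of
  \<open>norm (u x) - C\<close> has zero integral over \<open>B\<close>. Finite measure of
  \<open>B\<close> is what allows a uniform error to be integrated. No Lebesgue points are involved,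
  and the kernel need not be centred at 0.\<close>

lemma kern_average_bound:
  fixes u :: "real ^ 'n \<Rightarrow> 'b::euclidean_space"
  assumes u: "integrable lebesgue u" and cont: "continuous_on UNIV \<psi>"
    and A: "compact A" "\<And>z. z \<notin> A \<Longrightarrow> \<psi> z = 0" and nn: "\<And>z. 0 \<le> \<psi> z" and int: "integral\<^sup>L lborel \<psi> = 1"
    and B: "B \<in> lmeasurable" and "0 < \<tau>"
    and bound: "\<And>x t. x \<in> B \<Longrightarrow> 0 < t \<Longrightarrow> t \<le> \<tau> \<Longrightarrow> norm (LINT y|lebesgue. kern \<psi> t x y *\<^sub>R u y) \<le> C"
  shows "AE x in lebesgue. x \<in> B \<longrightarrow> norm (u x) \<le> C"
proof -
  have ki: "integrable lebesgue (\<lambda>y. kern \<psi> t x y *\<^sub>R v y)" if "integrable lebesgue v"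
    for t x and v :: "real ^ 'n \<Rightarrow> 'b"
    using kern_integrable[of UNIV v \<psi> A t x] that cont A by (simp add: lebesgue_on_UNIV_eq)
  have int1: "(\<integral>\<^sup>+z. \<psi> z \<partial>lborel) = 1"
  proof -
    have "integrable lborel \<psi>"
      using int not_integrable_integral_eq by fastforce
    then show ?thesis
      using nn int by (subst nn_integral_eq_integral) auto
  qed
  note km = borel_measurable_kern(2)[OF cont]
  have knn: "0 \<le> kern \<psi> t x y" if "0 < t" for t x y
    using nn that by (simp add: kern_def)
  have k1: "(\<integral>\<^sup>+y. kern \<psi> t x y \<partial>lborel) = 1" "(\<integral>\<^sup>+x. kern \<psi> t x y \<partial>lborel) = 1" if "0 < t" for t x y
    using nn_integral_kern[OF cont nn that] int1 by auto
  have kint: "integrable lebesgue (\<lambda>y. kern \<psi> t x y)" "(LINT y|lebesgue. kern \<psi> t x y) = 1" if "0 < t" for t x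
  proof -
    have "has_bochner_integral lborel (\<lambda>y. kern \<psi> t x y) 1"
      using that km knn k1 by (intro has_bochner_integral_nn_integral) auto
    then show "integrable lebesgue (\<lambda>y. kern \<psi> t x y)" "(LINT y|lebesgue. kern \<psi> t x y) = 1"
      using km by (auto simp: has_bochner_integral_iff integrable_completion integral_completion)
  qed
  obtain \<rho> where \<rho>: "0 < \<rho>" "\<And>z. z \<in> A \<Longrightarrow> norm z \<le> \<rho>"
    using A(1) compact_imp_bounded bounded_pos by metis
  have um: "u \<in> borel_measurable lebesgue" using u by auto
  have Bm: "B \<in> sets lebesgue" "emeasure lebesgue B < \<infinity>"
    using B by (auto simp: fmeasurable_def)
  \<comment> \<open>\<open>ennreal\<close> truncates at 0, so the integrand is the positive part. In
    the bound, the two units stand for \<open>w\<close> and for its average, and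
    \<open>measure lebesgue B\<close> for the uniform error of averaging \<open>g\<close>.\<close>
  have main: "(\<integral>\<^sup>+x\<in>B. ennreal (norm (u x) - C) \<partial>lebesgue) \<le> ennreal (\<epsilon> * (2 + measure lebesgue B))"
    if \<epsilon>: "0 < \<epsilon>" for \<epsilon>
  proof -
    obtain g where g: "uniformly_continuous_on UNIV g" "integrable lebesgue g"
      "(LINT x|lebesgue. norm (u x - g x)) < \<epsilon>"
      using integrable_approx_uniformly_continuous[OF u, rule_format, OF \<epsilon>] by auto
    obtain \<delta> where \<delta>: "0 < \<delta>" "\<And>x y. dist x y < \<delta> \<Longrightarrow> dist (g x) (g y) < \<epsilon>"
      using g(1)[unfolded uniformly_continuous_on_def, rule_format, OF \<epsilon>] by auto
    \<comment> \<open>Small enough for the hypothesis \<open>bound\<close>, and so small that the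
      support of the kernel, of radius at most \<open>t * \<rho>\<close>, lies where
      \<open>g\<close> varies by less than \<open>\<epsilon>\<close>.\<close>
    define t where "t = min \<tau> (\<delta> / (2 * \<rho>))"
    have t: "0 < t" "t \<le> \<tau>" and "t * \<rho> \<le> \<delta> / 2"
      using \<open>0 < \<tau>\<close> \<delta>(1) \<rho>(1) by (auto simp: t_def min_def field_simps)
    then have t\<rho>: "t * \<rho> < \<delta>" using \<delta>(1) by simp
    define w where "w y = u y - g y" for y
    have wi: "integrable lebesgue w" unfolding w_def using u g by auto
    have "(\<lambda>y. ennreal (norm (w y))) \<in> borel_measurable lebesgue"
      using wi by measurable
    \<comment> \<open>\<open>norm (w y)\<close> is only Lebesgue measurable; a Borel version is
      needed for Fubini on the product of two copies of \<open>lborel\<close>.\<close>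
    from completion_ex_borel_measurable[OF this] obtain h
      where h: "h \<in> borel_measurable lborel" "AE y in lborel. ennreal (norm (w y)) = h y" by blast
    have hint: "(\<integral>\<^sup>+y. h y \<partial>lborel) < ennreal \<epsilon>"
    proof -
      have "(\<integral>\<^sup>+y. h y \<partial>lborel) = (\<integral>\<^sup>+y. h y \<partial>lebesgue)"
        by (simp add: nn_integral_completion)
      also have "\<dots> = (\<integral>\<^sup>+y. ennreal (norm (w y)) \<partial>lebesgue)"
        using AE_completion[OF h(2)] by (intro nn_integral_cong_AE) (auto elim: eventually_mono)
      also have "\<dots> = ennreal (LINT y|lebesgue. norm (w y))"
        using wi by (intro nn_integral_eq_integral) auto
      also have "\<dots> < ennreal \<epsilon>"
        using g(3) that by (simp add: w_def ennreal_less_iff)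
      finally show ?thesis .
    qed
    have wavg: "ennreal (norm (LINT y|lebesgue. kern \<psi> t x y *\<^sub>R w y)) \<le>
        (\<integral>\<^sup>+y. kern \<psi> t x y * h y \<partial>lborel)" for x
    proof -
      have "ennreal (norm (LINT y|lebesgue. kern \<psi> t x y *\<^sub>R w y)) \<le>
          (\<integral>\<^sup>+y. norm (kern \<psi> t x y *\<^sub>R w y) \<partial>lebesgue)"
        by (rule integral_norm_bound_ennreal[OF ki[OF wi]])
      also have "\<dots> = (\<integral>\<^sup>+y. kern \<psi> t x y * h y \<partial>lebesgue)"
        using AE_completion[OF h(2)] knn[OF t(1)]
        by (intro nn_integral_cong_AE) (auto elim!: eventually_mono simp: ennreal_mult)
      finally show ?thesis by (simp add: nn_integral_completion)
    qed
    have gavg: "norm (g x - (LINT y|lebesgue. kern \<psi> t x y *\<^sub>R g y)) \<le> \<epsilon>" for x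
    proof -
      have "g x - (LINT y|lebesgue. kern \<psi> t x y *\<^sub>R g y) =
          (LINT y|lebesgue. kern \<psi> t x y *\<^sub>R g x) - (LINT y|lebesgue. kern \<psi> t x y *\<^sub>R g y)"
        using kint[OF t(1)] by simp
      also have "\<dots> = (LINT y|lebesgue. kern \<psi> t x y *\<^sub>R (g x - g y))"
        using kint[OF t(1), of x] ki[OF g(2)]
        by (subst Bochner_Integration.integral_diff[symmetric]) (auto simp: scaleR_diff_right)
      finally have eq: "g x - (LINT y|lebesgue. kern \<psi> t x y *\<^sub>R g y) =
          (LINT y|lebesgue. kern \<psi> t x y *\<^sub>R (g x - g y))" .
      have "norm (LINT y|lebesgue. kern \<psi> t x y *\<^sub>R (g x - g y)) \<le> (LINT y|lebesgue. kern \<psi> t x y * \<epsilon>)"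
      proof (rule Bochner_Integration.integral_norm_bound_integral)
        show "integrable lebesgue (\<lambda>y. kern \<psi> t x y *\<^sub>R (g x - g y))"
          using kint[OF t(1), of x] ki[OF g(2), of t x]
          by (simp add: scaleR_diff_right)
        show "norm (kern \<psi> t x y *\<^sub>R (g x - g y)) \<le> kern \<psi> t x y * \<epsilon>" for y
        proof (cases "(1 / t) *\<^sub>R (y - x) \<in> A")
          case True
          then have "norm (y - x) \<le> t * \<rho>"
            using \<rho>(2)[OF True] t(1) unfolding norm_scaleR by (simp add: field_simps)
          then have "dist (g x) (g y) < \<epsilon>"
            using t\<rho> by (intro \<delta>) (simp add: dist_norm norm_minus_commute)
          then show ?thesis
            using knn[OF t(1)] by (simp add: dist_norm mult_left_mono)
        next
          case False
          then show ?thesis by (simp add: kern_def A(2))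
        qed
      qed (use kint[OF t(1)] in auto)
      then show ?thesis using kint[OF t(1)] by (simp add: eq)
    qed
    have pt: "ennreal (norm (u x) - C) \<le>
        ennreal (norm (w x)) + ennreal \<epsilon> + (\<integral>\<^sup>+y. kern \<psi> t x y * h y \<partial>lborel)" if "x \<in> B" for x
    proof -
      define a where "a = (LINT y|lebesgue. kern \<psi> t x y *\<^sub>R u y)"
      define b where "b = (LINT y|lebesgue. kern \<psi> t x y *\<^sub>R g y)"
      define c where "c = (LINT y|lebesgue. kern \<psi> t x y *\<^sub>R w y)"
      have "c = a - b"
        unfolding a_def b_def c_def w_def scaleR_diff_right
        by (rule Bochner_Integration.integral_diff) (intro ki u g)+
      \<comment> \<open>Only \<open>a\<close> is controlled by \<open>C\<close>; the other three
        terms are small, \<open>w\<close> and \<open>c\<close> in the mean and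
        \<open>g x - b\<close> uniformly.\<close>
      then have "u x = w x + (g x - b) + (a - c)"
        by (simp add: w_def)
      then have "norm (u x) \<le> norm (w x + (g x - b)) + norm (a - c)"
        using norm_triangle_ineq by metis
      also have "\<dots> \<le> norm (w x) + norm (g x - b) + (norm a + norm c)"
        by (intro add_mono norm_triangle_ineq norm_triangle_ineq4)
      finally have "norm (u x) \<le> norm (w x) + norm (g x - b) + (norm a + norm c)" .
      moreover have "norm a \<le> C" unfolding a_def by (rule bound[OF \<open>x \<in> B\<close> t])
      moreover have "norm (g x - b) \<le> \<epsilon>" unfolding b_def by (rule gavg)
      ultimately have "norm (u x) - C \<le> norm (w x) + \<epsilon> + norm c" by simp
      then have "ennreal (norm (u x) - C) \<le> ennreal (norm (w x) + \<epsilon> + norm c)"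
        by (rule ennreal_leI)
      also have "\<dots> = ennreal (norm (w x)) + ennreal \<epsilon> + ennreal (norm c)"
        using \<open>0 < \<epsilon>\<close> by simp
      also have "\<dots> \<le> ennreal (norm (w x)) + ennreal \<epsilon> + (\<integral>\<^sup>+y. kern \<psi> t x y * h y \<partial>lborel)"
        unfolding c_def by (intro add_left_mono wavg)
      finally show ?thesis .
    qed
    have kmp: "(\<lambda>p. ennreal (kern \<psi> t (fst p) (snd p)) * h (snd p)) \<in> borel_measurable (lborel \<Otimes>\<^sub>M lborel)"
    proof -
      have "(\<lambda>p. kern \<psi> t (fst p) (snd p)) \<in> borel_measurable (lborel \<Otimes>\<^sub>M lborel)"
        using borel_measurable_kern(1)[OF cont, of t] by (simp add: lborel_prod)
      then show ?thesis using h(1) by measurable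
    qed
    \<comment> \<open>Integrating in \<open>x\<close> first removes the kernel, whose mass in
      \<open>x\<close> is 1.\<close>
    have fub: "(\<integral>\<^sup>+x. \<integral>\<^sup>+y. kern \<psi> t x y * h y \<partial>lborel \<partial>lborel) = (\<integral>\<^sup>+y. h y \<partial>lborel)"
    proof -
      have "(\<integral>\<^sup>+x. \<integral>\<^sup>+y. kern \<psi> t x y * h y \<partial>lborel \<partial>lborel) =
          (\<integral>\<^sup>+y. \<integral>\<^sup>+x. kern \<psi> t x y * h y \<partial>lborel \<partial>lborel)"
        using lborel_pair.Fubini'[of "\<lambda>x y. ennreal (kern \<psi> t x y) * h y"] kmp
        by (simp add: case_prod_beta)
      also have "\<dots> = (\<integral>\<^sup>+y. h y \<partial>lborel)"
      proof (rule nn_integral_cong)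
        fix y
        show "(\<integral>\<^sup>+x. kern \<psi> t x y * h y \<partial>lborel) = h y"
          using borel_measurable_kern(3)[OF cont, of t y] by (subst nn_integral_multc) (auto simp: k1[OF t(1)])
      qed
      finally show ?thesis .
    qed
    have im: "(\<lambda>x. \<integral>\<^sup>+y. kern \<psi> t x y * h y \<partial>lborel) \<in> borel_measurable lebesgue"
      using kmp by (intro measurable_completion lborel.borel_measurable_nn_integral) (simp add: case_prod_beta)
    have wm: "(\<lambda>y. ennreal (norm (w y))) \<in> borel_measurable lebesgue"
      using wi by measurable
    have "(\<integral>\<^sup>+x\<in>B. ennreal (norm (u x) - C) \<partial>lebesgue) \<le>
      (\<integral>\<^sup>+x. ennreal (norm (w x)) + ennreal \<epsilon> * indicator B x +
         (\<integral>\<^sup>+y. kern \<psi> t x y * h y \<partial>lborel) \<partial>lebesgue)"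
    proof (rule nn_integral_mono)
      fix x
      show "ennreal (norm (u x) - C) * indicator B x \<le> ennreal (norm (w x)) + ennreal \<epsilon> * indicator B x +
         (\<integral>\<^sup>+y. kern \<psi> t x y * h y \<partial>lborel)"
        using pt[of x] by (cases "x \<in> B") auto
    qed
    also have "\<dots> = (\<integral>\<^sup>+x. ennreal (norm (w x)) \<partial>lebesgue) + ennreal \<epsilon> * emeasure lebesgue B
        + (\<integral>\<^sup>+x. \<integral>\<^sup>+y. kern \<psi> t x y * h y \<partial>lborel \<partial>lebesgue)"
      using Bm im wm by (simp add: nn_integral_add nn_integral_cmult_indicator)
    also have "(\<integral>\<^sup>+x. ennreal (norm (w x)) \<partial>lebesgue) \<le> ennreal \<epsilon>"
    proof -
      have "(\<integral>\<^sup>+x. ennreal (norm (w x)) \<partial>lebesgue) = ennreal (LINT y|lebesgue. norm (w y))"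
        using wi by (intro nn_integral_eq_integral) auto
      then show ?thesis using g(3) by (simp add: w_def ennreal_leI)
    qed
    also have "(\<integral>\<^sup>+x. \<integral>\<^sup>+y. kern \<psi> t x y * h y \<partial>lborel \<partial>lebesgue) \<le> ennreal \<epsilon>"
      using fub hint by (simp add: nn_integral_completion)
    also have "emeasure lebesgue B = ennreal (measure lebesgue B)"
      using Bm by (simp add: emeasure_eq_ennreal_measure)
    also have "ennreal \<epsilon> + ennreal \<epsilon> * ennreal (measure lebesgue B) + ennreal \<epsilon> =
        ennreal (\<epsilon> * (2 + measure lebesgue B))"
      using that by (simp add: ennreal_mult[symmetric] ennreal_plus[symmetric] algebra_simps del: ennreal_plus)
    finally show ?thesis by (simp add: add_mono)
  qed
  have "(\<integral>\<^sup>+x\<in>B. ennreal (norm (u x) - C) \<partial>lebesgue) \<le> 0"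
  proof (rule ennreal_le_epsilon)
    fix \<epsilon> :: real assume "0 < \<epsilon>"
    have p: "0 < 2 + measure lebesgue B" by (simp add: add_pos_nonneg)
    then have "0 < \<epsilon> / (2 + measure lebesgue B)"
      using \<open>0 < \<epsilon>\<close> by simp
    from main[OF this] show "(\<integral>\<^sup>+x\<in>B. ennreal (norm (u x) - C) \<partial>lebesgue) \<le> 0 + ennreal \<epsilon>"
      using p by simp
  qed
  then have "(\<integral>\<^sup>+x. ennreal (norm (u x) - C) * indicator B x \<partial>lebesgue) = 0"
    by simp
  moreover have "(\<lambda>x. ennreal (norm (u x) - C) * indicator B x) \<in> borel_measurable lebesgue"
    using um Bm by measurable
  ultimately have "AE x in lebesgue. ennreal (norm (u x) - C) * indicator B x = 0"
    by (simp add: nn_integral_0_iff_AE)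
  then show ?thesis
    by eventually_elim (auto simp: indicator_def ennreal_eq_0_iff split: if_splits)
qed

section \<open>Scaled test functions and weak derivatives\<close>

text \<open>Sign and mass are left free and the ball is fixed: the class is then stable under
  multiplication by a coordinate, \<open>partial\<close> and \<open>dil\<close>, so all kernels of
  the iteration fit into the same cone.\<close>

definition bump :: "real ^ 'n \<Rightarrow> real \<Rightarrow> (real ^ 'n \<Rightarrow> real) \<Rightarrow> bool" where
  "bump w r \<psi> \<longleftrightarrow> smooth \<psi> \<and> (\<forall>z. z \<notin> cball w r \<longrightarrow> \<psi> z = 0)"

lemma bumpD: "bump w r \<psi> \<Longrightarrow> smooth \<psi>" "bump w r \<psi> \<Longrightarrow> z \<notin> cball w r \<Longrightarrow> \<psi> z = 0"
  by (auto simp: bump_def)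

lemma bump_coord: "bump w r \<psi> \<Longrightarrow> bump w r (\<lambda>z. z $ i * \<psi> z)"
  unfolding bump_def using smooth_mult[OF smooth_coord] by auto

lemma partial_zero_outside:
  assumes "closed A" "\<And>z. z \<notin> A \<Longrightarrow> \<psi> z = 0" "z \<notin> A"
  shows "partial i \<psi> z = 0"
proof -
  have "(\<psi> has_derivative (\<lambda>h. 0)) (at z)"
    by (rule has_derivative_transform_within_open[of "\<lambda>_. 0" _ _ _ "- A"]) (use assms in auto)
  then show ?thesis by (rule partial_eqI)
qed

lemma bump_partial: "bump w r \<psi> \<Longrightarrow> bump w r (partial i \<psi>)"
  unfolding bump_def using partial_zero_outside[of "cball w r" \<psi>] smooth_partial by auto

lemma bump_sum: "(\<And>i. i \<in> I \<Longrightarrow> bump w r (f i)) \<Longrightarrow> bump w r (\<lambda>z. \<Sum>i\<in>I. f i z)"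
  unfolding bump_def using smooth_sum[of I f] by (auto intro!: sum.neutral)

lemma bump_bounded:
  assumes "bump w r \<psi>"
  obtains M where "0 < M" "\<And>z. \<bar>\<psi> z\<bar> \<le> M"
proof -
  obtain M where "0 < M" "\<And>z. norm (\<psi> z) \<le> M"
    by (rule bounded_compact_support[of \<psi> "cball w r"]) (use assms in \<open>auto simp: bump_def smooth_continuous\<close>)
  then show thesis using that[of M] by simp
qed

section \<open>Rescaled bumps as test functions\<close>

lemma test_functions_iff:
  "\<phi> \<in> test_functions Q \<longleftrightarrow>
     smooth \<phi> \<and> compact (closure {x. \<phi> x \<noteq> 0}) \<and> closure {x. \<phi> x \<noteq> 0} \<subseteq> Q"
  by (simp add: test_functions_def smooth_iff_partials)

lemma test_functionsI:
  assumes "smooth \<phi>" "compact K" "K \<subseteq> Q" "\<And>x. x \<notin> K \<Longrightarrow> \<phi> x = 0"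
  shows "\<phi> \<in> test_functions Q"
proof -
  have K: "closure {x. \<phi> x \<noteq> 0} \<subseteq> K"
    using assms(4) by (intro closure_minimal compact_imp_closed assms(2)) blast
  have "bounded (closure {x. \<phi> x \<noteq> 0})"
    using K assms(2) bounded_subset compact_imp_bounded by blast
  then have "compact (closure {x. \<phi> x \<noteq> 0})"
    by (simp add: compact_eq_bounded_closed)
  then show ?thesis
    unfolding test_functions_iff using assms(1,3) K by blast
qed

lemma test_functions_partial:
  assumes "\<phi> \<in> test_functions Q"
  shows "partial i \<phi> \<in> test_functions Q"
proof (rule test_functionsI)
  show "partial i \<phi> x = 0" if "x \<notin> closure {x. \<phi> x \<noteq> 0}" for x
    by (rule partial_zero_outside[OF closed_closure _ that]) (use closure_subset[of "{x. \<phi> x \<noteq> 0}"] in blast)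
qed (use assms in \<open>auto simp: test_functions_iff smooth_partial\<close>)

lemma test_functions_partials: "\<phi> \<in> test_functions Q \<Longrightarrow> partials js \<phi> \<in> test_functions Q"
  by (induction js) (auto simp: partials_Cons test_functions_partial)

lemma kern_affine: "kern \<psi> t x = (\<lambda>y. (1 / t ^ CARD('n)) * \<psi> ((1 / t) *\<^sub>R (y - x)))"
  for \<psi> :: "real ^ 'n \<Rightarrow> real"
  by (simp add: kern_def fun_eq_iff)

lemma smooth_kern: "smooth \<psi> \<Longrightarrow> smooth (kern \<psi> t x)"
  unfolding kern_affine by (intro smooth_mult smooth_const smooth_affine)

text \<open>The support lies in the image of the ball under \<open>z\<close> to
  \<open>x + t z\<close>, which is compact and, by the last hypothesis, inside \<open>Q\<close>; the
  point \<open>x\<close> itself may lie outside the support.\<close>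

lemma kern_test_function:
  assumes \<psi>: "bump w r \<psi>" and "0 < t" and "\<And>z. z \<in> cball w r \<Longrightarrow> x + t *\<^sub>R z \<in> Q"
  shows "kern \<psi> t x \<in> test_functions Q"
proof (rule test_functionsI)
  show "smooth (kern \<psi> t x)" using \<psi> by (simp add: smooth_kern bump_def)
  show "compact ((\<lambda>z. x + t *\<^sub>R z) ` cball w r)"
    by (intro compact_continuous_image continuous_intros compact_cball)
  show "(\<lambda>z. x + t *\<^sub>R z) ` cball w r \<subseteq> Q" using assms by auto
  show "kern \<psi> t x y = 0" if "y \<notin> (\<lambda>z. x + t *\<^sub>R z) ` cball w r" for y
  proof -
    have "y = x + t *\<^sub>R ((1 / t) *\<^sub>R (y - x))" using \<open>0 < t\<close> by simp
    then have "(1 / t) *\<^sub>R (y - x) \<notin> cball w r" using that by blast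
    then show ?thesis using \<psi> by (simp add: kern_def bump_def)
  qed
qed

lemma partial_kern:
  assumes "smooth \<psi>"
  shows "partial i (kern \<psi> t x) y = (1 / t) * kern (partial i \<psi>) t x y"
proof -
  have "partial i (kern \<psi> t x) = (\<lambda>y. (1 / t ^ CARD('a)) * ((1 / t) * partial i \<psi> ((1 / t) *\<^sub>R (y - x))))"
    unfolding kern_affine
    using partial_mult[of "\<lambda>_. 1 / t ^ CARD('a)" "\<lambda>y. \<psi> ((1 / t) *\<^sub>R (y - x))" i]
      partial_affine[of \<psi> i "1 / t" x] smooth_differentiable[OF assms]
      smooth_differentiable[OF smooth_affine[OF assms]]
    by (simp add: partial_const)
  then show ?thesis by (simp add: kern_def)
qed

text \<open>The function \<open>F(t)\<close> of the overview after the substitution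
  \<open>y = x + t z\<close>.\<close>

definition avg :: "(real ^ 'n) set \<Rightarrow> (real ^ 'n \<Rightarrow> real) \<Rightarrow> real \<Rightarrow> real ^ 'n \<Rightarrow>
    (real ^ 'n \<Rightarrow> 'b::euclidean_space) \<Rightarrow> 'b" where
  "avg Q \<psi> t x v = (LINT y|lebesgue_on Q. kern \<psi> t x y *\<^sub>R v y)"

lemma kern_integrable_bump:
  fixes v :: "real ^ 'n \<Rightarrow> 'b::euclidean_space"
  assumes "bump w r \<psi>" "integrable (lebesgue_on Q) v"
  shows "integrable (lebesgue_on Q) (\<lambda>y. kern \<psi> t x y *\<^sub>R v y)"
  using assms by (intro kern_integrable[of _ _ _ "cball w r"]) (auto simp: bump_def smooth_continuous)

lemma avg_partial:
  fixes v :: "real ^ 'n \<Rightarrow> 'b::euclidean_space"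
  assumes wd: "weak_deriv Q [i] v g" and \<psi>: "bump w r \<psi>" and "0 < t"
    and "\<And>z. z \<in> cball w r \<Longrightarrow> x + t *\<^sub>R z \<in> Q"
  shows "(LINT y|lebesgue_on Q. partial i (kern \<psi> t x) y *\<^sub>R v y) = - avg Q \<psi> t x g"
proof -
  have "kern \<psi> t x \<in> test_functions Q"
    using \<psi> assms(3,4) by (rule kern_test_function)
  then show ?thesis
    using wd by (simp add: weak_deriv_def partials_Cons avg_def)
qed

text \<open>The divergence of \<open>z \<psi>(z)\<close>; up to the factor \<open>- 1 / t\<close> it generates the change of scale.\<close>

definition dil :: "(real ^ 'n \<Rightarrow> real) \<Rightarrow> real ^ 'n \<Rightarrow> real" where
  "dil \<psi> z = (\<Sum>i\<in>UNIV. partial i (\<lambda>z. z $ i * \<psi> z) z)"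

lemma bump_dil: "bump w r \<psi> \<Longrightarrow> bump w r (dil \<psi>)"
  unfolding dil_def[abs_def] by (intro bump_sum bump_partial bump_coord)

lemma dil_eq:
  fixes \<psi> :: "real ^ 'n \<Rightarrow> real"
  assumes "smooth \<psi>"
  shows "dil \<psi> z = real CARD('n) * \<psi> z + (\<Sum>i\<in>UNIV. z $ i * partial i \<psi> z)"
proof -
  have c: "partial i (\<lambda>z :: real ^ 'n. z $ i) = (\<lambda>z. 1)" for i
  proof
    fix z :: "real ^ 'n"
    have "((\<lambda>z. z $ i) has_derivative (\<lambda>h. h $ i)) (at z)"
      by (intro bounded_linear_imp_has_derivative bounded_linear_vec_nth)
    from partial_eqI[OF this, of i] show "partial i (\<lambda>z. z $ i) z = 1" by (simp add: axis_def)
  qed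
  have "partial i (\<lambda>z. z $ i * \<psi> z) = (\<lambda>z. z $ i * partial i \<psi> z + 1 * \<psi> z)" for i
    using partial_mult[of "\<lambda>z. z $ i" \<psi> i, OF smooth_differentiable[OF smooth_coord]
      smooth_differentiable[OF assms]] by (simp add: c)
  then show ?thesis by (simp add: dil_def sum.distrib)
qed

text \<open>The factor \<open>t^n\<close> in the denominator contributes \<open>- n \<psi>\<close>,
  the argument of \<open>\<psi>\<close> contributes \<open>- z\<close> times its gradient, both over
  \<open>t\<close>; by \<open>dil_eq\<close> the sum is \<open>- dil \<psi>\<close>.\<close>

lemma kern_has_t_derivative:
  fixes \<psi> :: "real ^ 'n \<Rightarrow> real"
  assumes "smooth \<psi>" "0 < t"
  shows "((\<lambda>t. kern \<psi> t x y) has_real_derivative - (1 / t) * kern (dil \<psi>) t x y) (at t)"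
proof -
  let ?n = "CARD('n)" and ?z = "(1 / t) *\<^sub>R (y - x)"
  have "((\<lambda>t. (1 / t) *\<^sub>R (y - x)) has_derivative (\<lambda>h. (- h / t\<^sup>2) *\<^sub>R (y - x))) (at t)"
    using \<open>0 < t\<close> by (auto intro!: derivative_eq_intros simp: power2_eq_square)
  from has_derivative_compose[OF this differentiable_has_derivative_partial[OF smooth_differentiable[OF assms(1)]]]
  have "((\<lambda>t. \<psi> ((1 / t) *\<^sub>R (y - x))) has_derivative
      (\<lambda>h. \<Sum>i\<in>UNIV. ((- h / t\<^sup>2) *\<^sub>R (y - x)) $ i * partial i \<psi> ?z)) (at t)" .
  moreover have "(\<Sum>i\<in>UNIV. ((- h / t\<^sup>2) *\<^sub>R (y - x)) $ i * partial i \<psi> ?z) =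
      (- (1 / t) * (\<Sum>i\<in>UNIV. ?z $ i * partial i \<psi> ?z)) * h" for h
    unfolding sum_distrib_left sum_distrib_right
    by (rule sum.cong) (use \<open>0 < t\<close> in \<open>auto simp: power2_eq_square\<close>)
  ultimately have d1: "((\<lambda>t. \<psi> ((1 / t) *\<^sub>R (y - x))) has_real_derivative
      - (1 / t) * (\<Sum>i\<in>UNIV. ?z $ i * partial i \<psi> ?z)) (at t)"
    unfolding has_field_derivative_def by (simp only:)
  have d2: "((\<lambda>t. t ^ ?n) has_real_derivative real ?n * t ^ (?n - 1)) (at t)"
    using DERIV_pow[of ?n t UNIV] by simp
  have n: "t ^ ?n = t * t ^ (?n - 1)"
    by (metis power_eq_if zero_less_card_finite less_numeral_extra(3))
  from DERIV_divide[OF d1 d2] \<open>0 < t\<close>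
  have "((\<lambda>t. kern \<psi> t x y) has_real_derivative
     (- (1 / t) * (\<Sum>i\<in>UNIV. ?z $ i * partial i \<psi> ?z) * t ^ ?n - \<psi> ?z * (real ?n * t ^ (?n - 1)))
       / (t ^ ?n * t ^ ?n)) (at t)"
    unfolding kern_def by simp
  moreover have "(- (1 / t) * (\<Sum>i\<in>UNIV. ?z $ i * partial i \<psi> ?z) * t ^ ?n - \<psi> ?z * (real ?n * t ^ (?n - 1)))
       / (t ^ ?n * t ^ ?n) = - (1 / t) * kern (dil \<psi>) t x y"
  proof -
    define S where "S = (\<Sum>i\<in>UNIV. ?z $ i * partial i \<psi> ?z)"
    define P where "P = \<psi> ?z"
    define N where "N = real ?n"
    define q where "q = t ^ (?n - 1)"
    have q: "q \<noteq> 0" using \<open>0 < t\<close> by (simp add: q_def)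
    show ?thesis
      unfolding kern_def dil_eq[OF assms(1)] S_def[symmetric] P_def[symmetric] N_def[symmetric] n q_def[symmetric]
      using \<open>0 < t\<close> q by (simp add: field_simps)
  qed
  ultimately show ?thesis by simp
qed

text \<open>Provides the dominating function for differentiating under the integral. It is uniform
  in \<open>x\<close> and \<open>y\<close> because only the supremum of \<open>dil \<psi>\<close>
  and the smallest scale enter.\<close>

lemma kern_t_lipschitz:
  fixes \<psi> :: "real ^ 'n \<Rightarrow> real"
  assumes \<psi>: "bump w r \<psi>" and "0 < \<tau>"
  obtains L where "0 \<le> L"
    "\<And>s t x y. \<tau> \<le> s \<Longrightarrow> \<tau> \<le> t \<Longrightarrow> \<bar>kern \<psi> s x y - kern \<psi> t x y\<bar> \<le> L * \<bar>s - t\<bar>"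
    "\<And>t x y. \<tau> \<le> t \<Longrightarrow> \<bar>(1 / t) * kern (dil \<psi>) t x y\<bar> \<le> L"
proof -
  obtain M where M: "0 < M" "\<And>z. \<bar>dil \<psi> z\<bar> \<le> M"
    using bump_bounded[OF bump_dil[OF \<psi>]] by blast
  define L where "L = (1 / \<tau>) * (M / \<tau> ^ CARD('n))"
  have L: "\<bar>(1 / t) * kern (dil \<psi>) t x y\<bar> \<le> L" if "\<tau> \<le> t" for t x y
  proof -
    have "\<tau> ^ CARD('n) \<le> t ^ CARD('n)" using that \<open>0 < \<tau>\<close> by (simp add: power_mono)
    then have "\<bar>kern (dil \<psi>) t x y\<bar> \<le> M / \<tau> ^ CARD('n)"
      unfolding kern_def abs_divide using M that \<open>0 < \<tau>\<close> by (intro frac_le) auto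
    then show ?thesis
      unfolding L_def abs_mult using that \<open>0 < \<tau>\<close> M(1) by (intro mult_mono) (auto simp: field_simps)
  qed
  show thesis
  proof
    show "0 \<le> L" using M \<open>0 < \<tau>\<close> by (simp add: L_def)
    fix s t :: real and x y assume "\<tau> \<le> s" "\<tau> \<le> t"
    show "\<bar>kern \<psi> s x y - kern \<psi> t x y\<bar> \<le> L * \<bar>s - t\<bar>"
      using field_differentiable_bound[of "{\<tau>..}" "\<lambda>t. kern \<psi> t x y"
          "\<lambda>t. - (1 / t) * kern (dil \<psi>) t x y" L s t]
        L kern_has_t_derivative[OF bumpD(1)[OF \<psi>]] \<open>0 < \<tau>\<close> \<open>\<tau> \<le> s\<close> \<open>\<tau> \<le> t\<close>
      by (fastforce simp: norm_minus_commute abs_minus_commute intro: has_field_derivative_at_within)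
  qed (use L in auto)
qed

text \<open>By \<open>partial_kern\<close> the factor \<open>1 / t\<close> in the scale derivative
  is exactly the one produced by a derivative in \<open>y\<close>. So the kernel changes by minus
  the divergence of the kernels of \<open>z $ i * \<psi> z\<close>, and testing the weak derivatives
  moves it onto \<open>v\<close> without any loss in \<open>t\<close>.\<close>

lemma avg_has_vector_derivative:
  fixes v :: "real ^ 'n \<Rightarrow> 'b::euclidean_space"
  assumes \<psi>: "bump w r \<psi>" and v: "integrable (lebesgue_on Q) v" and "0 < t"
    and Q: "\<And>z. z \<in> cball w r \<Longrightarrow> x + t *\<^sub>R z \<in> Q"
    and wd: "\<And>i. weak_deriv Q [i] v (g i)"
  shows "((\<lambda>t. avg Q \<psi> t x v) has_vector_derivative
      (\<Sum>i\<in>UNIV. avg Q (\<lambda>z. z $ i * \<psi> z) t x (g i))) (at t)"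
proof -
  define k' where "k' y = - (1 / t) * kern (dil \<psi>) t x y" for y
  \<comment> \<open>Scales stay above \<open>t / 2\<close>, since the Lipschitz constant degenerates
    as the scale tends to 0.\<close>
  obtain L where L: "0 \<le> L"
    "\<And>s t' x y. t / 2 \<le> s \<Longrightarrow> t / 2 \<le> t' \<Longrightarrow> \<bar>kern \<psi> s x y - kern \<psi> t' x y\<bar> \<le> L * \<bar>s - t'\<bar>"
    "\<And>t' x y. t / 2 \<le> t' \<Longrightarrow> \<bar>(1 / t') * kern (dil \<psi>) t' x y\<bar> \<le> L"
    using kern_t_lipschitz[OF \<psi>, of "t / 2"] \<open>0 < t\<close> half_gt_zero by blast
  have ki: "integrable (lebesgue_on Q) (\<lambda>y. kern \<psi> s x y *\<^sub>R v y)" for s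
    by (rule kern_integrable_bump[OF \<psi> v])
  have k'i: "integrable (lebesgue_on Q) (\<lambda>y. k' y *\<^sub>R v y)"
  proof -
    have "integrable (lebesgue_on Q) (\<lambda>y. (- (1 / t)) *\<^sub>R (kern (dil \<psi>) t x y *\<^sub>R v y))"
      by (intro integrable_scaleR_right kern_integrable_bump[OF bump_dil[OF \<psi>] v])
    then show ?thesis by (simp add: k'_def)
  qed
  define D where "D = (LINT y|lebesgue_on Q. k' y *\<^sub>R v y)"
  \<comment> \<open>The linearisation error of the integrand at scale \<open>s\<close>; divided by
    \<open>\<bar>s - t\<bar>\<close> it tends to 0 pointwise and is dominated by
    \<open>2 * L * norm (v y)\<close>.\<close>
  define E where "E s y = (kern \<psi> s x y - kern \<psi> t x y - (s - t) * k' y) *\<^sub>R v y" for s y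
  have Ei: "integrable (lebesgue_on Q) (E s)" for s
  proof -
    have "integrable (lebesgue_on Q) (\<lambda>y. kern \<psi> s x y *\<^sub>R v y - kern \<psi> t x y *\<^sub>R v y - (s - t) *\<^sub>R (k' y *\<^sub>R v y))"
      by (intro Bochner_Integration.integrable_diff integrable_scaleR_right ki k'i)
    then show ?thesis
      by (simp add: E_def[abs_def] scaleR_diff_left)
  qed
  have Eint: "avg Q \<psi> s x v - avg Q \<psi> t x v - (s - t) *\<^sub>R D = integral\<^sup>L (lebesgue_on Q) (E s)" for s
  proof -
    have "integral\<^sup>L (lebesgue_on Q) (E s) =
        (LINT y|lebesgue_on Q. kern \<psi> s x y *\<^sub>R v y - kern \<psi> t x y *\<^sub>R v y - (s - t) *\<^sub>R (k' y *\<^sub>R v y))"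
      by (simp add: E_def[abs_def] scaleR_diff_left)
    also have "\<dots> = avg Q \<psi> s x v - avg Q \<psi> t x v - (s - t) *\<^sub>R D"
      unfolding avg_def D_def
      by (subst Bochner_Integration.integral_diff | intro Bochner_Integration.integrable_diff
          integrable_scaleR_right ki k'i | subst integral_scaleR_right | rule refl)+
    finally show ?thesis by simp
  qed
  \<comment> \<open>The restriction to \<open>s > t / 2\<close> makes the bounds of \<open>L\<close>
    available; it is an open neighbourhood of \<open>t\<close>, so the limit is the full
    one.\<close>
  have "((\<lambda>s. LINT y|lebesgue_on Q. norm (E s y) / \<bar>s - t\<bar>) \<longlongrightarrow> 0) (at t within {t / 2<..})"
    unfolding tendsto_at_iff_sequentially comp_def
  proof (intro allI impI)
    fix X :: "nat \<Rightarrow> real"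
    assume X: "\<forall>k. X k \<in> {t / 2<..} - {t}" "X \<longlonglongrightarrow> t"
    have "(\<lambda>k. LINT y|lebesgue_on Q. norm (E (X k) y) / \<bar>X k - t\<bar>) \<longlonglongrightarrow> (LINT y|lebesgue_on Q. (0::real))"
    proof (rule integral_dominated_convergence[where w = "\<lambda>y. 2 * L * norm (v y)"])
      show "AE y in lebesgue_on Q. (\<lambda>k. norm (E (X k) y) / \<bar>X k - t\<bar>) \<longlonglongrightarrow> 0"
      proof (intro AE_I2)
        fix y
        have "((\<lambda>s. (kern \<psi> s x y - kern \<psi> t x y) / (s - t)) \<longlongrightarrow> k' y) (at t)"
          using kern_has_t_derivative[OF bumpD(1)[OF \<psi>] \<open>0 < t\<close>, of x y]
          by (simp add: has_field_derivative_iff k'_def)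
        then have "((\<lambda>s. norm (((kern \<psi> s x y - kern \<psi> t x y) / (s - t) - k' y) *\<^sub>R v y)) \<longlongrightarrow>
            norm ((k' y - k' y) *\<^sub>R v y)) (at t)"
          by (intro tendsto_intros)
        then have "(\<lambda>k. norm (((kern \<psi> (X k) x y - kern \<psi> t x y) / (X k - t) - k' y) *\<^sub>R v y)) \<longlonglongrightarrow> 0"
          using X unfolding tendsto_at_iff_sequentially comp_def by simp
        moreover have "norm (((kern \<psi> (X k) x y - kern \<psi> t x y) / (X k - t) - k' y) *\<^sub>R v y) =
            norm (E (X k) y) / \<bar>X k - t\<bar>" for k
        proof -
          have "X k - t \<noteq> 0" using X by auto
          then have "(kern \<psi> (X k) x y - kern \<psi> t x y) / (X k - t) - k' y =
              (kern \<psi> (X k) x y - kern \<psi> t x y - (X k - t) * k' y) / (X k - t)"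
            by (simp add: field_simps)
          then show ?thesis by (simp add: E_def)
        qed
        ultimately show "(\<lambda>k. norm (E (X k) y) / \<bar>X k - t\<bar>) \<longlonglongrightarrow> 0" by simp
      qed
      show "AE y in lebesgue_on Q. norm (norm (E (X k) y) / \<bar>X k - t\<bar>) \<le> 2 * L * norm (v y)" for k
      proof (intro AE_I2)
        fix y
        have Xk: "t / 2 \<le> X k" "X k \<noteq> t" using X(1) by (auto simp: less_imp_le)
        have "\<bar>kern \<psi> (X k) x y - kern \<psi> t x y - (X k - t) * k' y\<bar> \<le> L * \<bar>X k - t\<bar> + \<bar>X k - t\<bar> * L"
        proof -
          have "\<bar>kern \<psi> (X k) x y - kern \<psi> t x y\<bar> \<le> L * \<bar>X k - t\<bar>"
            using L(2)[OF Xk(1), of t x y] \<open>0 < t\<close> by simp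
          moreover have "\<bar>k' y\<bar> \<le> L"
            unfolding k'_def using L(3)[of t x y] \<open>0 < t\<close> by simp
          then have "\<bar>(X k - t) * k' y\<bar> \<le> \<bar>X k - t\<bar> * L"
            by (simp add: abs_mult mult_left_mono)
          ultimately show ?thesis by linarith
        qed
        then have "norm (E (X k) y) \<le> (2 * L * \<bar>X k - t\<bar>) * norm (v y)"
          unfolding E_def norm_scaleR by (intro mult_right_mono) auto
        then show "norm (norm (E (X k) y) / \<bar>X k - t\<bar>) \<le> 2 * L * norm (v y)"
          using Xk(2) by (simp add: field_simps)
      qed
      show "(\<lambda>y. norm (E (X k) y) / \<bar>X k - t\<bar>) \<in> borel_measurable (lebesgue_on Q)" for k
        using Ei[of "X k"] by (intro borel_measurable_integrable) auto
      show "integrable (lebesgue_on Q) (\<lambda>y. 2 * L * norm (v y))" using v by auto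
    qed auto
    then show "(\<lambda>k. LINT y|lebesgue_on Q. norm (E (X k) y) / \<bar>X k - t\<bar>) \<longlonglongrightarrow> 0" by simp
  qed
  then have lim: "((\<lambda>s. LINT y|lebesgue_on Q. norm (E s y) / \<bar>s - t\<bar>) \<longlongrightarrow> 0) (at t)"
    using \<open>0 < t\<close> at_within_open[of t "{t / 2<..}"] by simp
  have "((\<lambda>s. norm (avg Q \<psi> s x v - avg Q \<psi> t x v - (s - t) *\<^sub>R D) / norm (s - t)) \<longlongrightarrow> 0) (at t)"
  proof (rule tendsto_sandwich[OF _ _ tendsto_const lim])
    show "\<forall>\<^sub>F s in at t. norm (avg Q \<psi> s x v - avg Q \<psi> t x v - (s - t) *\<^sub>R D) / norm (s - t)
        \<le> (LINT y|lebesgue_on Q. norm (E s y) / \<bar>s - t\<bar>)"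
    proof (intro always_eventually allI)
      fix s
      have "norm (integral\<^sup>L (lebesgue_on Q) (E s)) / \<bar>s - t\<bar> \<le> (LINT y|lebesgue_on Q. norm (E s y)) / \<bar>s - t\<bar>"
        by (intro divide_right_mono integral_norm_bound) auto
      then show "norm (avg Q \<psi> s x v - avg Q \<psi> t x v - (s - t) *\<^sub>R D) / norm (s - t)
        \<le> (LINT y|lebesgue_on Q. norm (E s y) / \<bar>s - t\<bar>)"
        by (simp add: Eint)
    qed
  qed auto
  then have der: "((\<lambda>t. avg Q \<psi> t x v) has_vector_derivative D) (at t)"
    unfolding has_vector_derivative_def has_derivative_iff_norm
    by (auto intro: bounded_linear_scaleR_left)
  \<comment> \<open>The kernel of \<open>dil \<psi>\<close> over \<open>t\<close> is recognised as a
    divergence in \<open>y\<close>.\<close>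
  have "D = (LINT y|lebesgue_on Q. - (\<Sum>i\<in>UNIV. partial i (kern (\<lambda>z. z $ i * \<psi> z) t x) y *\<^sub>R v y))"
    unfolding D_def k'_def
    by (simp add: partial_kern[OF bumpD(1)[OF bump_coord[OF \<psi>]]] dil_def kern_def sum_divide_distrib
        sum_distrib_left scaleR_sum_left sum_negf)
  also have "\<dots> = - (\<Sum>i\<in>UNIV. LINT y|lebesgue_on Q. partial i (kern (\<lambda>z. z $ i * \<psi> z) t x) y *\<^sub>R v y)"
  proof -
    have "integrable (lebesgue_on Q) (\<lambda>y. partial i (kern (\<lambda>z. z $ i * \<psi> z) t x) y *\<^sub>R v y)" for i
    proof -
      have "integrable (lebesgue_on Q) (\<lambda>y. (1 / t) *\<^sub>R (kern (partial i (\<lambda>z. z $ i * \<psi> z)) t x y *\<^sub>R v y))"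
        by (intro integrable_scaleR_right kern_integrable_bump[OF bump_partial[OF bump_coord[OF \<psi>]] v])
      then show ?thesis
        by (simp add: partial_kern[OF bumpD(1)[OF bump_coord[OF \<psi>]]])
    qed
    then show ?thesis by (simp add: Bochner_Integration.integral_sum)
  qed
  also have "\<dots> = (\<Sum>i\<in>UNIV. avg Q (\<lambda>z. z $ i * \<psi> z) t x (g i))"
    using avg_partial[OF wd bump_coord[OF \<psi>] \<open>0 < t\<close> Q] by (simp add: sum_negf)
  finally show ?thesis using der by simp
qed

section \<open>Sobolev embedding into bounded functions\<close>

text \<open>\<open>A\<close> bounds the integral of the \<open>p\<close>-th power without the root,
  to compare directly with the summands in \<open>sobolev_norm\<close>. Plain integrability is
  included because it is what integration against the bounded kernels requires.\<close>

definition lp_bdd :: "(real ^ 'n) set \<Rightarrow> real \<Rightarrow> real \<Rightarrow> (real ^ 'n \<Rightarrow> 'b::euclidean_space) \<Rightarrow> bool" where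
  "lp_bdd Q p A v \<longleftrightarrow> integrable (lebesgue_on Q) v \<and>
     integrable (lebesgue_on Q) (\<lambda>x. norm (v x) powr p) \<and>
     (LINT x|lebesgue_on Q. norm (v x) powr p) \<le> A"

text \<open>Derivatives are taken one at a time, as the induction on averages consumes them, and are
  existentially quantified, so no choice of representative is built in.\<close>

primrec sob_bdd :: "(real ^ 'n) set \<Rightarrow> real \<Rightarrow> real \<Rightarrow> nat \<Rightarrow> (real ^ 'n \<Rightarrow> 'b::euclidean_space) \<Rightarrow> bool" where
  "sob_bdd Q p A 0 v = lp_bdd Q p A v"
| "sob_bdd Q p A (Suc m) v =
    (lp_bdd Q p A v \<and> (\<exists>g. \<forall>i. weak_deriv Q [i] v (g i) \<and> sob_bdd Q p A m (g i)))"

lemma sob_bdd_imp_lp_bdd: "sob_bdd Q p A m v \<Longrightarrow> lp_bdd Q p A v"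
  by (cases m) auto

lemma integrable_on_restrict:
  fixes f :: "'a \<Rightarrow> real"
  assumes "integrable M f" "Q \<in> sets M"
  shows "integrable (restrict_space M Q) f"
    and "(\<And>x. 0 \<le> f x) \<Longrightarrow> integral\<^sup>L (restrict_space M Q) f \<le> integral\<^sup>L M f"
proof -
  have Q: "Q \<inter> space M \<in> sets M" using assms by auto
  have i: "integrable M (\<lambda>x. indicator Q x *\<^sub>R f x)"
    by (rule integrable_mult_indicator) fact+
  then show "integrable (restrict_space M Q) f"
    by (simp add: integrable_restrict_space[OF Q])
  show "integral\<^sup>L (restrict_space M Q) f \<le> integral\<^sup>L M f" if "\<And>x. 0 \<le> f x"
    unfolding integral_restrict_space[OF Q]
    by (rule integral_mono'[OF assms(1)]) (use that in \<open>auto simp: indicator_def\<close>)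
qed

section \<open>Bounds for averages at small scales\<close>

lemma integral_abs_kern:
  fixes \<psi> :: "real ^ 'n \<Rightarrow> real"
  assumes \<psi>: "bump w r \<psi>"
  obtains V where "0 \<le> V" "\<And>t x. 0 < t \<Longrightarrow> integrable lebesgue (\<lambda>y. \<bar>kern \<psi> t x y\<bar>)"
    "\<And>t x. 0 < t \<Longrightarrow> (LINT y|lebesgue. \<bar>kern \<psi> t x y\<bar>) = V"
proof -
  have cont: "continuous_on UNIV (\<lambda>z. \<bar>\<psi> z\<bar>)"
    by (intro continuous_on_rabs smooth_continuous bumpD(1)[OF \<psi>])
  have "set_integrable lborel (cball w r) (\<lambda>z. \<bar>\<psi> z\<bar>)"
    unfolding set_integrable_def
    by (rule borel_integrable_compact) (auto intro: continuous_on_subset[OF cont])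
  moreover have "(\<lambda>z. indicat_real (cball w r) z *\<^sub>R \<bar>\<psi> z\<bar>) = (\<lambda>z. \<bar>\<psi> z\<bar>)"
    using \<psi> by (auto simp: bump_def indicator_def fun_eq_iff)
  ultimately have int: "integrable lborel (\<lambda>z. \<bar>\<psi> z\<bar>)"
    by (simp add: set_integrable_def)
  have k: "has_bochner_integral lborel (\<lambda>y. \<bar>kern \<psi> t x y\<bar>) (LINT z|lborel. \<bar>\<psi> z\<bar>)" if "0 < t" for t x
  proof -
    have eq: "\<bar>kern \<psi> t x y\<bar> = kern (\<lambda>z. \<bar>\<psi> z\<bar>) t x y" for y
      using that by (simp add: kern_def)
    show ?thesis
      unfolding eq
    proof (rule has_bochner_integral_nn_integral)
      show "(\<integral>\<^sup>+y. kern (\<lambda>z. \<bar>\<psi> z\<bar>) t x y \<partial>lborel) = ennreal (LINT z|lborel. \<bar>\<psi> z\<bar>)"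
        using int by (simp add: nn_integral_kern(1)[OF cont _ that] nn_integral_eq_integral)
    qed (use that borel_measurable_kern(2)[OF cont] in \<open>auto simp: kern_def\<close>)
  qed
  have m: "(\<lambda>y. \<bar>kern \<psi> t x y\<bar>) \<in> borel_measurable lborel" for t x
    using borel_measurable_kern(2)[OF smooth_continuous[OF bumpD(1)[OF \<psi>]]] by simp
  show thesis
  proof
    show "0 \<le> (LINT z|lborel. \<bar>\<psi> z\<bar>)" by simp
  qed (use k m in \<open>auto simp: has_bochner_integral_iff integrable_completion integral_completion\<close>)
qed

text \<open>In place of Hoelder's inequality, values are split at the level
  \<open>s = t powr - (n / p)\<close>. The small ones cost \<open>s\<close> times the mass
  \<open>V\<close> of the kernel, the large ones the supremum \<open>M / t^n\<close> times
  \<open>s powr (1 - p)\<close> times \<open>A\<close>, and for this level the second cost is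
  \<open>M * A * s\<close> as well.\<close>

lemma avg_lp_bound:
  fixes \<psi> :: "real ^ 'n \<Rightarrow> real"
  assumes \<psi>: "bump w r \<psi>" and "1 \<le> p" and Q: "Q \<in> sets lebesgue"
  shows "\<exists>C\<ge>0. \<forall>v :: real ^ 'n \<Rightarrow> 'b::euclidean_space. lp_bdd Q p A v \<longrightarrow>
     (\<forall>x t. 0 < t \<longrightarrow> norm (avg Q \<psi> t x v) \<le> C * t powr - (real CARD('n) / p))"
proof -
  let ?n = "CARD('n)"
  obtain V where V: "0 \<le> V" "\<And>t x. 0 < t \<Longrightarrow> integrable lebesgue (\<lambda>y. \<bar>kern \<psi> t x y\<bar>)"
    "\<And>t x. 0 < t \<Longrightarrow> (LINT y|lebesgue. \<bar>kern \<psi> t x y\<bar>) = V"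
    using integral_abs_kern[OF \<psi>] by blast
  obtain M where M: "0 < M" "\<And>z. \<bar>\<psi> z\<bar> \<le> M" using bump_bounded[OF \<psi>] by blast
  have bound: "norm (avg Q \<psi> t x v) \<le> (V + M * \<bar>A\<bar>) * t powr - (real ?n / p)"
    if v: "lp_bdd Q p A v" and t: "0 < t" for v :: "real ^ 'n \<Rightarrow> 'b" and x t
  proof -
    define s where "s = t powr - (real ?n / p)"
    have s: "0 < s" using t by (simp add: s_def)
    \<comment> \<open>Above the level \<open>s\<close> one has
      \<open>norm c powr (1 - p) \<le> s powr (1 - p)\<close>, because \<open>1 - p\<close> is not
      positive.\<close>
    have young: "norm c \<le> s + s powr (1 - p) * norm c powr p" for c :: 'b
    proof (cases "norm c \<le> s")
      case True
      then show ?thesis by (simp add: add_increasing2)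
    next
      case False
      then have "norm c = norm c powr (1 - p) * norm c powr p"
        using s by (simp add: powr_add[symmetric])
      also have "\<dots> \<le> s powr (1 - p) * norm c powr p"
        using False s \<open>1 \<le> p\<close> by (intro mult_right_mono powr_mono2') auto
      finally show ?thesis using s by simp
    qed
    have ki: "integrable (lebesgue_on Q) (\<lambda>y. \<bar>kern \<psi> t x y\<bar>)"
      and kV: "(LINT y|lebesgue_on Q. \<bar>kern \<psi> t x y\<bar>) \<le> V"
      using integrable_on_restrict[OF V(2)[OF t, of x] Q] V(3)[OF t, of x] by auto
    have vi: "integrable (lebesgue_on Q) v" "integrable (lebesgue_on Q) (\<lambda>y. norm (v y) powr p)"
      and vA: "(LINT y|lebesgue_on Q. norm (v y) powr p) \<le> A"
      using v by (auto simp: lp_bdd_def)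
    define q where "q = (M / t ^ ?n) * s powr (1 - p)"
    have q: "0 \<le> q" using M t by (simp add: q_def)
    have "norm (avg Q \<psi> t x v) \<le> (LINT y|lebesgue_on Q. s * \<bar>kern \<psi> t x y\<bar> + q * norm (v y) powr p)"
      unfolding avg_def
    proof (rule Bochner_Integration.integral_norm_bound_integral)
      fix y
      have "norm (kern \<psi> t x y *\<^sub>R v y) \<le> \<bar>kern \<psi> t x y\<bar> * (s + s powr (1 - p) * norm (v y) powr p)"
        unfolding norm_scaleR by (rule mult_left_mono[OF young]) simp
      also have "\<dots> = s * \<bar>kern \<psi> t x y\<bar> + \<bar>kern \<psi> t x y\<bar> * (s powr (1 - p) * norm (v y) powr p)"
        by (simp add: algebra_simps)
      also have "\<bar>kern \<psi> t x y\<bar> * (s powr (1 - p) * norm (v y) powr p) \<le>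
          (M / t ^ ?n) * (s powr (1 - p) * norm (v y) powr p)"
        using M t by (intro mult_right_mono) (auto simp: kern_def abs_divide divide_right_mono)
      finally show "norm (kern \<psi> t x y *\<^sub>R v y) \<le> s * \<bar>kern \<psi> t x y\<bar> + q * norm (v y) powr p"
        by (simp add: q_def mult.assoc)
    qed (use ki vi kern_integrable_bump[OF \<psi>] in auto)
    also have "\<dots> = s * (LINT y|lebesgue_on Q. \<bar>kern \<psi> t x y\<bar>) + q * (LINT y|lebesgue_on Q. norm (v y) powr p)"
      using ki vi by simp
    also have "\<dots> \<le> s * V + q * \<bar>A\<bar>"
      using kV vA s q by (intro add_mono mult_left_mono) auto
    also have "q = M * s"
    proof -
      have "s powr (1 - p) = t powr real ?n * s"
      proof -
        have "- (real ?n / p) * (1 - p) = real ?n + - (real ?n / p)"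
          using \<open>1 \<le> p\<close> by (simp add: field_simps)
        then show ?thesis unfolding s_def powr_powr by (simp only: powr_add)
      qed
      then show ?thesis
        using t by (simp add: q_def powr_realpow)
    qed
    finally show ?thesis by (simp add: s_def algebra_simps)
  qed
  have "0 \<le> V + M * \<bar>A\<bar>" using V M by simp
  then show ?thesis using bound by blast
qed

text \<open>Each weak derivative gains one power of the scale: \<open>avg\<close> differentiated in \<open>t\<close> is a sum of
  averages of the first derivatives. The exponent \<open>a\<close> avoids the integers so that no logarithm
  appears on integration.\<close>

lemma avg_sob_bound:
  fixes Q S :: "(real ^ 'n) set"
  assumes p: "1 \<le> p" and Q: "Q \<in> sets lebesgue"
    and S: "\<And>x t z. x \<in> S \<Longrightarrow> 0 < t \<Longrightarrow> t \<le> 1 \<Longrightarrow> z \<in> cball w r \<Longrightarrow> x + t *\<^sub>R z \<in> Q"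
    and a: "real CARD('n) / p \<le> a" "\<And>j::nat. a \<noteq> real j"
    and \<psi>: "bump w r \<psi>"
  shows "\<exists>C\<ge>0. \<forall>v :: real ^ 'n \<Rightarrow> 'b::euclidean_space. sob_bdd Q p A l v \<longrightarrow>
     (\<forall>x\<in>S. \<forall>t. 0 < t \<longrightarrow> t \<le> 1 \<longrightarrow> norm (avg Q \<psi> t x v) \<le> C * t powr - max (a - real l) 0)"
  using \<psi>
proof (induction l arbitrary: \<psi>)
  case 0
  obtain C where C: "0 \<le> C" "\<And>(v :: real ^ 'n \<Rightarrow> 'b) x t. lp_bdd Q p A v \<Longrightarrow> 0 < t \<Longrightarrow>
      norm (avg Q \<psi> t x v) \<le> C * t powr - (real CARD('n) / p)"
    using avg_lp_bound[OF 0 p Q, of A] by blast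
  have "C * t powr - (real CARD('n) / p) \<le> C * t powr - max a 0" if "0 < t" "t \<le> 1" for t
    using that C(1) a(1) by (intro mult_left_mono powr_mono') auto
  then show ?case
    using C by (intro exI[of _ C]) (fastforce intro: order_trans)
next
  case (Suc l)
  \<comment> \<open>The growth exponent that the induction hypothesis gives for the first
    derivatives; \<open>b = 1\<close> would mean that \<open>a\<close> is the integer
    \<open>Suc l\<close>.\<close>
  define b where "b = max (a - real l) 0"
  have b: "0 \<le> b" "b \<noteq> 1" using a(2)[of "Suc l"] by (auto simp: b_def max_def)
  have b': "max (a - real (Suc l)) 0 = max (b - 1) 0" by (auto simp: b_def max_def)
  \<comment> \<open>The bound at scale 1, from which \<open>F\<close> is integrated down to scale
    \<open>t\<close>.\<close>
  obtain C0 where C0: "0 \<le> C0" "\<And>(v :: real ^ 'n \<Rightarrow> 'b) x. lp_bdd Q p A v \<Longrightarrow>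
      norm (avg Q \<psi> 1 x v) \<le> C0"
    using avg_lp_bound[OF Suc.prems p Q, of A] by (metis mult.right_neutral powr_one_eq_one zero_less_one)
  have "\<forall>i. \<exists>C\<ge>0. \<forall>v :: real ^ 'n \<Rightarrow> 'b. sob_bdd Q p A l v \<longrightarrow>
     (\<forall>x\<in>S. \<forall>t. 0 < t \<longrightarrow> t \<le> 1 \<longrightarrow> norm (avg Q (\<lambda>z. z $ i * \<psi> z) t x v) \<le> C * t powr - b)"
    using Suc.IH[OF bump_coord[OF Suc.prems]] unfolding b_def by blast
  from choice[OF this] obtain C where C: "\<And>i. 0 \<le> C i"
    "\<And>i (v :: real ^ 'n \<Rightarrow> 'b) x t. sob_bdd Q p A l v \<Longrightarrow> x \<in> S \<Longrightarrow> 0 < t \<Longrightarrow> t \<le> 1 \<Longrightarrow>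
      norm (avg Q (\<lambda>z. z $ i * \<psi> z) t x v) \<le> C i * t powr - b"
    by blast
  define B where "B = (\<Sum>i\<in>UNIV. C i)"
  have B: "0 \<le> B" unfolding B_def by (rule sum_nonneg) (rule C)
  have "norm (avg Q \<psi> t x v) \<le> (C0 + B / \<bar>1 - b\<bar>) * t powr - max (b - 1) 0"
    if v: "sob_bdd Q p A (Suc l) v" and x: "x \<in> S" and t: "0 < t" "t \<le> 1"
    for v :: "real ^ 'n \<Rightarrow> 'b" and x t
  proof -
    \<comment> \<open>The target growth. It is at least 1 for \<open>t \<le> 1\<close>, so constants
      can be absorbed into it.\<close>
    define e where "e = t powr - max (b - 1) 0"
    have e1: "1 \<le> e" using t powr_mono'[of "- max (b - 1) 0" 0 t] by (simp add: e_def)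
    have v0: "lp_bdd Q p A v" using v by simp
    obtain g where g: "\<And>i. weak_deriv Q [i] v (g i)" "\<And>i. sob_bdd Q p A l (g i)"
      using v by auto
    define F where "F t = avg Q \<psi> t x v" for t
    define F' where "F' t = (\<Sum>i\<in>UNIV. avg Q (\<lambda>z. z $ i * \<psi> z) t x (g i))" for t
    \<comment> \<open>A primitive of the bound \<open>B * s powr - b\<close> on the derivative,
      available because \<open>b \<noteq> 1\<close>.\<close>
    define \<phi> where "\<phi> s = B / (1 - b) * s powr (1 - b)" for s
    have dF: "(F has_vector_derivative F' s) (at s)" if "0 < s" "s \<le> 1" for s
      unfolding F_def[abs_def] F'_def
      by (rule avg_has_vector_derivative[OF Suc.prems _ that(1) S[OF x that] g(1)])
         (use v0 in \<open>auto simp: lp_bdd_def\<close>)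
    have d\<phi>: "(\<phi> has_real_derivative B * s powr - b) (at s)" if "0 < s" for s
      unfolding \<phi>_def[abs_def] using that b by (auto intro!: derivative_eq_intros)
    have "norm (F 1 - F t) \<le> B / \<bar>1 - b\<bar> * e"
    proof (cases "t = 1")
      case True
      then show ?thesis using B e1 by simp
    next
      case False
      then have "t < 1" using t by simp
      have "norm (F 1 - F t) \<le> \<phi> 1 - \<phi> t"
      proof (rule differentiable_bound_general[OF \<open>t < 1\<close>])
        show "continuous_on {t..1} F"
          using t by (intro continuous_at_imp_continuous_on ballI has_vector_derivative_continuous[OF dF]) auto
        show "continuous_on {t..1} \<phi>"
          using t by (intro continuous_at_imp_continuous_on ballI DERIV_isCont[OF d\<phi>]) auto
        fix s assume s: "t < s" "s < 1"
        show "(F has_vector_derivative F' s) (at s)" using s t by (intro dF) auto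
        show "(\<phi> has_vector_derivative B * s powr - b) (at s)"
          using d\<phi>[of s] s t by (simp add: has_real_derivative_iff_has_vector_derivative)
        have "norm (F' s) \<le> (\<Sum>i\<in>UNIV. C i * s powr - b)"
          unfolding F'_def using s t by (intro sum_norm_le C(2) g x) auto
        then show "norm (F' s) \<le> B * s powr - b" by (simp add: B_def sum_distrib_right)
      qed
      also have "\<dots> = B / (1 - b) * (1 - t powr (1 - b))" by (simp add: \<phi>_def algebra_simps)
      also have "\<dots> \<le> B / \<bar>1 - b\<bar> * e"
      proof (cases "b < 1")
        case True
        have "1 - t powr (1 - b) \<le> e" using e1 powr_ge_zero[of t "1 - b"] by linarith
        then have "B / (1 - b) * (1 - t powr (1 - b)) \<le> B / (1 - b) * e"
          using B True by (intro mult_left_mono) auto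
        then show ?thesis using True by simp
      next
        case False
        then have "1 < b" using b by simp
        then have "B / (1 - b) * (1 - t powr (1 - b)) = B / (b - 1) * (t powr (1 - b) - 1)"
          by (simp add: field_simps)
        also have "\<dots> \<le> B / (b - 1) * t powr (1 - b)"
          using B \<open>1 < b\<close> by (intro mult_left_mono) auto
        finally show ?thesis using \<open>1 < b\<close> by (simp add: e_def)
      qed
      finally show ?thesis .
    qed
    moreover have "norm (F 1) \<le> C0 * e"
      using C0(2)[OF v0, of x] mult_left_mono[OF e1 C0(1)] by (simp add: F_def)
    ultimately have "norm (F t) \<le> C0 * e + B / \<bar>1 - b\<bar> * e"
      using norm_triangle_ineq4[of "F 1" "F 1 - F t"] by simp
    then show ?thesis by (simp add: F_def e_def distrib_right)
  qed
  moreover have "0 \<le> C0 + B / \<bar>1 - b\<bar>" using C0 B by simp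
  ultimately show ?case unfolding b' by blast
qed

text \<open>With \<open>m\<close> derivatives above \<open>n / p\<close> the growth exponent has
  dropped to 0, so the averages are bounded down to scale 0 and \<open>kern_average_bound\<close>
  passes the bound to \<open>v\<close>.\<close>

lemma sob_bdd_local:
  fixes Q S :: "(real ^ 'n) set"
  assumes p: "1 \<le> p" and m: "real CARD('n) / p < real m" and Q: "Q \<in> sets lebesgue"
    and S: "\<And>x t z. x \<in> S \<Longrightarrow> 0 < t \<Longrightarrow> t \<le> 1 \<Longrightarrow> z \<in> cball w r \<Longrightarrow> x + t *\<^sub>R z \<in> Q"
    and "0 < r" and Sm: "S \<in> lmeasurable" "S \<subseteq> Q"
  shows "\<exists>C. \<forall>v :: real ^ 'n \<Rightarrow> 'b::euclidean_space. sob_bdd Q p A m v \<longrightarrow>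
     (AE x in lebesgue. x \<in> S \<longrightarrow> norm (v x) \<le> C)"
proof -
  obtain \<psi> where \<psi>: "smooth \<psi>" "\<And>z. z \<notin> cball w r \<Longrightarrow> \<psi> z = 0" "\<And>z. 0 \<le> \<psi> z"
    "integral\<^sup>L lborel \<psi> = 1"
    using smooth_bump_exists[OF \<open>0 < r\<close>] by blast
  have "0 \<le> real CARD('n) / p" using p by simp
  then have "0 < m" using m by (simp del: zero_le_divide_iff)
  \<comment> \<open>The midpoint of \<open>max (n / p) (m - 1)\<close> and \<open>m\<close>: at
    least \<open>n / p\<close>, and strictly between consecutive integers.\<close>
  define a where "a = (max (real CARD('n) / p) (real m - 1) + real m) / 2"
  have "c \<le> (max c d + e) / 2 \<and> (max c d + e) / 2 < e \<and> d < (max c d + e) / 2"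
    if "c < e" "d < e" for c d e :: real
    using that by (auto simp: max_def)
  from this[OF m, of "real m - 1"]
  have a: "real CARD('n) / p \<le> a" "a < real m" "real m - 1 < a"
    unfolding a_def by auto
  have a': "a \<noteq> real j" for j :: nat
  proof
    assume "a = real j"
    then have "j < m" "m - 1 < j" using a(2,3) \<open>0 < m\<close> by (auto simp: of_nat_diff)
    then show False by simp
  qed
  obtain C where C: "0 \<le> C" "\<And>(v :: real ^ 'n \<Rightarrow> 'b) x t. sob_bdd Q p A m v \<Longrightarrow> x \<in> S \<Longrightarrow> 0 < t \<Longrightarrow> t \<le> 1 \<Longrightarrow>
      norm (avg Q \<psi> t x v) \<le> C * t powr - max (a - real m) 0"
  proof -
    have "bump w r \<psi>" using \<psi> by (simp add: bump_def)
    then have "\<exists>C\<ge>0. \<forall>v :: real ^ 'n \<Rightarrow> 'b. sob_bdd Q p A m v \<longrightarrow> (\<forall>x\<in>S. \<forall>t. 0 < t \<longrightarrow> t \<le> 1 \<longrightarrow>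
        norm (avg Q \<psi> t x v) \<le> C * t powr - max (a - real m) 0)"
      by (intro avg_sob_bound[where w = w and r = r] p Q a(1) a') (rule S)
    then show thesis using that by auto
  qed
  have "AE x in lebesgue. x \<in> S \<longrightarrow> norm (v x) \<le> C" if v: "sob_bdd Q p A m v" for v :: "real ^ 'n \<Rightarrow> 'b"
  proof -
    have "integrable (lebesgue_on Q) v"
      using sob_bdd_imp_lp_bdd[OF v] by (simp add: lp_bdd_def)
    \<comment> \<open>Extension by zero puts \<open>v\<close> on the whole space without affecting
      the averages, which are integrals over \<open>Q\<close>.\<close>
    then have u: "integrable lebesgue (\<lambda>x. indicator Q x *\<^sub>R v x)"
      using Q by (subst (asm) integrable_restrict_space) auto
    have "AE x in lebesgue. x \<in> S \<longrightarrow> norm (indicator Q x *\<^sub>R v x) \<le> C"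
    proof (rule kern_average_bound[where A = "cball w r" and \<psi> = \<psi>, OF u _ compact_cball _ _ \<psi>(4) Sm(1) zero_less_one])
      fix x t assume x: "x \<in> S" and t: "0 < t" "t \<le> (1::real)"
      have "(LINT y|lebesgue. kern \<psi> t x y *\<^sub>R indicat_real Q y *\<^sub>R v y) = avg Q \<psi> t x v"
        unfolding avg_def using Q by (subst integral_restrict_space) (auto simp: mult.commute)
      moreover have "norm (avg Q \<psi> t x v) \<le> C"
        using C(2)[OF v x t] a t by simp
      ultimately show "norm (LINT y|lebesgue. kern \<psi> t x y *\<^sub>R indicat_real Q y *\<^sub>R v y) \<le> C"
        by simp
    qed (use \<psi> smooth_continuous in auto)
    then show ?thesis
      by eventually_elim (use Sm in \<open>auto simp: indicator_def\<close>)
  qed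
  then show ?thesis by blast
qed

text \<open>One cone serves every point of \<open>Q\<close> near \<open>x\<close>: moving along
  directions close to the vertical, a point gains height faster than the Lipschitz graph can rise
  below it.\<close>

lemma lipschitz_domain_cone:
  fixes Q :: "(real ^ 'n) set"
  assumes Q: "bounded_lipschitz_domain Q" and "x \<in> closure Q"
  shows "\<exists>B w r. open B \<and> x \<in> B \<and> 0 < r \<and>
     (\<forall>y\<in>B \<inter> Q. \<forall>t z. 0 < t \<longrightarrow> t \<le> 1 \<longrightarrow> z \<in> cball w r \<longrightarrow> y + t *\<^sub>R z \<in> Q)"
proof (cases "x \<in> Q")
  case True
  then obtain \<rho> where \<rho>: "0 < \<rho>" "ball x \<rho> \<subseteq> Q"
    using Q unfolding bounded_lipschitz_domain_def by (meson open_contains_ball)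
  have "y + t *\<^sub>R z \<in> Q" if "y \<in> ball x (\<rho> / 2)" "0 < t" "t \<le> 1" "z \<in> cball 0 (\<rho> / 2)" for y t z
  proof -
    have "norm (t *\<^sub>R z) \<le> 1 * (\<rho> / 2)"
      unfolding norm_scaleR using that by (intro mult_mono) auto
    then have "dist x (y + t *\<^sub>R z) < \<rho>"
      using that(1) norm_triangle_ineq4[of "x - y" "t *\<^sub>R z"] by (simp add: dist_norm algebra_simps)
    then show ?thesis using \<rho> by auto
  qed
  then show ?thesis
    using \<rho> by (intro exI[of _ "ball x (\<rho> / 2)"] exI[of _ 0] exI[of _ "\<rho> / 2"]) auto
next
  case False
  then have "x \<in> frontier Q"
    using assms by (simp add: frontier_def bounded_lipschitz_domain_def interior_open)
  then obtain \<rho> \<nu> g L where \<rho>: "0 < \<rho>" and \<nu>: "norm \<nu> = 1" and g: "L-lipschitz_on {z. z \<bullet> \<nu> = 0} g"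
    and Qg: "Q \<inter> ball x \<rho> = {y \<in> ball x \<rho>. g (y - (y \<bullet> \<nu>) *\<^sub>R \<nu>) < y \<bullet> \<nu>}"
    using Q unfolding bounded_lipschitz_domain_def by blast
  have L: "0 \<le> L" using g by (rule lipschitz_on_nonneg)
  have \<nu>\<nu>: "\<nu> \<bullet> \<nu> = 1" using \<nu> by (simp add: norm_eq_1)
  \<comment> \<open>A point within \<open>\<rho> / 2\<close> of \<open>x\<close> moves by at most
    \<open>s + r \<le> 2 * s = \<rho> / 2\<close> and stays in the chart.\<close>
  define s where "s = \<rho> / 4"
  \<comment> \<open>Chosen so that \<open>s - r = 2 * L * r + r\<close>: per unit of
    \<open>t\<close> the height gains at least \<open>s - r\<close>, the graph at most
    \<open>2 * L * r\<close>.\<close>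
  define r where "r = s / (2 * L + 2)"
  have s: "0 < s" using \<rho> by (simp add: s_def)
  have r: "0 < r" using s L by (simp add: r_def)
  have rL: "2 * L * r + 2 * r = s"
  proof -
    have "2 * L * r + 2 * r = r * (2 * L + 2)" by (simp add: algebra_simps)
    also have "\<dots> = s" using L by (simp add: r_def add_nonneg_eq_0_iff)
    finally show ?thesis .
  qed
  then have rs: "r \<le> s" using L r by (smt (verit) mult_nonneg_nonneg)
  define P where "P y = y - (y \<bullet> \<nu>) *\<^sub>R \<nu>" for y
  have Pin: "P y \<in> {z. z \<bullet> \<nu> = 0}" for y
    by (simp add: P_def inner_diff_left \<nu>\<nu>)
  have "y + t *\<^sub>R z \<in> Q" if y: "y \<in> ball x (\<rho> / 2)" "y \<in> Q" and t: "0 < t" "t \<le> 1" and z: "z \<in> cball (s *\<^sub>R \<nu>) r"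
    for y t z
  proof -
    define d where "d = z - s *\<^sub>R \<nu>"
    have d: "norm d \<le> r" using z by (simp add: d_def dist_norm norm_minus_commute)
    have zd: "z = s *\<^sub>R \<nu> + d" by (simp add: d_def)
    have d\<nu>: "\<bar>d \<bullet> \<nu>\<bar> \<le> r"
      using Cauchy_Schwarz_ineq2[of d \<nu>] d \<nu> by simp
    have nz: "norm z \<le> s + r"
      unfolding zd using norm_triangle_ineq[of "s *\<^sub>R \<nu>" d] d \<nu> s by simp
    have "norm (t *\<^sub>R z) \<le> 1 * (s + r)"
      unfolding norm_scaleR using t nz by (intro mult_mono) auto
    then have "dist x (y + t *\<^sub>R z) < \<rho>"
      using y(1) norm_triangle_ineq4[of "x - y" "t *\<^sub>R z"] rs by (simp add: dist_norm algebra_simps s_def)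
    then have in_ball: "y + t *\<^sub>R z \<in> ball x \<rho>" by simp
    have "y \<in> Q \<inter> ball x \<rho>" using y \<rho> by auto
    then have gy: "g (P y) < y \<bullet> \<nu>" using Qg by (auto simp: P_def)
    \<comment> \<open>The vertical part \<open>s *\<^sub>R \<nu>\<close> drops out; only the
      deviation \<open>d\<close> moves the foot point on the graph.\<close>
    have Pz: "P (y + t *\<^sub>R z) - P y = t *\<^sub>R (d - (d \<bullet> \<nu>) *\<^sub>R \<nu>)"
      by (simp add: P_def zd inner_add_left \<nu>\<nu> algebra_simps)
    have "norm (d - (d \<bullet> \<nu>) *\<^sub>R \<nu>) \<le> 2 * r"
      using norm_triangle_ineq4[of d "(d \<bullet> \<nu>) *\<^sub>R \<nu>"] d d\<nu> \<nu> by simp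
    then have "dist (P (y + t *\<^sub>R z)) (P y) \<le> t * (2 * r)"
      using t by (simp add: dist_norm Pz)
    then have "L * dist (P (y + t *\<^sub>R z)) (P y) \<le> L * (t * (2 * r))"
      using L by (rule mult_left_mono)
    moreover have "dist (g (P (y + t *\<^sub>R z))) (g (P y)) \<le> L * dist (P (y + t *\<^sub>R z)) (P y)"
      using lipschitz_onD[OF g Pin Pin] .
    ultimately have "g (P (y + t *\<^sub>R z)) \<le> g (P y) + t * (2 * L * r)"
      by (simp add: dist_real_def algebra_simps)
    moreover have "(y + t *\<^sub>R z) \<bullet> \<nu> \<ge> y \<bullet> \<nu> + t * (s - r)"
    proof -
      have "s - r \<le> z \<bullet> \<nu>" using d\<nu> by (simp add: zd inner_add_left \<nu>\<nu>)
      then show ?thesis using t by (simp add: inner_add_left)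
    qed
    moreover have "t * (2 * L * r) \<le> t * (s - r)"
      using t rL r by (intro mult_left_mono) auto
    ultimately have "g (P (y + t *\<^sub>R z)) < (y + t *\<^sub>R z) \<bullet> \<nu>"
      using gy by linarith
    then have "y + t *\<^sub>R z \<in> Q \<inter> ball x \<rho>"
      unfolding Qg using in_ball by (simp add: P_def)
    then show ?thesis by simp
  qed
  then show ?thesis
    using \<rho> r by (intro exI[of _ "ball x (\<rho> / 2)"] exI[of _ "s *\<^sub>R \<nu>"] exI[of _ r]) auto
qed

text \<open>Compactness of \<open>closure Q\<close> reduces the claim to
  \<open>sob_bdd_local\<close> on finitely many pieces. The local constants are chosen before
  \<open>v\<close>, which makes the bound uniform.\<close>

theorem sob_bdd_imp_bounded:
  fixes Q :: "(real ^ 'n) set"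
  assumes Q: "bounded_lipschitz_domain Q" and p: "1 \<le> p" and m: "real CARD('n) / p < real m"
  shows "\<exists>C. \<forall>v :: real ^ 'n \<Rightarrow> 'b::euclidean_space. sob_bdd Q p A m v \<longrightarrow>
     (AE x in lebesgue. x \<in> Q \<longrightarrow> norm (v x) \<le> C)"
proof -
  have oQ: "open Q" "bounded Q" using Q by (auto simp: bounded_lipschitz_domain_def)
  have Qm: "Q \<in> sets lebesgue" using oQ by (simp add: lmeasurable_open fmeasurableD)
  have "\<forall>x\<in>closure Q. \<exists>B C. open B \<and> x \<in> B \<and> (\<forall>v :: real ^ 'n \<Rightarrow> 'b. sob_bdd Q p A m v \<longrightarrow>
     (AE y in lebesgue. y \<in> B \<inter> Q \<longrightarrow> norm (v y) \<le> C))"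
  proof
    fix x assume "x \<in> closure Q"
    from lipschitz_domain_cone[OF Q this] obtain B w r where B: "open B" "x \<in> B" "0 < r"
      "\<And>y t z. y \<in> B \<inter> Q \<Longrightarrow> 0 < t \<Longrightarrow> t \<le> 1 \<Longrightarrow> z \<in> cball w r \<Longrightarrow> y + t *\<^sub>R z \<in> Q"
      by blast
    have "B \<inter> Q \<in> lmeasurable"
      using B(1) oQ by (intro lmeasurable_open) (auto intro: bounded_subset)
    then obtain C where "\<forall>v :: real ^ 'n \<Rightarrow> 'b. sob_bdd Q p A m v \<longrightarrow>
       (AE y in lebesgue. y \<in> B \<inter> Q \<longrightarrow> norm (v y) \<le> C)"
      using sob_bdd_local[where w = w and r = r and S = "B \<inter> Q" and A = A and 'b = 'b, OF p m Qm _ B(3)] B(4)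
      by auto
    with B(1,2) show "\<exists>B C. open B \<and> x \<in> B \<and> (\<forall>v :: real ^ 'n \<Rightarrow> 'b. sob_bdd Q p A m v \<longrightarrow>
       (AE y in lebesgue. y \<in> B \<inter> Q \<longrightarrow> norm (v y) \<le> C))"
      by (intro exI[of _ B] exI[of _ C] conjI)
  qed
  from bchoice[OF this] obtain B where "\<forall>x\<in>closure Q. \<exists>C. open (B x) \<and> x \<in> B x \<and>
     (\<forall>v :: real ^ 'n \<Rightarrow> 'b. sob_bdd Q p A m v \<longrightarrow>
     (AE y in lebesgue. y \<in> B x \<inter> Q \<longrightarrow> norm (v y) \<le> C))" ..
  from bchoice[OF this] obtain C where BC: "\<forall>x\<in>closure Q. open (B x) \<and> x \<in> B x \<and>
     (\<forall>v :: real ^ 'n \<Rightarrow> 'b. sob_bdd Q p A m v \<longrightarrow>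
     (AE y in lebesgue. y \<in> B x \<inter> Q \<longrightarrow> norm (v y) \<le> C x))" ..
  have "compact (closure Q)" using oQ by (simp add: compact_closure)
  then obtain D where D: "D \<subseteq> closure Q" "finite D" "closure Q \<subseteq> (\<Union>x\<in>D. B x)"
    by (rule compactE_image[of "closure Q" "closure Q" B]) (use BC in blast)+
  \<comment> \<open>The sum of absolute values stands in for the maximum of the local
    constants.\<close>
  have "AE y in lebesgue. y \<in> Q \<longrightarrow> norm (v y) \<le> (\<Sum>x\<in>D. \<bar>C x\<bar>)" if "sob_bdd Q p A m v"
    for v :: "real ^ 'n \<Rightarrow> 'b"
  proof -
    have "AE y in lebesgue. \<forall>x\<in>D. y \<in> B x \<inter> Q \<longrightarrow> norm (v y) \<le> C x"
      using D(1) BC that by (intro AE_finite_allI[OF D(2)]) blast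
    then show ?thesis
    proof eventually_elim
      case (elim y)
      show ?case
      proof
        assume "y \<in> Q"
        then obtain x where "x \<in> D" "y \<in> B x" using D(3) closure_subset by blast
        then have "norm (v y) \<le> \<bar>C x\<bar>" using elim \<open>y \<in> Q\<close> by force
        also have "\<dots> \<le> (\<Sum>x\<in>D. \<bar>C x\<bar>)"
          using \<open>x \<in> D\<close> D(2) by (intro member_le_sum) auto
        finally show "norm (v y) \<le> (\<Sum>x\<in>D. \<bar>C x\<bar>)" .
      qed
    qed
  qed
  then show ?thesis by blast
qed

section \<open>Uniqueness of weak derivatives\<close>

text \<open>Only local integrability is at hand, so the product is dominated on the compact support
  of \<open>\<phi>\<close> and extended by zero.\<close>

lemma test_function_integrable:
  fixes u :: "real ^ 'n \<Rightarrow> 'b::euclidean_space"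
  assumes \<phi>: "\<phi> \<in> test_functions Q" and u: "locally_integrable Q u" and Q: "Q \<in> sets lebesgue"
  shows "integrable (lebesgue_on Q) (\<lambda>x. \<phi> x *\<^sub>R u x)"
proof -
  define K where "K = closure {x. \<phi> x \<noteq> 0}"
  have K: "compact K" "K \<subseteq> Q" "smooth \<phi>" and K0: "\<And>x. x \<notin> K \<Longrightarrow> \<phi> x = 0"
    using \<phi> closure_subset[of "{x. \<phi> x \<noteq> 0}"] by (auto simp: test_functions_iff K_def)
  obtain M where M: "0 < M" "\<And>x. norm (\<phi> x) \<le> M"
    using bounded_compact_support[OF smooth_continuous[OF K(3)] K(1)] K0 by blast
  have ui: "integrable lebesgue (\<lambda>x. indicat_real K x *\<^sub>R u x)"
    using u K by (simp add: locally_integrable_def set_integrable_def)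
  have \<phi>m: "\<phi> \<in> borel_measurable lebesgue"
    using borel_measurable_continuous_onI[OF smooth_continuous[OF K(3)]]
    by (intro measurable_completion) simp
  have "integrable lebesgue (\<lambda>x. \<phi> x *\<^sub>R (indicat_real K x *\<^sub>R u x))"
  proof (rule Bochner_Integration.integrable_bound[OF integrable_scaleR_right[OF ui, of M]])
    show "(\<lambda>x. \<phi> x *\<^sub>R (indicat_real K x *\<^sub>R u x)) \<in> borel_measurable lebesgue"
      by (intro borel_measurable_scaleR \<phi>m borel_measurable_integrable[OF ui])
    show "AE x in lebesgue. norm (\<phi> x *\<^sub>R indicat_real K x *\<^sub>R u x) \<le> norm (M *\<^sub>R indicat_real K x *\<^sub>R u x)"
    proof (intro AE_I2)
      fix x
      have "\<bar>\<phi> x\<bar> * norm (indicat_real K x *\<^sub>R u x) \<le> M * norm (indicat_real K x *\<^sub>R u x)"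
        using M by (intro mult_right_mono) auto
      then show "norm (\<phi> x *\<^sub>R indicat_real K x *\<^sub>R u x) \<le> norm (M *\<^sub>R indicat_real K x *\<^sub>R u x)"
        using M(1) by (simp add: mult.assoc abs_mult)
    qed
  qed
  moreover have eq: "\<phi> x *\<^sub>R (indicat_real K x *\<^sub>R u x) = indicat_real Q x *\<^sub>R (\<phi> x *\<^sub>R u x)" for x
    using K0[of x] K(2) by (auto simp: indicator_def)
  ultimately have "integrable lebesgue (\<lambda>x. indicat_real Q x *\<^sub>R (\<phi> x *\<^sub>R u x))"
    by (simp only: eq)
  then show ?thesis
    using Q by (subst integrable_restrict_space) auto
qed

lemma AE_lebesgue_imp_negligible:
  assumes "AE x in lebesgue. P x"
  shows "negligible {x. \<not> P x}"
proof -
  obtain N where "{x \<in> space lebesgue. \<not> P x} \<subseteq> N" "emeasure lebesgue N = 0" "N \<in> sets lebesgue"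
    using AE_E[OF assms] by blast
  then have "negligible N" by (simp add: negligible_iff_null_sets null_sets_def)
  then show ?thesis
    by (rule negligible_subset) (use \<open>{x \<in> space lebesgue. \<not> P x} \<subseteq> N\<close> in auto)
qed

text \<open>The fundamental lemma of the calculus of variations. Small kernels around interior
  points are test functions, so all averages vanish, and \<open>kern_average_bound\<close> applies
  with \<open>C = 0\<close>.\<close>

lemma weakly_zero_imp_AE_zero:
  fixes u :: "real ^ 'n \<Rightarrow> 'b::euclidean_space"
  assumes Q: "open Q" and u: "locally_integrable Q u"
    and zero: "\<And>\<phi>. \<phi> \<in> test_functions Q \<Longrightarrow> (LINT x|lebesgue_on Q. \<phi> x *\<^sub>R u x) = 0"
  shows "AE x in lebesgue_on Q. u x = 0"
proof -
  have Qm: "Q \<in> sets lebesgue" using Q by (auto intro!: sets_completionI_sets)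
  obtain \<psi> :: "real ^ 'n \<Rightarrow> real" where \<psi>: "smooth \<psi>" "\<And>z. z \<notin> cball 0 1 \<Longrightarrow> \<psi> z = 0" "\<And>z. 0 \<le> \<psi> z"
    "integral\<^sup>L lborel \<psi> = 1"
    using smooth_bump_exists[of 1 0] by auto
  have b\<psi>: "bump 0 1 \<psi>" using \<psi> by (simp add: bump_def)
  have loc: "\<exists>\<rho>>0. negligible {x \<in> ball x0 \<rho>. u x \<noteq> 0}" if "x0 \<in> Q" for x0
  proof -
    obtain \<epsilon> where \<epsilon>: "0 < \<epsilon>" "cball x0 \<epsilon> \<subseteq> Q"
      using Q \<open>x0 \<in> Q\<close> open_contains_cball by blast
    \<comment> \<open>Half the radius, so that kernels of scale up to \<open>\<rho>\<close> centred
      in \<open>ball x0 \<rho>\<close> are supported in \<open>K\<close>.\<close>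
    define \<rho> where "\<rho> = \<epsilon> / 2"
    define K where "K = cball x0 \<epsilon>"
    have \<rho>: "0 < \<rho>" using \<epsilon> by (simp add: \<rho>_def)
    have ui: "integrable lebesgue (\<lambda>x. indicat_real K x *\<^sub>R u x)"
      using u \<epsilon> by (simp add: locally_integrable_def set_integrable_def K_def)
    have "AE x in lebesgue. x \<in> ball x0 \<rho> \<longrightarrow> norm (indicat_real K x *\<^sub>R u x) \<le> 0"
    proof (rule kern_average_bound[where A = "cball 0 1" and \<psi> = \<psi>, OF ui _ compact_cball _ _ \<psi>(4) _ \<rho>])
      show "ball x0 \<rho> \<in> lmeasurable" by simp
      fix x t assume x: "x \<in> ball x0 \<rho>" and t: "0 < t" "t \<le> \<rho>"
      have sub: "x + t *\<^sub>R z \<in> K" if "z \<in> cball 0 1" for z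
      proof -
        have "norm (t *\<^sub>R z) \<le> \<rho> * 1"
          unfolding norm_scaleR using that t by (intro mult_mono) auto
        then show ?thesis
          using x norm_triangle_ineq4[of "x0 - x" "t *\<^sub>R z"] by (simp add: K_def \<rho>_def dist_norm algebra_simps)
      qed
      have "kern \<psi> t x \<in> test_functions Q"
        using sub \<epsilon>(2) t by (intro kern_test_function[OF b\<psi>]) (auto simp: K_def)
      then have "(LINT y|lebesgue_on Q. kern \<psi> t x y *\<^sub>R u y) = 0" by (rule zero)
      moreover have "(LINT y|lebesgue_on Q. kern \<psi> t x y *\<^sub>R u y) =
          (LINT y|lebesgue. kern \<psi> t x y *\<^sub>R indicat_real K y *\<^sub>R u y)"
      proof -
        have "indicat_real Q y *\<^sub>R (kern \<psi> t x y *\<^sub>R u y) = kern \<psi> t x y *\<^sub>R indicat_real K y *\<^sub>R u y" for y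
        proof (cases "(1 / t) *\<^sub>R (y - x) \<in> cball 0 1")
          case True
          have "y = x + t *\<^sub>R ((1 / t) *\<^sub>R (y - x))" using t by simp
          then have "y \<in> K" using sub[OF True] by simp
          then show ?thesis using \<epsilon>(2) by (auto simp: K_def indicator_def)
        next
          case False
          then show ?thesis using \<psi>(2) by (simp add: kern_def)
        qed
        note eq = this
        show ?thesis
          by (subst integral_restrict_space) (use Qm in simp, simp only: eq)
      qed
      ultimately show "norm (LINT y|lebesgue. kern \<psi> t x y *\<^sub>R indicat_real K y *\<^sub>R u y) \<le> 0" by simp
    qed (use \<psi> smooth_continuous in auto)
    then have "negligible {x. \<not> (x \<in> ball x0 \<rho> \<longrightarrow> norm (indicat_real K x *\<^sub>R u x) \<le> 0)}"
      by (rule AE_lebesgue_imp_negligible)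
    then have "negligible {x \<in> ball x0 \<rho>. u x \<noteq> 0}"
      by (rule negligible_subset) (use \<rho> in \<open>auto simp: K_def \<rho>_def indicator_def\<close>)
    then show ?thesis using \<rho> by blast
  qed
  \<comment> \<open>A set that is negligible near each of its points is negligible.\<close>
  have "negligible {x \<in> Q. u x \<noteq> 0}"
    unfolding locally_negligible_alt[of "{x \<in> Q. u x \<noteq> 0}"]
  proof
    fix x0 assume x0: "x0 \<in> {x \<in> Q. u x \<noteq> 0}"
    then obtain \<rho> where \<rho>: "0 < \<rho>" "negligible {x \<in> ball x0 \<rho>. u x \<noteq> 0}" using loc by blast
    show "\<exists>U. openin (top_of_set {x \<in> Q. u x \<noteq> 0}) U \<and> x0 \<in> U \<and> negligible U"
    proof (intro exI conjI)
      show "openin (top_of_set {x \<in> Q. u x \<noteq> 0}) ({x \<in> Q. u x \<noteq> 0} \<inter> ball x0 \<rho>)"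
        by (intro openin_open_Int open_ball)
      show "negligible ({x \<in> Q. u x \<noteq> 0} \<inter> ball x0 \<rho>)"
        by (rule negligible_subset[OF \<rho>(2)]) auto
    qed (use x0 \<rho> in auto)
  qed
  then have "AE x in lebesgue. x \<notin> {x \<in> Q. u x \<noteq> 0}"
    by (intro AE_not_in) (simp add: negligible_iff_null_sets)
  then show ?thesis
    using Qm by (subst AE_restrict_space_iff) (auto elim: eventually_mono)
qed

lemma locally_integrable_diff:
  "locally_integrable Q u \<Longrightarrow> locally_integrable Q v \<Longrightarrow> locally_integrable Q (\<lambda>x. u x - v x)"
  unfolding locally_integrable_def by (auto intro: set_integral_diff)

text \<open>Makes the arbitrary choice in \<open>wderiv\<close> harmless: it agrees almost
  everywhere with any weak derivative known explicitly.\<close>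

lemma weak_deriv_unique:
  fixes u :: "real ^ 'n \<Rightarrow> 'b::euclidean_space"
  assumes Q: "open Q" and g: "weak_deriv Q js u g" and h: "weak_deriv Q js u h"
  shows "AE x in lebesgue_on Q. g x = h x"
proof -
  have Qm: "Q \<in> sets lebesgue" using Q by (auto intro!: sets_completionI_sets)
  have li: "locally_integrable Q g" "locally_integrable Q h"
    using g h by (auto simp: weak_deriv_def)
  have "AE x in lebesgue_on Q. g x - h x = 0"
  proof (rule weakly_zero_imp_AE_zero[OF Q locally_integrable_diff[OF li]])
    fix \<phi> assume \<phi>: "\<phi> \<in> test_functions Q"
    have "((-1) ^ length js :: real) *\<^sub>R (LINT x|lebesgue_on Q. \<phi> x *\<^sub>R g x) =
        ((-1) ^ length js :: real) *\<^sub>R (LINT x|lebesgue_on Q. \<phi> x *\<^sub>R h x)"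
    proof (rule trans[OF sym])
      show "(LINT x|lebesgue_on Q. partials js \<phi> x *\<^sub>R u x) =
          ((-1) ^ length js :: real) *\<^sub>R (LINT x|lebesgue_on Q. \<phi> x *\<^sub>R g x)"
        using g \<phi> by (simp add: weak_deriv_def)
      show "(LINT x|lebesgue_on Q. partials js \<phi> x *\<^sub>R u x) =
          ((-1) ^ length js :: real) *\<^sub>R (LINT x|lebesgue_on Q. \<phi> x *\<^sub>R h x)"
        using h \<phi> by (simp add: weak_deriv_def)
    qed
    then have "(LINT x|lebesgue_on Q. \<phi> x *\<^sub>R g x) = (LINT x|lebesgue_on Q. \<phi> x *\<^sub>R h x)"
      by simp
    then show "(LINT x|lebesgue_on Q. \<phi> x *\<^sub>R (g x - h x)) = 0"
      unfolding scaleR_diff_right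
      by (subst Bochner_Integration.integral_diff) (auto intro!: test_function_integrable[OF \<phi> _ Qm] li)
  qed
  then show ?thesis by simp
qed

lemma weak_deriv_diff:
  fixes u v :: "real ^ 'n \<Rightarrow> 'b::euclidean_space"
  assumes Q: "open Q" and u: "weak_deriv Q js u g" and v: "weak_deriv Q js v h"
  shows "weak_deriv Q js (\<lambda>x. u x - v x) (\<lambda>x. g x - h x)"
proof -
  have Qm: "Q \<in> sets lebesgue" using Q by (auto intro!: sets_completionI_sets)
  have li: "locally_integrable Q g" "locally_integrable Q h" "locally_integrable Q u" "locally_integrable Q v"
    using u v by (auto simp: weak_deriv_def)
  have "(LINT x|lebesgue_on Q. partials js \<phi> x *\<^sub>R (u x - v x)) =
      (-1) ^ length js *\<^sub>R (LINT x|lebesgue_on Q. \<phi> x *\<^sub>R (g x - h x))" if \<phi>: "\<phi> \<in> test_functions Q" for \<phi>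
  proof -
    note p\<phi> = test_functions_partials[OF \<phi>, of js]
    have "(LINT x|lebesgue_on Q. partials js \<phi> x *\<^sub>R (u x - v x)) =
        (LINT x|lebesgue_on Q. partials js \<phi> x *\<^sub>R u x) - (LINT x|lebesgue_on Q. partials js \<phi> x *\<^sub>R v x)"
      unfolding scaleR_diff_right
      by (rule Bochner_Integration.integral_diff) (intro test_function_integrable[OF p\<phi> _ Qm] li)+
    moreover have "(LINT x|lebesgue_on Q. \<phi> x *\<^sub>R (g x - h x)) =
        (LINT x|lebesgue_on Q. \<phi> x *\<^sub>R g x) - (LINT x|lebesgue_on Q. \<phi> x *\<^sub>R h x)"
      unfolding scaleR_diff_right
      by (rule Bochner_Integration.integral_diff) (intro test_function_integrable[OF \<phi> _ Qm] li)+
    ultimately show ?thesis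
      using u v \<phi> by (simp add: weak_deriv_def scaleR_diff_right)
  qed
  then show ?thesis
    unfolding weak_deriv_def using locally_integrable_diff li by blast
qed

text \<open>The weak derivative along \<open>js\<close> is tested with
  \<open>partial i \<phi>\<close>. Since the last direction of a list acts first on test functions,
  this is the identity for \<open>js @ [i]\<close>, and the common sign cancels.\<close>

lemma weak_deriv_snoc:
  fixes u :: "real ^ 'n \<Rightarrow> 'b::euclidean_space"
  assumes v: "weak_deriv Q js u v" and g: "weak_deriv Q (js @ [i]) u g"
  shows "weak_deriv Q [i] v g"
proof -
  have "(LINT x|lebesgue_on Q. partial i \<phi> x *\<^sub>R v x) = - (LINT x|lebesgue_on Q. \<phi> x *\<^sub>R g x)"
    if \<phi>: "\<phi> \<in> test_functions Q" for \<phi>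
  proof -
    have "(LINT x|lebesgue_on Q. partials (js @ [i]) \<phi> x *\<^sub>R u x) =
        ((-1) ^ length js :: real) *\<^sub>R (LINT x|lebesgue_on Q. partial i \<phi> x *\<^sub>R v x)"
      using v test_functions_partial[OF \<phi>, of i] by (simp add: weak_deriv_def partials_snoc)
    moreover have "(LINT x|lebesgue_on Q. partials (js @ [i]) \<phi> x *\<^sub>R u x) =
        ((-1) ^ length js :: real) *\<^sub>R - (LINT x|lebesgue_on Q. \<phi> x *\<^sub>R g x)"
      using g \<phi> by (simp add: weak_deriv_def)
    ultimately have "((-1) ^ length js :: real) *\<^sub>R (LINT x|lebesgue_on Q. partial i \<phi> x *\<^sub>R v x) =
        ((-1) ^ length js :: real) *\<^sub>R - (LINT x|lebesgue_on Q. \<phi> x *\<^sub>R g x)" by metis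
    then show ?thesis
      by (rule scaleR_left_imp_eq[rotated]) simp
  qed
  then show ?thesis
    using v g by (simp add: weak_deriv_def partials_Cons)
qed

section \<open>Gradients of Sobolev functions\<close>

text \<open>Rests on the completeness of Lebesgue measure.\<close>

lemma borel_measurable_lebesgue_on_AE:
  fixes f g :: "'a::euclidean_space \<Rightarrow> 'b::euclidean_space"
  assumes f: "f \<in> borel_measurable (lebesgue_on Q)" and Q: "Q \<in> sets lebesgue"
    and ae: "AE x in lebesgue_on Q. f x = g x"
  shows "g \<in> borel_measurable (lebesgue_on Q)"
proof -
  have "(\<lambda>x. indicat_real Q x *\<^sub>R f x) \<in> borel_measurable lebesgue"
    using f Q by (subst (asm) borel_measurable_restrict_space_iff) auto
  moreover have "AE x in lebesgue. indicat_real Q x *\<^sub>R f x = indicat_real Q x *\<^sub>R g x"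
    using ae Q by (subst (asm) AE_restrict_space_iff) (auto elim!: eventually_mono simp: indicator_def)
  ultimately have "(\<lambda>x. indicat_real Q x *\<^sub>R g x) \<in> borel_measurable lebesgue"
    by (rule borel_measurable_AE)
  then show ?thesis
    using Q by (subst borel_measurable_restrict_space_iff) auto
qed

lemma Lp_fun_AE:
  assumes f: "Lp_fun Q p f" and Q: "Q \<in> sets lebesgue" and ae: "AE x in lebesgue_on Q. f x = g x"
  shows "Lp_fun Q p g"
proof -
  have g: "g \<in> borel_measurable (lebesgue_on Q)"
    using borel_measurable_lebesgue_on_AE[OF _ Q ae] f by (simp add: Lp_fun_def)
  have "integrable (lebesgue_on Q) (\<lambda>x. norm (f x) powr p)" using f by (simp add: Lp_fun_def)
  then have "integrable (lebesgue_on Q) (\<lambda>x. norm (g x) powr p)"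
  proof (rule integrable_cong_AE_imp)
    show "AE x in lebesgue_on Q. norm (f x) powr p = norm (g x) powr p"
      using ae by eventually_elim simp
    show "(\<lambda>x. norm (g x) powr p) \<in> borel_measurable (lebesgue_on Q)"
      using g by measurable
  qed
  then show ?thesis using g by (simp add: Lp_fun_def)
qed

text \<open>\<open>in_sobolev\<close> provides some weak derivative in \<open>L^p\<close>, while
  \<open>wderiv\<close> may choose another one; almost everywhere uniqueness carries the
  integrability over.\<close>

lemma in_sobolev_wderiv:
  assumes Q: "open Q" and u: "in_sobolev Q k p u" and "length js \<le> k"
  shows "weak_deriv Q js u (wderiv Q js u)" and "Lp_fun Q p (wderiv Q js u)"
proof -
  have Qm: "Q \<in> sets lebesgue" using Q by (auto intro!: sets_completionI_sets)
  obtain g where g: "weak_deriv Q js u g" "Lp_fun Q p g"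
    using u \<open>length js \<le> k\<close> by (auto simp: in_sobolev_def)
  show w: "weak_deriv Q js u (wderiv Q js u)"
    unfolding wderiv_def using g(1) by (rule someI[of "weak_deriv Q js u"])
  show "Lp_fun Q p (wderiv Q js u)"
    by (rule Lp_fun_AE[OF g(2) Qm weak_deriv_unique[OF Q g(1) w]])
qed

text \<open>On a set of finite measure \<open>1 + norm (f x) powr p\<close> is integrable and
  dominates \<open>norm (f x)\<close>.\<close>

lemma Lp_fun_integrable:
  fixes f :: "real ^ 'n \<Rightarrow> 'b::euclidean_space"
  assumes f: "Lp_fun Q p f" and "1 \<le> p" and Q: "Q \<in> lmeasurable"
  shows "integrable (lebesgue_on Q) f"
proof (rule Bochner_Integration.integrable_bound)
  have "integrable (lebesgue_on Q) (\<lambda>x. 1 :: real)"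
    by (rule finite_measure.integrable_const[OF finite_measure_lebesgue_on[OF Q]])
  then show "integrable (lebesgue_on Q) (\<lambda>x. 1 + norm (f x) powr p)"
    using f by (auto simp: Lp_fun_def)
  show "AE x in lebesgue_on Q. norm (f x) \<le> norm (1 + norm (f x) powr p)"
  proof (intro AE_I2)
    fix x
    have "norm (f x) \<le> 1 + norm (f x) powr p"
      using powr_mono[of 1 p "norm (f x)"] \<open>1 \<le> p\<close> powr_ge_zero[of "norm (f x)" p]
      by (cases "norm (f x) \<le> 1") (linarith, simp)
    then show "norm (f x) \<le> norm (1 + norm (f x) powr p)" by simp
  qed
qed (use f in \<open>simp add: Lp_fun_def\<close>)

text \<open>Each summand in the \<open>p\<close>-th power of the Sobolev norm is at most the whole
  sum, whence the constant \<open>\<bar>R\<bar> powr p\<close>. The nested derivatives come from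
  appending directions to \<open>js\<close>.\<close>

lemma in_sobolev_sob_bdd:
  fixes u :: "real ^ 'n \<Rightarrow> 'b::euclidean_space"
  assumes Q: "open Q" "bounded Q" and u: "in_sobolev Q k p u" and p: "1 \<le> p"
    and R: "sobolev_norm Q k p u \<le> R" and "length js + m \<le> k"
  shows "sob_bdd Q p (\<bar>R\<bar> powr p) m (wderiv Q js u)"
proof -
  have Qm: "Q \<in> lmeasurable" using Q by (simp add: lmeasurable_open)
  have *: "lp_bdd Q p (\<bar>R\<bar> powr p) (wderiv Q js u)" if js: "length js \<le> k" for js
  proof -
    note L = in_sobolev_wderiv(2)[OF Q(1) u js]
    define N where "N js = Lp_norm Q p (wderiv Q js u) powr p" for js
    have N: "N js = (LINT x|lebesgue_on Q. norm (wderiv Q js u x) powr p)" for js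
      using p by (simp add: N_def Lp_norm_def powr_powr)
    have N_nonneg: "0 \<le> N js" for js by (simp add: N_def)
    have fin: "finite {js :: 'n list. length js \<le> k}"
      using finite_lists_length_le[of "UNIV :: 'n set" k] by simp
    have "N js \<le> (\<Sum>js \<in> {js. length js \<le> k}. N js)"
      using js fin by (intro member_le_sum) (auto simp: N_nonneg)
    also have "\<dots> = sobolev_norm Q k p u powr p"
      unfolding sobolev_norm_def N_def[symmetric] powr_powr
      using p by (simp add: sum_nonneg N_nonneg)
    also have "\<dots> \<le> \<bar>R\<bar> powr p"
      using R p by (intro powr_mono2) (auto simp: sobolev_norm_def)
    finally show ?thesis
      using L Lp_fun_integrable[OF L p Qm] by (simp add: lp_bdd_def N Lp_fun_def)
  qed
  show ?thesis
    using \<open>length js + m \<le> k\<close>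
  proof (induction m arbitrary: js)
    case 0
    then show ?case using * by simp
  next
    case (Suc m)
    have "weak_deriv Q [i] (wderiv Q js u) (wderiv Q (js @ [i]) u)" for i
      using Suc.prems by (intro weak_deriv_snoc[of Q js u] in_sobolev_wderiv(1)[OF Q(1) u]) auto
    moreover have "sob_bdd Q p (\<bar>R\<bar> powr p) m (wderiv Q (js @ [i]) u)" for i
      using Suc.prems by (intro Suc.IH) auto
    ultimately have "\<exists>g. \<forall>i. weak_deriv Q [i] (wderiv Q js u) (g i) \<and> sob_bdd Q p (\<bar>R\<bar> powr p) m (g i)"
      by (intro exI[of _ "\<lambda>i. wderiv Q (js @ [i]) u"]) simp
    then show ?case
      using *[of js] Suc.prems by simp
  qed
qed

section \<open>Semiconvexity on compact sets\<close>

text \<open>\<open>grad\<close> is a definite description, so the representing vector must be shown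
  both to exist, built from the basis, and to be unique.\<close>

lemma grad_inner:
  fixes f :: "'a::euclidean_space \<Rightarrow> real"
  assumes f: "(f has_derivative F) (at x)"
  shows "grad f x \<bullet> h = F h"
proof -
  interpret linear F using f by (rule has_derivative_linear)
  define D where "D = (\<Sum>b\<in>Basis. F b *\<^sub>R b)"
  have FD: "F h = h \<bullet> D" for h
  proof -
    have "F h = F (\<Sum>b\<in>Basis. (h \<bullet> b) *\<^sub>R b)" by (simp add: euclidean_representation)
    also have "\<dots> = h \<bullet> D"
      by (simp add: sum scale D_def inner_sum_right mult.commute)
    finally show ?thesis .
  qed
  have "GDERIV f x :> D" using f FD by (simp add: gderiv_def flip: FD)
  moreover have "D' = D" if "GDERIV f x :> D'" for D'
  proof -
    have "F = (\<lambda>h. h \<bullet> D')"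
      using has_derivative_unique[OF f] that by (simp add: gderiv_def)
    then have "(D' - D) \<bullet> D' = (D' - D) \<bullet> D" using FD by metis
    then have "(D' - D) \<bullet> (D' - D) = 0" by (simp add: inner_diff_right)
    then show ?thesis by simp
  qed
  ultimately have "grad f x = D" unfolding grad_def by (rule the_equality)
  then show ?thesis by (simp add: FD inner_commute)
qed

text \<open>The gap \<open>\<delta>\<close> between \<open>S\<close> and the complement of
  \<open>U\<close> decides which of the two cases of the overview applies; all constants come from
  suprema over compact sets.\<close>

lemma C2_semiconvex:
  fixes f :: "'a::euclidean_space \<Rightarrow> real"
  assumes f: "C2_on U f" and U: "open U" and S: "compact S" "S \<subseteq> U"
  obtains C where "continuous_on U f" "continuous_on U (grad f)"
    "\<And>x y. x \<in> S \<Longrightarrow> y \<in> S \<Longrightarrow> f x - f y - C * (norm (x - y))\<^sup>2 \<le> grad f x \<bullet> (x - y)"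
proof -
  obtain f' :: "'a \<Rightarrow> 'a \<Rightarrow>\<^sub>L real" and f'' :: "'a \<Rightarrow> 'a \<Rightarrow>\<^sub>L 'a \<Rightarrow>\<^sub>L real" where
    d1: "\<And>x. x \<in> U \<Longrightarrow> (f has_derivative blinfun_apply (f' x)) (at x)" and
    d2: "\<And>x. x \<in> U \<Longrightarrow> (f' has_derivative blinfun_apply (f'' x)) (at x)" and
    c2: "continuous_on U f''"
    using f unfolding C2_on_def by blast
  have c1: "continuous_on U f'"
    using d2 by (intro continuous_at_imp_continuous_on ballI has_derivative_continuous) blast
  have c0: "continuous_on U f"
    using d1 by (intro continuous_at_imp_continuous_on ballI has_derivative_continuous) blast
  obtain \<delta> where \<delta>: "0 < \<delta>" "(\<Union>x\<in>S. cball x \<delta>) \<subseteq> U"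
    using compact_subset_open_imp_cball_epsilon_subset[OF S(1) U S(2)] by blast
  \<comment> \<open>The closed \<open>\<delta>\<close>-neighbourhood of \<open>S\<close>, still
    compact and inside \<open>U\<close>: segments between nearby points of \<open>S\<close> may
    leave \<open>S\<close> but not \<open>T\<close>.\<close>
  define T where "T = {x + y | x y. x \<in> S \<and> y \<in> cball 0 \<delta>}"
  have T: "compact T" unfolding T_def by (rule compact_sums[OF S(1) compact_cball])
  have cT: "cball x \<delta> \<subseteq> T" if "x \<in> S" for x
  proof
    fix z assume "z \<in> cball x \<delta>"
    then have "z = x + (z - x)" "z - x \<in> cball 0 \<delta>" by (auto simp: dist_norm norm_minus_commute)
    then show "z \<in> T" unfolding T_def using that by blast
  qed
  have TU: "T \<subseteq> U"
  proof
    fix z assume "z \<in> T"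
    then obtain x y where "z = x + y" "x \<in> S" "norm y \<le> \<delta>" by (auto simp: T_def)
    then have "z \<in> cball x \<delta>" by (simp add: dist_norm)
    then show "z \<in> U" using \<delta>(2) \<open>x \<in> S\<close> by blast
  qed
  have bdd: "\<exists>M>0. \<forall>x\<in>A. norm (g x) \<le> M" if "continuous_on A g" "compact A"
    for g :: "'a \<Rightarrow> 'c::real_normed_vector" and A
  proof -
    have "bounded (g ` A)" using that by (intro compact_imp_bounded compact_continuous_image)
    then show ?thesis by (auto simp: bounded_pos)
  qed
  obtain M2 where M2: "0 < M2" "\<And>x. x \<in> T \<Longrightarrow> norm (f'' x) \<le> M2"
    using bdd[OF continuous_on_subset[OF c2 TU] T] by blast
  obtain M1 where M1: "0 < M1" "\<And>x. x \<in> S \<Longrightarrow> norm (f' x) \<le> M1"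
    using bdd[OF continuous_on_subset[OF c1 S(2)] S(1)] by blast
  obtain M0 where M0: "0 < M0" "\<And>x. x \<in> S \<Longrightarrow> \<bar>f x\<bar> \<le> M0"
    using bdd[OF continuous_on_subset[OF c0 S(2)] S(1)] by auto
  \<comment> \<open>\<open>M2\<close> serves pairs within \<open>\<delta>\<close>; the other two
    terms turn the bounds on \<open>f\<close> and \<open>f'\<close> into multiples of the squared
    distance for pairs farther apart.\<close>
  define C where "C = M2 + 2 * M0 / \<delta>\<^sup>2 + M1 / \<delta>"
  have CM2: "M2 \<le> C" and C': "2 * M0 / \<delta>\<^sup>2 + M1 / \<delta> \<le> C"
    using M0 M1 M2 \<delta> by (auto simp: C_def)
  have gr: "grad f x \<bullet> h = f' x h" if "x \<in> U" for x h
    by (rule grad_inner[OF d1[OF that]])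
  have "continuous_on U (\<lambda>x. \<Sum>b\<in>Basis. f' x b *\<^sub>R b)"
    by (intro continuous_intros c1)
  moreover have "(\<Sum>b\<in>Basis. f' x b *\<^sub>R b) = grad f x" if "x \<in> U" for x
    using euclidean_representation[of "grad f x"] by (simp add: gr that)
  ultimately have cg: "continuous_on U (grad f)"
    by (simp cong: continuous_on_cong)
  show thesis
  proof (rule that[OF c0 cg])
    fix x y assume x: "x \<in> S" and y: "y \<in> S"
    have "f x - f y - C * (norm (x - y))\<^sup>2 \<le> f' x (x - y)"
    proof (cases "norm (x - y) \<le> \<delta>")
      case True
      define L where "L = closed_segment x y"
      have LT: "L \<subseteq> cball x \<delta>"
        unfolding L_def using True \<delta>(1)
        by (intro closed_segment_subset) (auto simp: dist_norm)
      then have LU: "L \<subseteq> U" using cT[OF x] TU by blast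
      have Lx: "x \<in> L" "y \<in> L" by (simp_all add: L_def)
      have lip: "norm (f' z - f' x) \<le> M2 * norm (z - x)" if "z \<in> L" for z
      proof (rule differentiable_bound[of L])
        show "convex L" by (simp add: L_def)
        show "(f' has_derivative blinfun_apply (f'' u)) (at u within L)" if "u \<in> L" for u
          using d2[of u] that LU by (auto intro: has_derivative_at_withinI)
        show "onorm (blinfun_apply (f'' u)) \<le> M2" if "u \<in> L" for u
          using M2(2)[of u] that LT cT[OF x] by (auto simp: norm_blinfun.rep_eq)
      qed (use that Lx in auto)
      \<comment> \<open>Mean value inequality for \<open>f\<close> minus its linear part at
        \<open>x\<close>, whose derivative on the segment is small by \<open>lip\<close>. This gives
        \<open>M2\<close> where Taylor's formula gives half of it.\<close>
      have "norm ((f y - f' x y) - (f x - f' x x)) \<le> (M2 * norm (x - y)) * norm (y - x)"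
      proof (rule differentiable_bound[of L "\<lambda>z. f z - f' x z" "\<lambda>z. blinfun_apply (f' z - f' x)"])
        show "convex L" by (simp add: L_def)
        fix z assume z: "z \<in> L"
        have "(f has_derivative blinfun_apply (f' z)) (at z within L)"
          using d1[of z] z LU by (auto intro: has_derivative_at_withinI)
        then have "((\<lambda>z. f z - f' x z) has_derivative (\<lambda>h. f' z h - f' x h)) (at z within L)"
          by (auto intro!: derivative_eq_intros)
        then show "((\<lambda>z. f z - f' x z) has_derivative blinfun_apply (f' z - f' x)) (at z within L)"
          by (simp add: blinfun.diff_left[abs_def] minus_blinfun.rep_eq)
        have "norm (f' z - f' x) \<le> M2 * norm (z - x)" by (rule lip[OF z])
        also have "\<dots> \<le> M2 * norm (x - y)"
          using z M2(1) unfolding L_def by (intro mult_left_mono) (auto dest: segment_bound1 simp: norm_minus_commute)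
        finally show "onorm (blinfun_apply (f' z - f' x)) \<le> M2 * norm (x - y)"
          by (simp add: norm_blinfun.rep_eq)
      qed (use Lx in auto)
      then have "f x - f y - f' x (x - y) \<le> M2 * (norm (x - y))\<^sup>2"
        by (simp add: blinfun.diff_right power2_eq_square norm_minus_commute mult.assoc)
      also have "\<dots> \<le> C * (norm (x - y))\<^sup>2" using CM2 by (intro mult_right_mono) auto
      finally show ?thesis by simp
    next
      case False
      define d where "d = norm (x - y)"
      have d: "\<delta> < d" using False by (simp add: d_def)
      have "\<bar>f' x (x - y)\<bar> \<le> norm (f' x) * d"
        using norm_blinfun[of "f' x" "x - y"] by (simp add: d_def)
      also have "\<dots> \<le> M1 * d" using M1(2)[OF x] by (intro mult_right_mono) (auto simp: d_def)
      finally have "f x - f y - f' x (x - y) \<le> 2 * M0 + M1 * d"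
        using M0(2)[OF x] M0(2)[OF y] by linarith
      also have "2 * M0 \<le> 2 * M0 / \<delta>\<^sup>2 * d\<^sup>2"
      proof -
        have "\<delta>\<^sup>2 \<le> d\<^sup>2" using d \<delta>(1) by (intro power_mono) auto
        then have "2 * M0 * \<delta>\<^sup>2 \<le> 2 * M0 * d\<^sup>2" using M0(1) by (intro mult_left_mono) auto
        then show ?thesis using \<delta>(1) by (simp add: pos_le_divide_eq)
      qed
      also have "M1 * d \<le> M1 / \<delta> * d\<^sup>2"
      proof -
        have "M1 * d * \<delta> \<le> M1 * d * d" using d \<delta>(1) M1(1) by (intro mult_left_mono) auto
        then show ?thesis using \<delta>(1) by (simp add: pos_le_divide_eq power2_eq_square)
      qed
      finally have "f x - f y - f' x (x - y) \<le> (2 * M0 / \<delta>\<^sup>2 + M1 / \<delta>) * d\<^sup>2"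
        by (simp add: algebra_simps)
      also have "\<dots> \<le> C * d\<^sup>2" using C' by (rule mult_right_mono) simp
      finally show ?thesis by (simp add: d_def)
    qed
    then show "f x - f y - C * (norm (x - y))\<^sup>2 \<le> grad f x \<bullet> (x - y)"
      using gr x S(2) by auto
  qed
qed

section \<open>The energy inequality\<close>

lemma continuous_on_det: "continuous_on A (det :: real ^ 'n ^ 'n \<Rightarrow> real)"
  unfolding det_def by (intro continuous_intros)

text \<open>With a real integrable representative the positive and negative parts are both finite,
  so the \<open>ereal\<close> difference is an ordinary one.\<close>

lemma ext_integral_eq:
  assumes h: "integrable M h" and ae: "AE x in M. f x = ereal (h x)"
  shows "ext_integral M f = ereal (integral\<^sup>L M h)"
proof -
  have pos: "(\<integral>\<^sup>+x. e2ennreal (f x) \<partial>M) = (\<integral>\<^sup>+x. ennreal (h x) \<partial>M)"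
    using ae by (intro nn_integral_cong_AE) (auto elim!: eventually_mono simp: ennreal.abs_eq)
  have neg: "(\<integral>\<^sup>+x. e2ennreal (- f x) \<partial>M) = (\<integral>\<^sup>+x. ennreal (- h x) \<partial>M)"
    using ae by (intro nn_integral_cong_AE) (auto elim!: eventually_mono simp: ennreal.abs_eq)
  obtain r q where rq: "0 \<le> r" "0 \<le> q" "(\<integral>\<^sup>+x. ennreal (h x) \<partial>M) = ennreal r"
    "(\<integral>\<^sup>+x. ennreal (- h x) \<partial>M) = ennreal q" "integral\<^sup>L M h = r - q"
    using integrableE[OF h] by metis
  show ?thesis
    unfolding ext_integral_def pos neg rq using rq by (simp add: enn2ereal_ennreal)
qed

lemma borel_measurable_wgrad:
  assumes "\<And>j. wderiv Q [j] \<eta> \<in> borel_measurable M"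
  shows "wgrad Q \<eta> \<in> borel_measurable M"
proof -
  have "(\<lambda>x. wgrad Q \<eta> x \<bullet> b) \<in> borel_measurable M" if "b \<in> Basis" for b
  proof -
    obtain i j where b: "b = axis i (axis j 1)"
    proof -
      obtain i and u :: "real ^ 'a" where "u \<in> Basis" "b = axis i u"
        using \<open>b \<in> Basis\<close> unfolding Basis_vec_def by blast
      moreover obtain j where "u = axis j 1"
        using \<open>u \<in> Basis\<close> unfolding Basis_vec_def by auto
      ultimately show thesis using that by blast
    qed
    have "(\<lambda>x. wderiv Q [j] \<eta> x \<bullet> axis i 1) \<in> borel_measurable M"
      using assms by (intro borel_measurable_inner) auto
    then show ?thesis by (simp add: b inner_axis wgrad_def)
  qed
  then show ?thesis by (rule borel_measurable_euclidean_space[THEN iffD2, rule_format])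
qed

lemma norm_matrix_le:
  fixes A :: "real ^ 'n ^ 'n"
  assumes "\<And>i j. \<bar>A $ i $ j\<bar> \<le> c"
  shows "norm A \<le> real CARD('n) * (real CARD('n) * c)"
proof -
  have "norm (A $ i) \<le> real CARD('n) * c" for i
  proof -
    have "norm (A $ i) \<le> (\<Sum>j\<in>UNIV. \<bar>A $ i $ j\<bar>)" by (rule norm_le_l1_cart)
    also have "\<dots> \<le> (\<Sum>j\<in>(UNIV :: 'n set). c)" by (intro sum_mono assms)
    finally show ?thesis by simp
  qed
  then have "(\<Sum>i\<in>UNIV. norm (A $ i)) \<le> (\<Sum>i\<in>(UNIV :: 'n set). real CARD('n) * c)"
    by (intro sum_mono)
  moreover have "norm A \<le> (\<Sum>i\<in>UNIV. norm (A $ i))"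
    unfolding norm_vec_def by (rule L2_set_le_sum) simp
  ultimately show ?thesis by simp
qed

text \<open>The choice in \<open>wderiv\<close> is not linear, so this holds only almost everywhere,
  by uniqueness of weak derivatives.\<close>

lemma wgrad_diff:
  assumes Q: "open Q" and \<eta>: "in_sobolev Q k p \<eta>" and \<gamma>: "in_sobolev Q k p \<gamma>" and "1 \<le> k"
  shows "AE x in lebesgue_on Q. wgrad Q (\<lambda>x. \<eta> x - \<gamma> x) x = wgrad Q \<eta> x - wgrad Q \<gamma> x"
proof -
  have "AE x in lebesgue_on Q. wderiv Q [j] (\<lambda>x. \<eta> x - \<gamma> x) x = wderiv Q [j] \<eta> x - wderiv Q [j] \<gamma> x" for j
  proof (rule weak_deriv_unique[OF Q])
    show *: "weak_deriv Q [j] (\<lambda>x. \<eta> x - \<gamma> x) (\<lambda>x. wderiv Q [j] \<eta> x - wderiv Q [j] \<gamma> x)"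
      using \<open>1 \<le> k\<close> by (intro weak_deriv_diff[OF Q] in_sobolev_wderiv(1)[OF Q \<eta>] in_sobolev_wderiv(1)[OF Q \<gamma>]) auto
    show "weak_deriv Q [j] (\<lambda>x. \<eta> x - \<gamma> x) (wderiv Q [j] (\<lambda>x. \<eta> x - \<gamma> x))"
      unfolding wderiv_def using * by (rule someI[of "weak_deriv Q [j] (\<lambda>x. \<eta> x - \<gamma> x)"])
  qed
  then have "AE x in lebesgue_on Q. \<forall>j\<in>UNIV. wderiv Q [j] (\<lambda>x. \<eta> x - \<gamma> x) x = wderiv Q [j] \<eta> x - wderiv Q [j] \<gamma> x"
    by (intro AE_finite_allI) auto
  then show ?thesis
    by eventually_elim (simp add: wgrad_def vec_eq_iff)
qed

text \<open>The embedding is applied to each \<open>wderiv Q [j] \<eta>\<close>, which has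
  \<open>k - 1\<close> controlled derivatives left.\<close>

lemma wgrad_bounded:
  fixes Q :: "(real ^ 'n) set"
  assumes Q: "bounded_lipschitz_domain Q"
    and X: "(k = 2 \<and> p > real CARD('n)) \<or> (p = 2 \<and> real k > real CARD('n) / 2 + 1)"
  obtains M where "\<And>\<eta>. in_sobolev Q k p \<eta> \<Longrightarrow> sobolev_norm Q k p \<eta> \<le> R \<Longrightarrow>
    AE x in lebesgue_on Q. norm (wgrad Q \<eta> x) \<le> M"
proof -
  have oQ: "open Q" "bounded Q" using Q by (auto simp: bounded_lipschitz_domain_def)
  have Qm: "Q \<in> sets lebesgue" using oQ by (auto intro!: sets_completionI_sets)
  have n: "1 \<le> real CARD('n)" by (simp add: Suc_leI)
  have p: "1 \<le> p" by (rule disjE[OF X]) (use n in linarith)+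
  have k: "1 \<le> k"
  proof -
    have "0 < real k" using X n by auto
    then show ?thesis by simp
  qed
  \<comment> \<open>For \<open>k = 2\<close> this is \<open>n / p < 1\<close>; for
    \<open>p = 2\<close> it is \<open>n / 2 < k - 1\<close>.\<close>
  have m: "real CARD('n) / p < real (k - 1)"
    using X k n by (auto simp: of_nat_diff)
  obtain C where C: "\<And>v :: real ^ 'n \<Rightarrow> real ^ 'n. sob_bdd Q p (\<bar>R\<bar> powr p) (k - 1) v \<Longrightarrow>
      AE x in lebesgue. x \<in> Q \<longrightarrow> norm (v x) \<le> C"
    using sob_bdd_imp_bounded[OF Q p m] by blast
  show thesis
  proof
    fix \<eta> :: "real ^ 'n \<Rightarrow> real ^ 'n"
    assume \<eta>: "in_sobolev Q k p \<eta>" "sobolev_norm Q k p \<eta> \<le> R"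
    have "AE x in lebesgue_on Q. norm (wderiv Q [j] \<eta> x) \<le> C" for j
      using C[OF in_sobolev_sob_bdd[OF oQ \<eta>(1) p \<eta>(2), of "[j]" "k - 1"]] k Qm
      by (subst AE_restrict_space_iff) auto
    then have "AE x in lebesgue_on Q. \<forall>j\<in>UNIV. norm (wderiv Q [j] \<eta> x) \<le> C"
      by (intro AE_finite_allI) auto
    then show "AE x in lebesgue_on Q. norm (wgrad Q \<eta> x) \<le> real CARD('n) * (real CARD('n) * C)"
    proof eventually_elim
      case (elim x)
      show ?case
      proof (rule norm_matrix_le)
        show "\<bar>wgrad Q \<eta> x $ i $ j\<bar> \<le> C" for i j
          using elim component_le_norm_cart[of "wderiv Q [j] \<eta> x" i] by (auto simp: wgrad_def intro: order_trans)
      qed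
    qed
  qed
qed

theorem lemma2p6:
  fixes Q \<Gamma>D \<Gamma>N :: "(real ^ 'n) set"
    and k :: nat and p :: real
    and e :: "real ^ 'n ^ 'n \<Rightarrow> ereal"
    and E2 :: "(real ^ 'n \<Rightarrow> real ^ 'n) \<Rightarrow> real"
    and e_min :: real
  assumes Q: "bounded_lipschitz_domain Q"
    and boundary: "frontier Q = \<Gamma>D \<union> \<Gamma>N"
    and \<Gamma>D: "hausdorff_measure (CARD('n) - 1) \<Gamma>D > 0"
    and X: "(k = 2 \<and> p > real CARD('n)) \<or> (p = 2 \<and> real k > real CARD('n) / 2 + 1)"
    and E_1: "\<And>\<xi>. det \<xi> > 0 \<Longrightarrow> \<bar>e \<xi>\<bar> \<noteq> \<infinity>"
             "C2_on {\<xi>. det \<xi> > 0} (\<lambda>\<xi>. real_of_ereal (e \<xi>))"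
    and E_2: "\<And>\<xi>. e \<xi> \<ge> ereal e_min"
    and E_3: "\<And>K::real. \<exists>\<epsilon>\<^sub>0 > 0. \<forall>\<eta> \<in> sobolev_space Q k p. energy Q e E2 \<eta> \<le> ereal K \<longrightarrow>
                (AE x in lebesgue_on Q. det (wgrad Q \<eta> x) \<ge> \<epsilon>\<^sub>0)"
    and E_4: "(e \<longlongrightarrow> \<infinity>) (filtercomap det (at_right 0))"
             "\<And>\<xi>. det \<xi> \<le> 0 \<Longrightarrow> e \<xi> = \<infinity>"
    and E_5: "convex_on_sobolev Q k p E2"
             "differentiable_on_sobolev Q k p E2"
             "coercive_on_admissible Q k p \<Gamma>D e E2"
  shows "\<forall>K::real. \<exists>C\<^sub>1::real. \<forall>\<eta>\<^sub>0 \<in> admissible Q k p \<Gamma>D. \<forall>\<eta>\<^sub>1 \<in> admissible Q k p \<Gamma>D.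
           energy Q e E2 \<eta>\<^sub>0 \<le> ereal K \<and> energy Q e E2 \<eta>\<^sub>1 \<le> ereal K \<longrightarrow>
           ereal (DE1 Q e \<eta>\<^sub>1 (\<lambda>x. \<eta>\<^sub>1 x - \<eta>\<^sub>0 x)) \<ge>
             E1 Q e \<eta>\<^sub>1 - E1 Q e \<eta>\<^sub>0
             - ereal (C\<^sub>1 * (Lp_norm Q 2 (\<lambda>x. wgrad Q \<eta>\<^sub>1 x - wgrad Q \<eta>\<^sub>0 x))\<^sup>2)"
proof
  fix K :: real
  define f where "f = (\<lambda>\<xi>. real_of_ereal (e \<xi>))"
  define U where "U = {\<xi> :: real ^ 'n ^ 'n. det \<xi> > 0}"
  have oQ: "open Q" "bounded Q" using Q by (auto simp: bounded_lipschitz_domain_def)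
  have Qm: "Q \<in> sets lebesgue" using oQ by (auto intro!: sets_completionI_sets)
  have "Q \<in> lmeasurable" using oQ by (simp add: lmeasurable_open)
  then interpret finite_measure "lebesgue_on Q" by (rule finite_measure_lebesgue_on)
  have k: "1 \<le> k"
  proof -
    have "0 < real k" using X by auto
    then show ?thesis by simp
  qed
  obtain R where R: "\<And>\<eta>. \<eta> \<in> admissible Q k p \<Gamma>D \<Longrightarrow> energy Q e E2 \<eta> \<le> ereal K \<Longrightarrow> sobolev_norm Q k p \<eta> \<le> R"
    using E_5(3) unfolding coercive_on_admissible_def by blast
  obtain M where M: "\<And>\<eta>. in_sobolev Q k p \<eta> \<Longrightarrow> sobolev_norm Q k p \<eta> \<le> R \<Longrightarrow>
    AE x in lebesgue_on Q. norm (wgrad Q \<eta> x) \<le> M"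
    using wgrad_bounded[OF Q X, of R] by blast
  obtain \<epsilon> where \<epsilon>: "0 < \<epsilon>" "\<And>\<eta>. \<eta> \<in> sobolev_space Q k p \<Longrightarrow> energy Q e E2 \<eta> \<le> ereal K \<Longrightarrow>
      AE x in lebesgue_on Q. det (wgrad Q \<eta> x) \<ge> \<epsilon>"
    using E_3[of K] by blast
  define S where "S = cball 0 M \<inter> {\<xi> :: real ^ 'n ^ 'n. \<epsilon> \<le> det \<xi>}"
  have "closed {\<xi> :: real ^ 'n ^ 'n. \<epsilon> \<le> det \<xi>}"
    by (intro closed_Collect_le continuous_on_const continuous_on_det)
  then have S: "compact S" unfolding S_def by (intro compact_Int_closed compact_cball)
  have SU: "S \<subseteq> U" using \<epsilon>(1) by (auto simp: S_def U_def)
  have oU: "open U" unfolding U_def by (intro open_Collect_less continuous_on_const continuous_on_det)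
  have C2: "C2_on U f" using E_1(2) by (simp add: U_def f_def)
  obtain C where cf: "continuous_on U f" and cg: "continuous_on U (grad f)" and
    C: "\<And>\<xi> \<zeta>. \<xi> \<in> S \<Longrightarrow> \<zeta> \<in> S \<Longrightarrow> f \<xi> - f \<zeta> - C * (norm (\<xi> - \<zeta>))\<^sup>2 \<le> grad f \<xi> \<bullet> (\<xi> - \<zeta>)"
    using C2_semiconvex[OF C2 oU S SU] by blast
  \<comment> \<open>\<open>f\<close> and \<open>grad f\<close> are known to be continuous only on
    \<open>U\<close>; cutting them off outside gives Borel functions on all matrices that are
    unchanged on \<open>S\<close>.\<close>
  define g where "g \<xi> = indicat_real U \<xi> *\<^sub>R f \<xi>" for \<xi>
  define g' where "g' \<xi> = indicat_real U \<xi> *\<^sub>R grad f \<xi>" for \<xi>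
  have gm: "g \<in> borel_measurable borel" "g' \<in> borel_measurable borel"
    unfolding g_def[abs_def] g'_def[abs_def]
    by (intro borel_measurable_continuous_on_indicator borel_open oU cf cg)+
  have gS: "g \<xi> = f \<xi>" "g' \<xi> = grad f \<xi>" if "\<xi> \<in> S" for \<xi>
    using that SU by (auto simp: g_def g'_def)
  obtain B where B: "\<And>\<xi>. \<xi> \<in> S \<Longrightarrow> \<bar>f \<xi>\<bar> \<le> B"
    using compact_imp_bounded[OF compact_continuous_image[OF continuous_on_subset[OF cf SU] S]]
    by (auto simp: bounded_iff)
  obtain B' where B': "\<And>\<xi>. \<xi> \<in> S \<Longrightarrow> norm (grad f \<xi>) \<le> B'"
    using compact_imp_bounded[OF compact_continuous_image[OF continuous_on_subset[OF cg SU] S]]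
    by (auto simp: bounded_iff)
  have sub: "in_sobolev Q k p \<eta> \<and> (AE x in lebesgue_on Q. wgrad Q \<eta> x \<in> S) \<and>
      wgrad Q \<eta> \<in> borel_measurable (lebesgue_on Q) \<and>
      integrable (lebesgue_on Q) (\<lambda>x. g (wgrad Q \<eta> x)) \<and>
      E1 Q e \<eta> = ereal (LINT x|lebesgue_on Q. g (wgrad Q \<eta> x))"
    if \<eta>: "\<eta> \<in> admissible Q k p \<Gamma>D" "energy Q e E2 \<eta> \<le> ereal K" for \<eta>
  proof -
    have s: "\<eta> \<in> sobolev_space Q k p" using \<eta> by (simp add: admissible_def)
    then have i: "in_sobolev Q k p \<eta>" by (simp add: sobolev_space_def)
    have inS: "AE x in lebesgue_on Q. wgrad Q \<eta> x \<in> S"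
      using M[OF i R[OF \<eta>]] \<epsilon>(2)[OF s \<eta>(2)] by eventually_elim (simp add: S_def)
    have m: "wgrad Q \<eta> \<in> borel_measurable (lebesgue_on Q)"
      using in_sobolev_wderiv(2)[OF oQ(1) i] k by (intro borel_measurable_wgrad) (auto simp: Lp_fun_def)
    have gi: "integrable (lebesgue_on Q) (\<lambda>x. g (wgrad Q \<eta> x))"
    proof (rule integrable_const_bound[where B = B])
      show "AE x in lebesgue_on Q. norm (g (wgrad Q \<eta> x)) \<le> B"
        using inS by eventually_elim (simp add: gS B)
      show "(\<lambda>x. g (wgrad Q \<eta> x)) \<in> borel_measurable (lebesgue_on Q)"
        by (rule measurable_compose[OF m gm(1)])
    qed
    \<comment> \<open>On \<open>S\<close> the density is finite, so \<open>real_of_ereal\<close>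
      loses nothing.\<close>
    have "AE x in lebesgue_on Q. e (wgrad Q \<eta> x) = ereal (g (wgrad Q \<eta> x))"
      using inS
    proof eventually_elim
      case (elim x)
      then have "det (wgrad Q \<eta> x) > 0" using SU by (auto simp: U_def)
      then show ?case using E_1(1) elim by (simp add: gS f_def ereal_real)
    qed
    then have "E1 Q e \<eta> = ereal (LINT x|lebesgue_on Q. g (wgrad Q \<eta> x))"
      unfolding E1_def by (rule ext_integral_eq[OF gi])
    with i inS m gi show ?thesis by blast
  qed
  show "\<exists>C\<^sub>1::real. \<forall>\<eta>\<^sub>0 \<in> admissible Q k p \<Gamma>D. \<forall>\<eta>\<^sub>1 \<in> admissible Q k p \<Gamma>D.
           energy Q e E2 \<eta>\<^sub>0 \<le> ereal K \<and> energy Q e E2 \<eta>\<^sub>1 \<le> ereal K \<longrightarrow>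
           ereal (DE1 Q e \<eta>\<^sub>1 (\<lambda>x. \<eta>\<^sub>1 x - \<eta>\<^sub>0 x)) \<ge>
             E1 Q e \<eta>\<^sub>1 - E1 Q e \<eta>\<^sub>0
             - ereal (C\<^sub>1 * (Lp_norm Q 2 (\<lambda>x. wgrad Q \<eta>\<^sub>1 x - wgrad Q \<eta>\<^sub>0 x))\<^sup>2)"
  proof (intro exI[of _ C] ballI impI)
    fix \<eta>0 \<eta>1
    assume adm: "\<eta>0 \<in> admissible Q k p \<Gamma>D" "\<eta>1 \<in> admissible Q k p \<Gamma>D"
      and en: "energy Q e E2 \<eta>0 \<le> ereal K \<and> energy Q e E2 \<eta>1 \<le> ereal K"
    define W0 where "W0 = wgrad Q \<eta>0"
    define W1 where "W1 = wgrad Q \<eta>1"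
    have 0: "in_sobolev Q k p \<eta>0" "AE x in lebesgue_on Q. W0 x \<in> S" "W0 \<in> borel_measurable (lebesgue_on Q)"
      "integrable (lebesgue_on Q) (\<lambda>x. g (W0 x))" "E1 Q e \<eta>0 = ereal (LINT x|lebesgue_on Q. g (W0 x))"
      unfolding W0_def using sub[OF adm(1)] en by auto
    have 1: "in_sobolev Q k p \<eta>1" "AE x in lebesgue_on Q. W1 x \<in> S" "W1 \<in> borel_measurable (lebesgue_on Q)"
      "integrable (lebesgue_on Q) (\<lambda>x. g (W1 x))" "E1 Q e \<eta>1 = ereal (LINT x|lebesgue_on Q. g (W1 x))"
      unfolding W1_def using sub[OF adm(2)] en by auto
    have bd: "AE x in lebesgue_on Q. norm (W1 x - W0 x) \<le> 2 * M"
      using 0(2) 1(2)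
    proof eventually_elim
      case (elim x)
      then show ?case using norm_triangle_ineq4[of "W1 x" "W0 x"] by (auto simp: S_def)
    qed
    have dm: "(\<lambda>x. W1 x - W0 x) \<in> borel_measurable (lebesgue_on Q)" using 0(3) 1(3) by measurable
    define h where "h x = g' (W1 x) \<bullet> (W1 x - W0 x)" for x
    have hi: "integrable (lebesgue_on Q) h"
    proof (rule integrable_const_bound[where B = "B' * (2 * M)"])
      show "AE x in lebesgue_on Q. norm (h x) \<le> B' * (2 * M)"
        using 1(2) bd
      proof eventually_elim
        case (elim x)
        have "norm (h x) \<le> norm (g' (W1 x)) * norm (W1 x - W0 x)"
          unfolding h_def real_norm_def by (rule Cauchy_Schwarz_ineq2)
        also have "\<dots> \<le> B' * (2 * M)"
          using elim B'[of "W1 x"] gS(2)[of "W1 x"] by (intro mult_mono) (auto intro: order_trans[OF norm_ge_zero])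
        finally show ?case .
      qed
      have "(\<lambda>x. g' (W1 x)) \<in> borel_measurable (lebesgue_on Q)"
        by (rule measurable_compose[OF 1(3) gm(2)])
      then show "h \<in> borel_measurable (lebesgue_on Q)"
        unfolding h_def[abs_def] using dm by (rule borel_measurable_inner)
    qed
    have sq: "integrable (lebesgue_on Q) (\<lambda>x. (norm (W1 x - W0 x))\<^sup>2)"
    proof (rule integrable_const_bound[where B = "(2 * M)\<^sup>2"])
      show "AE x in lebesgue_on Q. norm ((norm (W1 x - W0 x))\<^sup>2) \<le> (2 * M)\<^sup>2"
        using bd
      proof eventually_elim
        case (elim x)
        then have "(norm (W1 x - W0 x))\<^sup>2 \<le> (2 * M)\<^sup>2" by (rule power_mono) simp
        then show ?case by simp
      qed
      show "(\<lambda>x. (norm (W1 x - W0 x))\<^sup>2) \<in> borel_measurable (lebesgue_on Q)" using dm by measurable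
    qed
    \<comment> \<open>\<open>DE1\<close> contains the gradient of the difference, while
      \<open>h\<close> contains the difference of the gradients.\<close>
    have ae: "AE x in lebesgue_on Q. h x = grad f (W1 x) \<bullet> wgrad Q (\<lambda>x. \<eta>1 x - \<eta>0 x) x"
      using 1(2) wgrad_diff[OF oQ(1) 1(1) 0(1) k]
    proof eventually_elim
      case (elim x)
      then show ?case by (simp add: h_def gS W1_def W0_def)
    qed
    note hm = borel_measurable_integrable[OF hi]
    have "DE1 Q e \<eta>1 (\<lambda>x. \<eta>1 x - \<eta>0 x) = integral\<^sup>L (lebesgue_on Q) h"
      unfolding DE1_def f_def[symmetric] W1_def[symmetric]
      by (rule integral_cong_AE[symmetric, OF hm borel_measurable_lebesgue_on_AE[OF hm Qm ae] ae])
    moreover have "(Lp_norm Q 2 (\<lambda>x. W1 x - W0 x))\<^sup>2 = (LINT x|lebesgue_on Q. (norm (W1 x - W0 x))\<^sup>2)"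
      by (simp add: Lp_norm_def powr_half_sqrt)
    moreover have "(LINT x|lebesgue_on Q. g (W1 x)) - (LINT x|lebesgue_on Q. g (W0 x))
        - C * (LINT x|lebesgue_on Q. (norm (W1 x - W0 x))\<^sup>2) \<le> integral\<^sup>L (lebesgue_on Q) h"
    proof -
      have "(LINT x|lebesgue_on Q. g (W1 x) - g (W0 x) - C * (norm (W1 x - W0 x))\<^sup>2) \<le> integral\<^sup>L (lebesgue_on Q) h"
      proof (rule integral_mono_AE)
        show "AE x in lebesgue_on Q. g (W1 x) - g (W0 x) - C * (norm (W1 x - W0 x))\<^sup>2 \<le> h x"
          using 0(2) 1(2) by eventually_elim (simp add: h_def gS C)
      qed (use 0(4) 1(4) sq hi in auto)
      then show ?thesis using 0(4) 1(4) sq by simp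
    qed
    ultimately show "E1 Q e \<eta>1 - E1 Q e \<eta>0
             - ereal (C * (Lp_norm Q 2 (\<lambda>x. wgrad Q \<eta>1 x - wgrad Q \<eta>0 x))\<^sup>2)
          \<le> ereal (DE1 Q e \<eta>1 (\<lambda>x. \<eta>1 x - \<eta>0 x))"
      unfolding 0(5) 1(5) W0_def[symmetric] W1_def[symmetric] by simp
  qed
qed

end
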